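(* Let $G$ be a virtually polycyclic group whose Hirsch number is different from $1$. Then $G$ admits a strongly aperiodic SFT.
   Context: A group is polycyclic if it admits a subnormal series with cyclic factors; virtually polycyclic if it has a polycyclic subgroup of finite index. The Hirsch number $h(G)$ is the number of infinite factors in a subnormal series of $G$ whose factors are cyclic or finite (it is independent of the series). For a finite set $A$ and a group $G$, $A^G$ is the set of functions $G\to A$ with the product topology, with $G$-action $(g\cdot x)_h = x_{g^{-1}h}$. A pattern is a partial function from $G$ to $A$ with finite support. A subshift of finite type (SFT) on $G$ is a set of the form $\{x\in A^G : \forall g\in G, \forall P\in\mathcal{P}, \exists h\in\mathrm{Supp}(P), (g\cdot x)_h\neq P_h\}$ for a finite set $\mathcal{P}$ of patterns. A subshift $X$ is strongly aperiodic if it is nonempty and every point $x\in X$ has finite stabilizer $\{g : g\cdot x = x\}$. *)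

theory Defs
  imports "HOL-Algebra.Elementary_Groups" "HOL-Algebra.Group_Action"
begin

definition subnormal_series :: "('g, 'm) monoid_scheme \<Rightarrow> 'g set list \<Rightarrow> bool" where
  "subnormal_series G Hs \<longleftrightarrow>
     Hs \<noteq> [] \<and> hd Hs = {\<one>\<^bsub>G\<^esub>} \<and> last Hs = carrier G \<and>
     (\<forall>H\<in>set Hs. subgroup H G) \<and>
     (\<forall>i. Suc i < length Hs \<longrightarrow> Hs ! i \<lhd> G\<lparr>carrier := Hs ! Suc i\<rparr>)"

definition series_factor :: "('g, 'm) monoid_scheme \<Rightarrow> 'g set list \<Rightarrow> nat \<Rightarrow> 'g set monoid" where
  "series_factor G Hs i = G\<lparr>carrier := Hs ! Suc i\<rparr> Mod (Hs ! i)"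

definition polycyclic :: "('g, 'm) monoid_scheme \<Rightarrow> bool" where
  "polycyclic G \<longleftrightarrow>
     (\<exists>Hs. subnormal_series G Hs \<and>
        (\<forall>i. Suc i < length Hs \<longrightarrow> cyclic_group (series_factor G Hs i)))"

definition virtually_polycyclic :: "('g, 'm) monoid_scheme \<Rightarrow> bool" where
  "virtually_polycyclic G \<longleftrightarrow>
     (\<exists>H. subgroup H G \<and> finite (rcosets\<^bsub>G\<^esub> H) \<and> polycyclic (G\<lparr>carrier := H\<rparr>))"

definition cyclic_or_finite_series :: "('g, 'm) monoid_scheme \<Rightarrow> 'g set list \<Rightarrow> bool" where
  "cyclic_or_finite_series G Hs \<longleftrightarrow>
     subnormal_series G Hs \<and>
     (\<forall>i. Suc i < length Hs \<longrightarrow>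
        cyclic_group (series_factor G Hs i) \<or> finite (carrier (series_factor G Hs i)))"

definition infinite_factor_count :: "('g, 'm) monoid_scheme \<Rightarrow> 'g set list \<Rightarrow> nat" where
  "infinite_factor_count G Hs =
     card {i. Suc i < length Hs \<and> infinite (carrier (series_factor G Hs i))}"

(* The count does not depend on the series, so the choice is immaterial whenever a series
   exists, which is the case for every virtually polycyclic group. Without a series the
   value is unspecified. *)
definition hirsch_number :: "('g, 'm) monoid_scheme \<Rightarrow> nat" where
  "hirsch_number G =
     infinite_factor_count G (SOME Hs. cyclic_or_finite_series G Hs)"

(* A^G is represented by the extensional functions, which are undefined off the carrier,
   so that equality of configurations is equality on the carrier. *)
definition configurations :: "('g, 'm) monoid_scheme \<Rightarrow> 'a set \<Rightarrow> ('g \<Rightarrow> 'a) set" where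
  "configurations G A = (carrier G \<rightarrow>\<^sub>E A)"

definition shift :: "('g, 'm) monoid_scheme \<Rightarrow> 'g \<Rightarrow> ('g \<Rightarrow> 'a) \<Rightarrow> ('g \<Rightarrow> 'a)" where
  "shift G g x = (\<lambda>h\<in>carrier G. x (inv\<^bsub>G\<^esub> g \<otimes>\<^bsub>G\<^esub> h))"

definition is_pattern :: "('g, 'm) monoid_scheme \<Rightarrow> 'a set \<Rightarrow> ('g \<rightharpoonup> 'a) \<Rightarrow> bool" where
  "is_pattern G A P \<longleftrightarrow> finite (dom P) \<and> dom P \<subseteq> carrier G \<and> ran P \<subseteq> A"

definition SFT_of ::
    "('g, 'm) monoid_scheme \<Rightarrow> 'a set \<Rightarrow> ('g \<rightharpoonup> 'a) set \<Rightarrow> ('g \<Rightarrow> 'a) set" where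
  "SFT_of G A \<P> =
     {x \<in> configurations G A.
        \<forall>g\<in>carrier G. \<forall>P\<in>\<P>. \<exists>h\<in>dom P. shift G g x h \<noteq> the (P h)}"

definition is_SFT :: "('g, 'm) monoid_scheme \<Rightarrow> 'a set \<Rightarrow> ('g \<Rightarrow> 'a) set \<Rightarrow> bool" where
  "is_SFT G A S \<longleftrightarrow>
     (\<exists>\<P>. finite \<P> \<and> (\<forall>P\<in>\<P>. is_pattern G A P) \<and> S = SFT_of G A \<P>)"

definition strongly_aperiodic :: "('g, 'm) monoid_scheme \<Rightarrow> ('g \<Rightarrow> 'a) set \<Rightarrow> bool" where
  "strongly_aperiodic G S \<longleftrightarrow>
     S \<noteq> {} \<and> (\<forall>x\<in>S. finite (stabilizer G (shift G) x))"

end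

theory Submission
  imports Defs "HOL-Analysis.Function_Topology"
begin

text \<open>Climb along a series with cyclic or finite factors. Suppose \<open>G = N \<langle>t\<rangle>\<close> with \<open>G / N\<close> infinite
  cyclic and \<open>N\<close> infinite, finitely generated and amenable. As in Kari's aperiodic tile set, let
  every coset \<open>N t\<^sup>k\<close> carry digits in \<open>{0, 1, 2}\<close> of some density, and force by bounded carries that
  the density is multiplied by \<open>2\<close> or by \<open>2/3\<close> when passing from \<open>N t\<^sup>k\<close> to \<open>N t\<^sup>k\<^sup>+\<^sup>1\<close>. Carries are
  coboundaries, which invariant means on \<open>N\<close> do not see, so a period outside \<open>N\<close> would give a
  relation \<open>2\<^sup>n = 3\<^sup>m\<close> with \<open>n > 0\<close>: all periods lie in \<open>N\<close>. Such configurations exist: the digits are Beatty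
  sequences along the cosets of \<open>\<langle>e\<rangle>\<close> for an element \<open>e\<close> of \<open>N\<close> of infinite order, the real-valued
  carries are explicit, and a bounded real flow with integral divergence can be rounded to
  an integral one.

  Intersections of the period group with \<open>N\<close> are controlled by a subshift on \<open>N\<close> used on each coset
  of \<open>N\<close>. This is the induction hypothesis unless \<open>N\<close> is virtually infinite cyclic; then \<open>t\<^sup>2\<close> commutes
  with an element of infinite order of \<open>N\<close>, and the same construction on the resulting copy of \<open>\<int>\<^sup>2\<close>,
  graded in the other direction, suffices. Finite factors are harmless.\<close>

section \<open>Rounding of flows\<close>

text \<open>Every nonempty SFT over an infinite virtually cyclic group has a point with infinite
  stabilizer, so at Hirsch number 1 the induction has no subshift to hand on. It records a cyclic
  subgroup of finite index instead, and the step from 1 to 2 has to find a second grading.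
  Conjugation by t may distort N: a step e taken at \<open>g \<otimes> t\<close> is a step t e t^-1
  as seen from g. The carries of two adjacent levels therefore run in different directions and
  cannot be merged into one sequence. The exact real carries take infinitely many values; a finite
  alphabet requires rounding both kinds at once while keeping their total divergence, hence the
  flows. The multipliers 2 and 2/3 come from the integral relations 2d = d' and 2d = 3d': factors 2
  on one side, odd factors on the other, so a return to the same density contradicts parity. Upper
  densities take the place of a chosen mean. They are extremal values of means, scale as means do,
  and can be handled through coboundaries alone.\<close>

lemma underdetermined_system:
  fixes m :: "'v \<Rightarrow> 'e \<Rightarrow> real"
  assumes "finite V" "finite F" "card V < card F"
  obtains g where "\<exists>e\<in>F. g e \<noteq> 0" "\<And>j. j \<in> V \<Longrightarrow> (\<Sum>e\<in>F. m j e * g e) = 0"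
proof -
  have "\<exists>g. (\<exists>e\<in>F. g e \<noteq> 0) \<and> (\<forall>j\<in>V. (\<Sum>e\<in>F. m j e * g e) = 0)"
    using assms
  proof (induction V arbitrary: F m rule: finite_induct)
    case empty
    then obtain e where "e \<in> F" by fastforce
    then show ?case by (intro exI[of _ "\<lambda>_. 1"]) auto
  next
    case (insert j V)
    show ?case
    proof (cases "\<forall>e\<in>F. m j e = 0")
      case True
      obtain g where "\<exists>e\<in>F. g e \<noteq> 0" "\<forall>i\<in>V. (\<Sum>e\<in>F. m i e * g e) = 0"
        using insert.IH[of F m] insert.prems insert.hyps by auto
      with True show ?thesis by (intro exI[of _ g]) auto
    next
      case False
      then obtain e0 where e0: "e0 \<in> F" "m j e0 \<noteq> 0" by blast
      define F' where "F' = F - {e0}"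
      \<comment> \<open>Row \<open>j\<close> is the pivot: \<open>m'\<close> is the system after
        elimination of the unknown \<open>e0\<close>, and \<open>g'\<close> below recovers its value
        from row \<open>j\<close>.\<close>
      define m' where "m' i e = m i e - m i e0 * m j e / m j e0" for i e
      have "finite F'" "card V < card F'"
        using insert.prems insert.hyps e0 by (auto simp: F'_def)
      then obtain g where g: "\<exists>e\<in>F'. g e \<noteq> 0" "\<forall>i\<in>V. (\<Sum>e\<in>F'. m' i e * g e) = 0"
        using insert.IH[of F' m'] by auto
      define s where "s = (\<Sum>e\<in>F'. m j e * g e)"
      define g' where "g' = g(e0 := - s / m j e0)"
      have split: "(\<Sum>e\<in>F. m i e * g' e) = m i e0 * g' e0 + (\<Sum>e\<in>F'. m i e * g e)" for i
        unfolding F'_def sum.remove[OF \<open>finite F\<close> e0(1)] g'_def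
        by (auto intro!: sum.cong)
      have "(\<Sum>e\<in>F. m j e * g' e) = 0"
        unfolding split using e0 by (simp add: g'_def s_def)
      moreover have "(\<Sum>e\<in>F. m i e * g' e) = 0" if "i \<in> V" for i
      proof -
        have "0 = (\<Sum>e\<in>F'. m i e * g e - (m i e0 / m j e0) * (m j e * g e))"
          using g(2) that by (simp add: m'_def algebra_simps)
        also have "\<dots> = (\<Sum>e\<in>F'. m i e * g e) - (m i e0 / m j e0) * s"
          by (simp add: sum_subtractf s_def sum_distrib_left)
        finally show ?thesis unfolding split by (simp add: g'_def)
      qed
      moreover have "\<exists>e\<in>F. g' e \<noteq> 0"
        using g(1) by (auto simp: g'_def F'_def)
      ultimately show ?thesis by blast
    qed
  qed
  then show ?thesis using that by blast
qed

text \<open>The oriented incidence matrix of a directed multigraph. A loop cancels to 0, so all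
  entries are -1, 0 or 1.\<close>

definition incidence :: "('e \<Rightarrow> 'v) \<Rightarrow> ('e \<Rightarrow> 'v) \<Rightarrow> 'v \<Rightarrow> 'e \<Rightarrow> real" where
  "incidence src tgt j e = of_bool (tgt e = j) - of_bool (src e = j)"

text \<open>Double counting: the vertices of \<open>V\<close> touched by \<open>F\<close> have
  degree at least 2, and an edge has at most two ends, so there are at most as many equations as
  unknowns. In case of equality every edge has two distinct ends in \<open>W\<close>; then the
  equations add up to 0 and one of them follows from the others.\<close>

lemma nonzero_circulation:
  assumes "finite V" "finite F" "F \<noteq> {}"
    and deg: "\<And>j. j \<in> V \<Longrightarrow> card {e\<in>F. incidence src tgt j e \<noteq> 0} \<noteq> 1"
  obtains g where "\<exists>e\<in>F. g e \<noteq> 0" "\<And>j. j \<in> V \<Longrightarrow> (\<Sum>e\<in>F. incidence src tgt j e * g e) = 0"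
proof -
  let ?m = "incidence src tgt"
  define W where "W = {j\<in>V. \<exists>e\<in>F. ?m j e \<noteq> 0}"
  have finW: "finite W" using assms by (simp add: W_def)
  have ends: "{j\<in>W. ?m j e \<noteq> 0} \<subseteq> {src e, tgt e}" for e
    by (auto simp: incidence_def split: if_splits)
  have ends2: "card {src e, tgt e} \<le> 2" for e by (simp add: card_insert_if)
  have le2: "card {j\<in>W. ?m j e \<noteq> 0} \<le> 2" for e
    using card_mono[OF _ ends[of e]] ends2[of e] by simp
  have ge2: "2 \<le> card {e\<in>F. ?m j e \<noteq> 0}" if "j \<in> W" for j
  proof -
    have "card {e\<in>F. ?m j e \<noteq> 0} \<noteq> 0" "card {e\<in>F. ?m j e \<noteq> 0} \<noteq> 1"
      using that deg[of j] \<open>finite F\<close> by (auto simp: W_def)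
    then show ?thesis by linarith
  qed
  have dc: "(\<Sum>j\<in>W. card {e\<in>F. ?m j e \<noteq> 0}) = (\<Sum>e\<in>F. card {j\<in>W. ?m j e \<noteq> 0})"
    by (rule sum_multicount_gen) (use finW assms in auto)
  have lower: "2 * card W \<le> (\<Sum>j\<in>W. card {e\<in>F. ?m j e \<noteq> 0})"
    using sum_mono[of W "\<lambda>_. 2" "\<lambda>j. card {e\<in>F. ?m j e \<noteq> 0}"] ge2 by simp
  have upper: "(\<Sum>e\<in>F. card {j\<in>W. ?m j e \<noteq> 0}) \<le> 2 * card F"
    using sum_mono[of F "\<lambda>e. card {j\<in>W. ?m j e \<noteq> 0}" "\<lambda>_. 2"] le2 by simp
  note goal = that
  have done_if: thesis if g: "\<exists>e\<in>F. g e \<noteq> 0" "\<forall>j\<in>W. (\<Sum>e\<in>F. ?m j e * g e) = 0" for g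
  proof (rule goal[of g])
    show "(\<Sum>e\<in>F. ?m j e * g e) = 0" if "j \<in> V" for j
    proof (cases "j \<in> W")
      case False
      then show ?thesis using that by (auto simp: W_def intro!: sum.neutral)
    qed (use g in blast)
  qed (use g in blast)
  show thesis
  proof (cases "card W < card F")
    case True
    then show thesis
      using underdetermined_system[OF finW \<open>finite F\<close>, where m = ?m] done_if by metis
  next
    case False
    then have eq: "card W = card F" "(\<Sum>e\<in>F. card {j\<in>W. ?m j e \<noteq> 0}) = 2 * card F"
      using dc lower upper by linarith+
    have eq2: "card {j\<in>W. ?m j e \<noteq> 0} = 2" if "e \<in> F" for e
    proof (rule ccontr)
      assume "card {j\<in>W. ?m j e \<noteq> 0} \<noteq> 2"
      then have "card {j\<in>W. ?m j e \<noteq> 0} < 2" using le2[of e] by linarith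
      then have "(\<Sum>e\<in>F. card {j\<in>W. ?m j e \<noteq> 0}) < (\<Sum>e\<in>F. 2)"
        using that le2 \<open>finite F\<close> by (intro sum_strict_mono_ex1) auto
      then show False using eq by simp
    qed
    have zero: "(\<Sum>j\<in>W. ?m j e) = 0" if "e \<in> F" for e
    proof -
      have st: "src e \<in> W" "tgt e \<in> W" "src e \<noteq> tgt e"
      proof -
        have "{j\<in>W. ?m j e \<noteq> 0} = {src e, tgt e}"
          using ends[of e] eq2[OF that] ends2[of e]
          by (intro card_seteq) auto
        moreover from this have "src e \<noteq> tgt e" using eq2[OF that] by auto
        ultimately show "src e \<in> W" "tgt e \<in> W" "src e \<noteq> tgt e" by auto
      qed
      then show ?thesis
        by (simp add: incidence_def sum_subtractf of_bool_def sum.delta finW)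
    qed
    have "F \<noteq> {}" "card F > 0" using assms by (auto simp: card_gt_0_iff)
    then obtain j0 where j0: "j0 \<in> W" using eq by fastforce
    have "card (W - {j0}) < card F" using eq j0 finW \<open>card F > 0\<close> by (simp add: card_Diff_singleton)
    then obtain g where g: "\<exists>e\<in>F. g e \<noteq> 0" "\<And>j. j \<in> W - {j0} \<Longrightarrow> (\<Sum>e\<in>F. ?m j e * g e) = 0"
      using underdetermined_system[of "W - {j0}" F ?m] finW \<open>finite F\<close> by blast
    have "(\<Sum>j\<in>W. \<Sum>e\<in>F. ?m j e * g e) = (\<Sum>e\<in>F. (\<Sum>j\<in>W. ?m j e) * g e)"
      by (subst sum.swap) (simp add: sum_distrib_right)
    also have "\<dots> = 0" by (simp add: zero)
    finally have "(\<Sum>e\<in>F. ?m j0 e * g e) = 0"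
      using sum.remove[OF finW j0, of "\<lambda>j. \<Sum>e\<in>F. ?m j e * g e"] g(2) by simp
    then show thesis using g done_if by blast
  qed
qed

text \<open>Fractional edges carry a circulation; pushing along it until some edge becomes integral
  decreases their number.\<close>
lemma flow_rounding_finite:
  fixes a :: "'e \<Rightarrow> real"
  assumes "finite V" "finite E"
    and "\<And>j. j \<in> V \<Longrightarrow> (\<Sum>e\<in>E. incidence src tgt j e * a e) \<in> \<int>"
  obtains b :: "'e \<Rightarrow> int" where "\<And>e. e \<in> E \<Longrightarrow> b e \<in> {\<lfloor>a e\<rfloor>..\<lceil>a e\<rceil>}"
    "\<And>j. j \<in> V \<Longrightarrow> (\<Sum>e\<in>E. incidence src tgt j e * of_int (b e)) = (\<Sum>e\<in>E. incidence src tgt j e * a e)"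
proof -
  let ?m = "incidence src tgt"
  have "\<exists>b :: 'e \<Rightarrow> int. (\<forall>e\<in>E. b e \<in> {\<lfloor>a e\<rfloor>..\<lceil>a e\<rceil>}) \<and>
      (\<forall>j\<in>V. (\<Sum>e\<in>E. ?m j e * of_int (b e)) = (\<Sum>e\<in>E. ?m j e * a e))"
    using assms(3)
  proof (induction "card {e\<in>E. a e \<notin> \<int>}" arbitrary: a rule: less_induct)
    case less
    define F where "F = {e\<in>E. a e \<notin> \<int>}"
    have finF: "finite F" using assms by (simp add: F_def)
    show ?case
    proof (cases "F = {}")
      case True
      then have "of_int \<lfloor>a e\<rfloor> = a e" if "e \<in> E" for e
        using that by (auto simp: F_def)
      then have "(\<Sum>e\<in>E. ?m j e * of_int \<lfloor>a e\<rfloor>) = (\<Sum>e\<in>E. ?m j e * a e)" for j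
        by (intro sum.cong) auto
      moreover have "\<lfloor>a e\<rfloor> \<le> \<lceil>a e\<rceil>" for e by linarith
      ultimately show ?thesis by (intro exI[of _ "\<lambda>e. \<lfloor>a e\<rfloor>"]) auto
    next
      case False
      \<comment> \<open>If exactly one fractional edge met a vertex, the divergence there would be
        fractional.\<close>
      have deg: "card {e\<in>F. ?m j e \<noteq> 0} \<noteq> 1" if j: "j \<in> V" for j
      proof
        assume "card {e\<in>F. ?m j e \<noteq> 0} = 1"
        then obtain e where e: "{e\<in>F. ?m j e \<noteq> 0} = {e}" by (rule card_1_singletonE)
        then have eF: "e \<in> F" "?m j e \<noteq> 0" by auto
        then have eE: "e \<in> E" by (simp add: F_def)
        have others: "?m j e' * a e' \<in> \<int>" if "e' \<in> E - {e}" for e'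
        proof (cases "e' \<in> F")
          case True
          with that e have "?m j e' = 0" by blast
          then show ?thesis by simp
        next
          case False
          with that have "a e' \<in> \<int>" by (auto simp: F_def)
          then show ?thesis by (auto simp: incidence_def)
        qed
        have "?m j e * a e = (\<Sum>e\<in>E. ?m j e * a e) - (\<Sum>e\<in>E-{e}. ?m j e * a e)"
          using sum.remove[OF \<open>finite E\<close> eE, of "\<lambda>e. ?m j e * a e"] by simp
        also have "\<dots> \<in> \<int>" using others by (intro Ints_diff[OF less.prems[OF j] Ints_sum])
        finally have "?m j e * a e \<in> \<int>" .
        moreover have "?m j e = 1 \<or> ?m j e = -1"
          using eF by (auto simp: incidence_def of_bool_def split: if_splits)
        ultimately have "a e \<in> \<int>" by (auto simp: minus_in_Ints_iff)
        with eF show False by (simp add: F_def)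
      qed
      obtain g where g: "\<exists>e\<in>F. g e \<noteq> 0" "\<And>j. j \<in> V \<Longrightarrow> (\<Sum>e\<in>F. ?m j e * g e) = 0"
        using nonzero_circulation[OF \<open>finite V\<close> finF False deg] by blast
      define F' where "F' = {e\<in>F. g e \<noteq> 0}"
      \<comment> \<open>\<open>\<mu> e\<close> is the time at which edge \<open>e\<close>, changing
        at speed \<open>g e\<close>, reaches an integer. Up to the earliest such time
        \<open>\<kappa>\<close> every edge stays between its floor and its ceiling.\<close>
      define \<mu> where "\<mu> e = ((if g e > 0 then of_int \<lceil>a e\<rceil> else of_int \<lfloor>a e\<rfloor>) - a e) / g e" for e
      define \<kappa> where "\<kappa> = Min (\<mu> ` F')"
      have F': "finite F'" "F' \<noteq> {}" using finF g by (auto simp: F'_def)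
      have \<mu>_pos: "\<mu> e > 0" if "e \<in> F'" for e
      proof -
        have "a e \<notin> \<int>" "g e \<noteq> 0" using that by (auto simp: F'_def F_def)
        then have "a e < of_int \<lceil>a e\<rceil>" "of_int \<lfloor>a e\<rfloor> < a e"
          by (metis Ints_of_int le_of_int_ceiling less_eq_real_def)
             (metis Ints_of_int of_int_floor_le less_eq_real_def \<open>a e \<notin> \<int>\<close>)
        then show ?thesis using \<open>g e \<noteq> 0\<close>
          by (auto simp: \<mu>_def divide_simps)
      qed
      have \<kappa>: "0 < \<kappa>" "\<And>e. e \<in> F' \<Longrightarrow> \<kappa> \<le> \<mu> e"
        using F' \<mu>_pos by (auto simp: \<kappa>_def)
      obtain e1 where e1: "e1 \<in> F'" "\<kappa> = \<mu> e1"
        using Min_in[of "\<mu> ` F'"] F' unfolding \<kappa>_def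
        by blast
      define a' where "a' e = (if e \<in> F' then a e + \<kappa> * g e else a e)" for e
      have box: "a' e \<in> {of_int \<lfloor>a e\<rfloor>..of_int \<lceil>a e\<rceil>}" for e
      proof (cases "e \<in> F'")
        case True
        then have ge: "g e \<noteq> 0" by (simp add: F'_def)
        show ?thesis
        proof (cases "g e > 0")
          case True
          have "\<kappa> * g e \<le> \<mu> e * g e" using \<kappa>(2)[OF \<open>e \<in> F'\<close>] True by simp
          moreover have "0 \<le> \<kappa> * g e" using True \<kappa>(1) by simp
          ultimately show ?thesis using True \<open>e \<in> F'\<close>
            by (auto simp: a'_def \<mu>_def add_increasing2)
        next
          case False
          with ge have neg: "g e < 0" by simp
          have "\<mu> e * g e \<le> \<kappa> * g e" using \<kappa>(2)[OF \<open>e \<in> F'\<close>] neg by simp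
          moreover have "\<kappa> * g e \<le> 0" using neg \<kappa>(1) by (simp add: mult_le_0_iff)
          moreover have "a e \<le> of_int \<lceil>a e\<rceil>" by simp
          ultimately show ?thesis using neg \<open>e \<in> F'\<close>
            by (auto simp: a'_def \<mu>_def simp del: le_of_int_ceiling)
        qed
      qed (simp add: a'_def)
      have int_e1: "a' e1 \<in> \<int>"
        using e1 by (auto simp: a'_def \<mu>_def F'_def)
      have a'_int: "a' e \<in> \<int>" if "e \<in> E" "a e \<in> \<int>" for e
        using that by (auto simp: a'_def F'_def F_def)
      have "{e\<in>E. a' e \<notin> \<int>} \<subset> F"
        using e1 int_e1 a'_int by (auto simp: F_def F'_def)
      then have smaller: "card {e\<in>E. a' e \<notin> \<int>} < card {e\<in>E. a e \<notin> \<int>}"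
        using finF psubset_card_mono unfolding F_def by blast
      have net: "(\<Sum>e\<in>E. ?m j e * a' e) = (\<Sum>e\<in>E. ?m j e * a e)" if "j \<in> V" for j
      proof -
        have "(\<Sum>e\<in>E. ?m j e * a' e) = (\<Sum>e\<in>E. ?m j e * a e + (if e \<in> F then \<kappa> * (?m j e * g e) else 0))"
          by (intro sum.cong) (auto simp: a'_def F'_def algebra_simps)
        also have "\<dots> = (\<Sum>e\<in>E. ?m j e * a e) + (\<Sum>e\<in>F. \<kappa> * (?m j e * g e))"
          using assms(2) by (simp add: sum.distrib sum.inter_filter F_def)
        also have "(\<Sum>e\<in>F. \<kappa> * (?m j e * g e)) = 0"
          using g(2)[OF that] by (simp add: sum_distrib_left[symmetric])
        finally show ?thesis by simp
      qed
      obtain b :: "'e \<Rightarrow> int" where b: "\<forall>e\<in>E. b e \<in> {\<lfloor>a' e\<rfloor>..\<lceil>a' e\<rceil>}"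
        "\<forall>j\<in>V. (\<Sum>e\<in>E. ?m j e * of_int (b e)) = (\<Sum>e\<in>E. ?m j e * a' e)"
        using less.hyps[OF smaller] less.prems net by auto
      have "\<lfloor>a e\<rfloor> \<le> \<lfloor>a' e\<rfloor>" "\<lceil>a' e\<rceil> \<le> \<lceil>a e\<rceil>" for e
        using box[of e] by (auto simp: le_floor_iff ceiling_le_iff)
      then have "\<forall>e\<in>E. b e \<in> {\<lfloor>a e\<rfloor>..\<lceil>a e\<rceil>}"
        using b(1) by (meson atLeastAtMost_iff order_trans)
      with b net show ?thesis by auto
    qed
  qed
  then show ?thesis using that by blast
qed

section \<open>Passage to infinite graphs by compactness\<close>

text \<open>Tychonoff: a constraint that reads finitely many coordinates is closed in the compact
  product of the finite discrete spaces \<open>B e\<close>, and \<open>sat\<close> is the finite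
  intersection property.\<close>

lemma finite_choice_compactness:
  fixes B :: "'e \<Rightarrow> 'b set" and supp :: "'v \<Rightarrow> 'e set"
  assumes fin: "\<And>e. e \<in> E \<Longrightarrow> finite (B e)"
    and supp: "\<And>j. j \<in> V \<Longrightarrow> finite (supp j) \<and> supp j \<subseteq> E"
    and loc: "\<And>j x y. j \<in> V \<Longrightarrow> (\<And>e. e \<in> supp j \<Longrightarrow> x e = y e) \<Longrightarrow> L j x \<Longrightarrow> L j y"
    and sat: "\<And>W. finite W \<Longrightarrow> W \<subseteq> V \<Longrightarrow> \<exists>x\<in>Pi E B. \<forall>j\<in>W. L j x"
  shows "\<exists>x\<in>Pi E B. \<forall>j\<in>V. L j x"
proof -
  define T where "T = product_topology (\<lambda>e. discrete_topology (B e)) E"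
  have top: "topspace T = Pi\<^sub>E E B" by (simp add: T_def)
  have "compact_space T"
    unfolding T_def compact_space_product_topology by (simp add: fin compact_space_discrete_topology)
  have pre: "closedin T {x \<in> topspace T. x e = p}" if "e \<in> E" for e p
  proof -
    have "closedin T {x \<in> topspace T. x e \<in> {p} \<inter> B e}"
      by (rule closedin_continuous_map_preimage[of _ "discrete_topology (B e)"])
         (auto simp: T_def that intro: continuous_map_product_projection)
    moreover have "{x \<in> topspace T. x e \<in> {p} \<inter> B e} = {x \<in> topspace T. x e = p}"
      using that by (auto simp: top)
    ultimately show ?thesis by simp
  qed
  define C where "C j = {x \<in> topspace T. L j x}" for j
  have closed: "closedin T (C j)" if j: "j \<in> V" for j
  proof -
    define R where "R = {p \<in> Pi\<^sub>E (supp j) B. L j p}"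
    have "finite (Pi\<^sub>E (supp j) B)"
      using supp[OF j] fin by (intro finite_PiE) auto
    then have finR: "finite R" by (simp add: R_def)
    \<comment> \<open>A finite union of cylinders, one for each admissible assignment on
      \<open>supp j\<close>.\<close>
    have eq: "C j = (\<Union>p\<in>R. topspace T \<inter> (\<Inter>e\<in>supp j. {x \<in> topspace T. x e = p e}))"
    proof (intro equalityI subsetI)
      fix x assume x: "x \<in> C j"
      have "restrict x (supp j) \<in> R"
        using x supp[OF j] loc[OF j, of x "restrict x (supp j)"] by (auto simp: R_def C_def top)
      then show "x \<in> (\<Union>p\<in>R. topspace T \<inter> (\<Inter>e\<in>supp j. {x \<in> topspace T. x e = p e}))"
        using x by (intro UN_I[of "restrict x (supp j)"]) (auto simp: C_def)
    next
      fix x assume "x \<in> (\<Union>p\<in>R. topspace T \<inter> (\<Inter>e\<in>supp j. {x \<in> topspace T. x e = p e}))"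
      then obtain p where p: "p \<in> R" "x \<in> topspace T" "\<forall>e\<in>supp j. x e = p e" by auto
      then show "x \<in> C j"
        using loc[OF j, of p x] by (auto simp: R_def C_def)
    qed
    have "closedin T (topspace T \<inter> (\<Inter>e\<in>supp j. {x \<in> topspace T. x e = p e}))" for p
    proof (cases "supp j = {}")
      case False
      then show ?thesis
        using supp[OF j] pre by (intro closedin_Int closedin_topspace closedin_INT) auto
    qed simp
    then show ?thesis unfolding eq by (intro closedin_Union) (use finR in auto)
  qed
  have "\<Inter> (insert (topspace T) (C ` V)) \<noteq> {}"
  proof -
    have "\<Inter>\<F> \<noteq> {}" if \<F>: "finite \<F>" "\<F> \<subseteq> insert (topspace T) (C ` V)" for \<F>
    proof -
      obtain W where W: "finite W" "W \<subseteq> V" "\<F> - {topspace T} = C ` W"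
        using finite_subset_image[of "\<F> - {topspace T}" C V] \<F>
        by (metis Diff_subset_conv finite_Diff insert_is_Un)
      obtain x where x: "x \<in> Pi E B" "\<forall>j\<in>W. L j x" using sat[OF W(1,2)] by blast
      have xT: "restrict x E \<in> topspace T" using x by (auto simp: top)
      have "restrict x E \<in> C j" if "j \<in> W" for j
      proof -
        have "j \<in> V" using that W by blast
        have "x e = restrict x E e" if "e \<in> supp j" for e
          using supp[OF \<open>j \<in> V\<close>] that by auto
        moreover have "L j x" using x that by blast
        ultimately have "L j (restrict x E)" by (rule loc[OF \<open>j \<in> V\<close>])
        then show ?thesis using xT by (simp add: C_def)
      qed
      then have "restrict x E \<in> \<Inter>\<F>"
        using xT W(3) by blast
      then show ?thesis by blast
    qed
    moreover have "\<forall>S\<in>insert (topspace T) (C ` V). closedin T S" using closed by auto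
    ultimately show ?thesis
      using \<open>compact_space T\<close> unfolding compact_space_fip by meson
  qed
  then obtain x where "x \<in> topspace T" "\<forall>j\<in>V. x \<in> C j" by auto
  then show ?thesis by (intro bexI[of _ x]) (auto simp: C_def top)
qed

text \<open>Each edge has finitely many candidate values and each vertex finitely many edges, so
  compactness reduces the claim to finitely many vertices, hence to finitely many edges.\<close>

lemma flow_rounding:
  fixes a :: "'e \<Rightarrow> real"
  assumes fin: "\<And>j. j \<in> V \<Longrightarrow> finite {e\<in>E. incidence src tgt j e \<noteq> 0}"
    and int: "\<And>j. j \<in> V \<Longrightarrow> (\<Sum>e\<in>{e\<in>E. incidence src tgt j e \<noteq> 0}. incidence src tgt j e * a e) \<in> \<int>"
  obtains b :: "'e \<Rightarrow> int" where "\<And>e. e \<in> E \<Longrightarrow> b e \<in> {\<lfloor>a e\<rfloor>..\<lceil>a e\<rceil>}"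
    "\<And>j. j \<in> V \<Longrightarrow> (\<Sum>e\<in>{e\<in>E. incidence src tgt j e \<noteq> 0}. incidence src tgt j e * of_int (b e))
       = (\<Sum>e\<in>{e\<in>E. incidence src tgt j e \<noteq> 0}. incidence src tgt j e * a e)"
proof -
  let ?m = "incidence src tgt"
  let ?S = "\<lambda>j. {e\<in>E. ?m j e \<noteq> 0}"
  have "\<exists>b\<in>Pi E (\<lambda>e. {\<lfloor>a e\<rfloor>..\<lceil>a e\<rceil>}). \<forall>j\<in>V.
      (\<Sum>e\<in>?S j. ?m j e * of_int (b e)) = (\<Sum>e\<in>?S j. ?m j e * a e)"
  proof (rule finite_choice_compactness[where supp = ?S])
    fix W assume W: "finite W" "W \<subseteq> V"
    define E' where "E' = (\<Union>j\<in>W. ?S j)"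
    have finE': "finite E'" using W fin by (auto simp: E'_def)
    have restr: "(\<Sum>e\<in>E'. ?m j e * h e) = (\<Sum>e\<in>?S j. ?m j e * h e)" if "j \<in> W" for j h
      using that finE' by (intro sum.mono_neutral_right) (auto simp: E'_def)
    have "(\<Sum>e\<in>E'. ?m j e * a e) \<in> \<int>" if "j \<in> W" for j
      using int[of j] W that by (auto simp: restr)
    then obtain b :: "'e \<Rightarrow> int" where b: "\<And>e. e \<in> E' \<Longrightarrow> b e \<in> {\<lfloor>a e\<rfloor>..\<lceil>a e\<rceil>}"
      "\<And>j. j \<in> W \<Longrightarrow> (\<Sum>e\<in>E'. ?m j e * of_int (b e)) = (\<Sum>e\<in>E'. ?m j e * a e)"
      using flow_rounding_finite[OF W(1) finE', of src tgt a] by blast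
    \<comment> \<open>Edges outside \<open>E'\<close> enter no equation at a vertex of
      \<open>W\<close>, so any value in their range will do.\<close>
    define b' where "b' e = (if e \<in> E' then b e else \<lfloor>a e\<rfloor>)" for e
    have "\<lfloor>a e\<rfloor> \<le> \<lceil>a e\<rceil>" for e by linarith
    then have "b' \<in> Pi E (\<lambda>e. {\<lfloor>a e\<rfloor>..\<lceil>a e\<rceil>})" using b(1) by (auto simp: b'_def)
    moreover have "(\<Sum>e\<in>?S j. ?m j e * of_int (b' e)) = (\<Sum>e\<in>?S j. ?m j e * a e)" if "j \<in> W" for j
    proof -
      have "(\<Sum>e\<in>E'. ?m j e * of_int (b' e)) = (\<Sum>e\<in>E'. ?m j e * of_int (b e))"
        by (intro sum.cong) (auto simp: b'_def)
      then show ?thesis using b(2)[OF that] by (simp add: restr[OF that, symmetric])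
    qed
    ultimately show "\<exists>b\<in>Pi E (\<lambda>e. {\<lfloor>a e\<rfloor>..\<lceil>a e\<rceil>}). \<forall>j\<in>W.
      (\<Sum>e\<in>?S j. ?m j e * of_int (b e)) = (\<Sum>e\<in>?S j. ?m j e * a e)" by blast
  next
    fix j x y
    assume "\<And>e. e \<in> ?S j \<Longrightarrow> x e = (y e :: int)"
    then have "(\<Sum>e\<in>?S j. ?m j e * of_int (x e)) = (\<Sum>e\<in>?S j. ?m j e * of_int (y e))"
      by (intro sum.cong) auto
    then show "(\<Sum>e\<in>?S j. ?m j e * of_int (x e)) = (\<Sum>e\<in>?S j. ?m j e * a e) \<Longrightarrow>
      (\<Sum>e\<in>?S j. ?m j e * of_int (y e)) = (\<Sum>e\<in>?S j. ?m j e * a e)" by simp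
  qed (use fin in auto)
  then show ?thesis using that by fast
qed

section \<open>Invariant means\<close>

text \<open>Finite sums of differences between a bounded function and a right translate of it; every
  right-invariant mean vanishes on them. Translations act on the right because periods act on the
  left.\<close>

inductive coboundary :: "('g, 'm) monoid_scheme \<Rightarrow> ('g \<Rightarrow> real) \<Rightarrow> bool" for G where
  zero: "(\<And>u. u \<in> carrier G \<Longrightarrow> h u = 0) \<Longrightarrow> coboundary G h"
| step: "coboundary G h \<Longrightarrow> k \<in> carrier G \<Longrightarrow> (\<And>u. u \<in> carrier G \<Longrightarrow> \<bar>f u\<bar> \<le> C) \<Longrightarrow>
    (\<And>u. u \<in> carrier G \<Longrightarrow> h' u = h u + (f (u \<otimes>\<^bsub>G\<^esub> k) - f u)) \<Longrightarrow> coboundary G h'"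

text \<open>A coboundary bounded above by a negative constant is the obstruction to an invariant mean.\<close>
definition amenable :: "('g, 'm) monoid_scheme \<Rightarrow> bool" where
  "amenable G \<longleftrightarrow> (\<forall>h \<delta>. coboundary G h \<longrightarrow> (\<forall>u\<in>carrier G. h u \<le> \<delta>) \<longrightarrow> 0 \<le> \<delta>)"

text \<open>The largest value of an invariant mean on \<open>f\<close>.\<close>
definition upper_density :: "('g, 'm) monoid_scheme \<Rightarrow> ('g \<Rightarrow> real) \<Rightarrow> real" where
  "upper_density G f = Inf {M. \<exists>h. coboundary G h \<and> (\<forall>u\<in>carrier G. f u + h u \<le> M)}"

lemma coboundary_cong:
  assumes "coboundary G h" "\<And>u. u \<in> carrier G \<Longrightarrow> h' u = h u"
  shows "coboundary G h'"
  using assms by (cases rule: coboundary.cases) (auto intro: coboundary.intros)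

lemma coboundary_translate:
  assumes "k \<in> carrier G" "\<And>u. u \<in> carrier G \<Longrightarrow> \<bar>f u\<bar> \<le> C"
  shows "coboundary G (\<lambda>u. f (u \<otimes>\<^bsub>G\<^esub> k) - f u)"
  by (rule coboundary.step[where h = "\<lambda>_. 0", OF coboundary.zero]) (use assms in auto)

lemma coboundary_add:
  assumes "coboundary G h" "coboundary G h'"
  shows "coboundary G (\<lambda>u. h u + h' u)"
  using assms(2)
proof (induction rule: coboundary.induct)
  case (zero h')
  then show ?case by (intro coboundary_cong[OF assms(1)]) auto
next
  case (step h' k f C h'')
  show ?case
    by (rule coboundary.step[OF step.IH step.hyps(2), where f = f]) (use step.hyps in auto)
qed

lemma coboundary_scale:
  assumes "coboundary G h"
  shows "coboundary G (\<lambda>u. c * h u)"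
  using assms
proof (induction rule: coboundary.induct)
  case (zero h)
  then show ?case by (intro coboundary.zero) auto
next
  case (step h k f C h')
  show ?case
  proof (rule coboundary.step[OF step.IH step.hyps(2), where f = "\<lambda>u. c * f u"])
    show "\<bar>c * f u\<bar> \<le> \<bar>c\<bar> * C" if "u \<in> carrier G" for u
      using step.hyps(3)[OF that] by (simp add: abs_mult mult_left_mono)
  qed (simp_all add: step.hyps(4) algebra_simps)
qed

lemma coboundary_sum:
  assumes "\<And>i. i \<in> I \<Longrightarrow> coboundary G (h i)"
  shows "coboundary G (\<lambda>u. \<Sum>i\<in>I. h i u)"
  using assms
proof (induction I rule: infinite_finite_induct)
  case (insert i I)
  then show ?case by (simp add: coboundary_add)
qed (auto intro: coboundary.zero)

text \<open>Meant for maps u -> s u t^-n, by which a period s identifies two levels: they turn right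
  translation by \<open>k\<close> into right translation by a conjugate of \<open>k\<close>.\<close>

lemma coboundary_reindex:
  assumes "coboundary G h" "\<And>u. u \<in> carrier G \<Longrightarrow> \<psi> u \<in> carrier G"
    and \<psi>: "\<And>k. k \<in> carrier G \<Longrightarrow> \<exists>k'\<in>carrier G. \<forall>u\<in>carrier G. \<psi> (u \<otimes>\<^bsub>G\<^esub> k') = \<psi> u \<otimes>\<^bsub>G\<^esub> k"
  shows "coboundary G (\<lambda>u. h (\<psi> u))"
  using assms(1)
proof (induction rule: coboundary.induct)
  case (zero h)
  then show ?case by (intro coboundary.zero) (auto simp: assms)
next
  case (step h k f C h')
  obtain k' where k': "k' \<in> carrier G" "\<forall>u\<in>carrier G. \<psi> (u \<otimes>\<^bsub>G\<^esub> k') = \<psi> u \<otimes>\<^bsub>G\<^esub> k"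
    using \<psi> step.hyps(2) by blast
  show ?case
    by (rule coboundary.step[OF step.IH k'(1), where f = "\<lambda>u. f (\<psi> u)"])
       (use step.hyps k' assms(2) in auto)
qed

section \<open>Upper densities\<close>

lemma upper_density_bdd:
  assumes "amenable G" "\<And>u. u \<in> carrier G \<Longrightarrow> \<bar>f u\<bar> \<le> C"
  shows "bdd_below {M. \<exists>h. coboundary G h \<and> (\<forall>u\<in>carrier G. f u + h u \<le> M)}"
proof (rule bdd_belowI[of _ "-C"], clarify)
  fix M h assume h: "coboundary G h" "\<forall>u\<in>carrier G. f u + h u \<le> M"
  have "\<forall>u\<in>carrier G. h u \<le> M + C" using h(2) assms(2) by fastforce
  then show "- C \<le> M" using assms(1) h(1) unfolding amenable_def by fastforce
qed

lemma upper_density_nonempty: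
  assumes "\<And>u. u \<in> carrier G \<Longrightarrow> \<bar>f u\<bar> \<le> C"
  shows "{M. \<exists>h. coboundary G h \<and> (\<forall>u\<in>carrier G. f u + h u \<le> M)} \<noteq> {}"
proof -
  have "coboundary G (\<lambda>_. 0)" by (rule coboundary.zero) simp
  moreover have "\<forall>u\<in>carrier G. f u + 0 \<le> C" using assms by fastforce
  ultimately show ?thesis by (auto intro!: exI[of _ C] exI[of _ "\<lambda>_. 0"])
qed

lemma upper_density_ge:
  assumes "amenable G" "\<And>u. u \<in> carrier G \<Longrightarrow> \<bar>f u\<bar> \<le> C" "\<And>u. u \<in> carrier G \<Longrightarrow> \<epsilon> \<le> f u"
  shows "\<epsilon> \<le> upper_density G f"
  unfolding upper_density_def
proof (rule cInf_greatest)
  fix M assume "M \<in> {M. \<exists>h. coboundary G h \<and> (\<forall>u\<in>carrier G. f u + h u \<le> M)}"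
  then obtain h where h: "coboundary G h" "\<forall>u\<in>carrier G. f u + h u \<le> M" by blast
  have "\<forall>u\<in>carrier G. h u \<le> M - \<epsilon>" using h(2) assms(3) by fastforce
  then show "\<epsilon> \<le> M" using assms(1) h(1) unfolding amenable_def by fastforce
qed (rule upper_density_nonempty[OF assms(2)])

text \<open>If adding \<open>h'\<close> brings \<open>f\<close> below \<open>M\<close>, then adding
  (b/a) h' - h/a brings \<open>f'\<close> below (b/a) M.\<close>

lemma upper_density_scale_le:
  assumes "amenable G" "coboundary G h" "a > 0" "b > 0"
    and f: "\<And>u. u \<in> carrier G \<Longrightarrow> \<bar>f u\<bar> \<le> C" "\<And>u. u \<in> carrier G \<Longrightarrow> \<bar>f' u\<bar> \<le> C'"
    and rel: "\<And>u. u \<in> carrier G \<Longrightarrow> a * f' u = b * f u + h u"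
  shows "a * upper_density G f' \<le> b * upper_density G f"
proof -
  have "a / b * upper_density G f' \<le> upper_density G f"
    unfolding upper_density_def[of G f]
  proof (rule cInf_greatest)
    fix M assume "M \<in> {M. \<exists>h. coboundary G h \<and> (\<forall>u\<in>carrier G. f u + h u \<le> M)}"
    then obtain h' where h': "coboundary G h'" "\<forall>u\<in>carrier G. f u + h' u \<le> M" by blast
    have "coboundary G (\<lambda>u. (b / a) * h' u + (- 1 / a) * h u)"
      by (intro coboundary_add coboundary_scale h' assms)
    moreover have "f' u + ((b / a) * h' u + (- 1 / a) * h u) \<le> b / a * M" if "u \<in> carrier G" for u
    proof -
      have "f' u = (b * f u + h u) / a" using rel[OF that] \<open>a > 0\<close> by (simp add: field_simps)
      then have "f' u + ((b / a) * h' u + (- 1 / a) * h u) = b / a * (f u + h' u)"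
        using \<open>a > 0\<close> by (simp add: field_simps)
      also have "\<dots> \<le> b / a * M"
        using h'(2) that \<open>a > 0\<close> \<open>b > 0\<close> by (intro mult_left_mono) auto
      finally show ?thesis .
    qed
    ultimately have "upper_density G f' \<le> b / a * M"
      unfolding upper_density_def by (intro cInf_lower upper_density_bdd[OF assms(1) f(2)]) blast+
    then show "a / b * upper_density G f' \<le> M"
      using \<open>a > 0\<close> \<open>b > 0\<close> by (simp add: field_simps)
  qed (rule upper_density_nonempty[OF f(1)])
  then show ?thesis using \<open>b > 0\<close> by (simp add: field_simps)
qed

lemma upper_density_scale:
  assumes "amenable G" "coboundary G h" "a > 0" "b > 0"
    and f: "\<And>u. u \<in> carrier G \<Longrightarrow> \<bar>f u\<bar> \<le> C" "\<And>u. u \<in> carrier G \<Longrightarrow> \<bar>f' u\<bar> \<le> C'"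
    and rel: "\<And>u. u \<in> carrier G \<Longrightarrow> a * f' u = b * f u + h u"
  shows "a * upper_density G f' = b * upper_density G f"
proof (rule antisym)
  show "a * upper_density G f' \<le> b * upper_density G f"
    by (rule upper_density_scale_le[OF assms])
  show "b * upper_density G f \<le> a * upper_density G f'"
    by (rule upper_density_scale_le[OF assms(1) coboundary_scale[OF assms(2), of "-1"] assms(4,3) f(2,1)])
       (use rel in auto)
qed

lemma upper_density_reindex_le:
  assumes "amenable G" "\<And>u. u \<in> carrier G \<Longrightarrow> \<bar>f u\<bar> \<le> C"
    and \<psi>: "\<And>u. u \<in> carrier G \<Longrightarrow> \<psi> u \<in> carrier G"
      "\<And>k. k \<in> carrier G \<Longrightarrow> \<exists>k'\<in>carrier G. \<forall>u\<in>carrier G. \<psi> (u \<otimes>\<^bsub>G\<^esub> k') = \<psi> u \<otimes>\<^bsub>G\<^esub> k"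
    and f': "\<And>u. u \<in> carrier G \<Longrightarrow> f' u = f (\<psi> u)"
  shows "upper_density G f' \<le> upper_density G f"
  unfolding upper_density_def[of G f]
proof (rule cInf_greatest)
  fix M assume "M \<in> {M. \<exists>h. coboundary G h \<and> (\<forall>u\<in>carrier G. f u + h u \<le> M)}"
  then obtain h where h: "coboundary G h" "\<forall>u\<in>carrier G. f u + h u \<le> M" by blast
  have "coboundary G (\<lambda>u. h (\<psi> u))" using h(1) \<psi> by (rule coboundary_reindex)
  moreover have "\<forall>u\<in>carrier G. f' u + h (\<psi> u) \<le> M" using h(2) \<psi>(1) f' by auto
  moreover have "\<bar>f' u\<bar> \<le> C" if "u \<in> carrier G" for u using assms(2) \<psi>(1) f' that by simp
  ultimately show "upper_density G f' \<le> M"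
    unfolding upper_density_def by (intro cInf_lower upper_density_bdd[OF assms(1)]) blast+
qed (rule upper_density_nonempty[OF assms(2)])

section \<open>Permanence of amenability\<close>

lemma amenable_trivial:
  fixes G (structure)
  assumes "group G" "carrier G = {\<one>\<^bsub>G\<^esub>}"
  shows "amenable G"
proof -
  interpret group G by fact
  have "h \<one> = 0" if "coboundary G h" for h
    using that by induction (auto simp: assms(2))
  then show ?thesis unfolding amenable_def by (metis assms(2) insertI1)
qed

text \<open>Summing over representatives of the right cosets turns a coboundary of \<open>G\<close>
  into one of \<open>N\<close>, since right translation permutes the cosets up to corrections in
  \<open>N\<close>. An upper bound is multiplied by the index, which preserves its sign.\<close>

lemma (in group) amenable_finite_quotient:
  assumes N: "subgroup N G" "finite (rcosets N)" and am: "amenable (G\<lparr>carrier := N\<rparr>)"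
  shows "amenable G"
proof -
  interpret N: subgroup N G by fact
  define s where "s C = (SOME x. x \<in> C)" for C :: "'a set"
  have s: "s C \<in> C" "s C \<in> carrier G" "N #> s C = C" if C: "C \<in> rcosets N" for C
  proof -
    obtain a where a: "a \<in> carrier G" "C = N #> a" using C by (auto simp: RCOSETS_def)
    then have "a \<in> C" using rcos_self[OF a(1) N(1)] by simp
    then show 1: "s C \<in> C" unfolding s_def by (rule someI)
    then show "s C \<in> carrier G" using a r_coset_subset_G[OF N.subset a(1)] by blast
    show "N #> s C = C" using repr_independence[of "s C" N a] 1 a N(1) by simp
  qed
  have lift: "coboundary (G\<lparr>carrier := N\<rparr>) (\<lambda>u. \<Sum>C\<in>rcosets N. h (u \<otimes> s C))" if "coboundary G h" for h
    using that
  proof (induction rule: coboundary.induct)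
    case (zero h)
    then show ?case using s N.mem_carrier by (intro coboundary.zero sum.neutral) simp
  next
    case (step h k f B h')
    have Ck: "C #> k \<in> rcosets N" if C: "C \<in> rcosets N" for C
    proof -
      obtain a where a: "a \<in> carrier G" "C = N #> a" using C by (auto simp: RCOSETS_def)
      then have "C #> k = N #> (a \<otimes> k)" using coset_mult_assoc N.subset step.hyps(2) by simp
      then show ?thesis using a step.hyps(2) by (auto simp: RCOSETS_def)
    qed
    \<comment> \<open>The correction in \<open>N\<close>: translating the representative of
      \<open>C\<close> by \<open>k\<close> gives \<open>m C\<close> times the representative of
      \<open>C #> k\<close>.\<close>
    define m where "m C = s C \<otimes> k \<otimes> inv (s (C #> k))" for C
    have m: "m C \<in> N" "m C \<otimes> s (C #> k) = s C \<otimes> k" if C: "C \<in> rcosets N" for C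
    proof -
      note s1 = s[OF C] and s2 = s[OF Ck[OF C]]
      have "C #> k = N #> (s C \<otimes> k)"
        using coset_mult_assoc[OF N.subset s1(2) step.hyps(2)] s1(3) by simp
      then have "N #> (s C \<otimes> k) = N #> s (C #> k)" using s2 by simp
      then have "s C \<otimes> k \<in> N #> s (C #> k)"
        using rcos_self[of "s C \<otimes> k" N] s1 step.hyps(2) N(1) by auto
      then obtain n where n: "n \<in> N" "s C \<otimes> k = n \<otimes> s (C #> k)" by (auto simp: r_coset_def)
      then have "m C = n" using s2(2) N.mem_carrier by (simp add: m_def m_assoc)
      then show "m C \<in> N" "m C \<otimes> s (C #> k) = s C \<otimes> k" using n by auto
    qed
    have bij: "bij_betw (\<lambda>C. C #> k) (rcosets N) (rcosets N)"
    proof (rule bij_betwI')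
      show "C #> k = C' #> k \<longleftrightarrow> C = C'" if C: "C \<in> rcosets N" "C' \<in> rcosets N" for C C'
      proof
        assume "C #> k = C' #> k"
        then have "C #> k #> inv k = C' #> k #> inv k" by simp
        moreover have "D #> k #> inv k = D" if D: "D \<in> rcosets N" for D
        proof -
          obtain a where a: "a \<in> carrier G" "D = N #> a" using D by (auto simp: RCOSETS_def)
          then show ?thesis
            using step.hyps(2) by (simp add: coset_mult_assoc N.subset m_assoc)
        qed
        ultimately show "C = C'" using C by metis
      qed simp
      show "\<exists>C'\<in>rcosets N. C = C' #> k" if C: "C \<in> rcosets N" for C
      proof -
        obtain a where a: "a \<in> carrier G" "C = N #> a" using C by (auto simp: RCOSETS_def)
        then have "C = (N #> (a \<otimes> inv k)) #> k"
          using step.hyps(2) by (simp add: coset_mult_assoc N.subset m_assoc)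
        moreover have "N #> (a \<otimes> inv k) \<in> rcosets N" using a step.hyps(2) by (auto simp: RCOSETS_def)
        ultimately show ?thesis by blast
      qed
    qed (use Ck in auto)
    have cob: "coboundary (G\<lparr>carrier := N\<rparr>)
        (\<lambda>u. \<Sum>C\<in>rcosets N. f (u \<otimes> m C \<otimes> s (C #> k)) - f (u \<otimes> s (C #> k)))"
    proof (rule coboundary_sum)
      fix C assume C: "C \<in> rcosets N"
      show "coboundary (G\<lparr>carrier := N\<rparr>) (\<lambda>u. f (u \<otimes> m C \<otimes> s (C #> k)) - f (u \<otimes> s (C #> k)))"
        using coboundary_translate[of "m C" "G\<lparr>carrier := N\<rparr>" "\<lambda>u. f (u \<otimes> s (C #> k))" B]
          m[OF C] s[OF Ck[OF C]] step.hyps(3) by simp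
    qed
    show ?case
    proof (rule coboundary_cong[OF coboundary_add[OF step.IH cob]])
      fix u assume "u \<in> carrier (G\<lparr>carrier := N\<rparr>)"
      then have u: "u \<in> N" "u \<in> carrier G" by auto
      have "f (u \<otimes> s C \<otimes> k) = f (u \<otimes> m C \<otimes> s (C #> k))" if C: "C \<in> rcosets N" for C
        using m[OF C] s[OF C] s[OF Ck[OF C]] u step.hyps(2) by (simp add: m_assoc)
      then have "(\<Sum>C\<in>rcosets N. h' (u \<otimes> s C)) =
          (\<Sum>C\<in>rcosets N. h (u \<otimes> s C) + (f (u \<otimes> m C \<otimes> s (C #> k)) - f (u \<otimes> s C)))"
        using s u step.hyps(4) by (intro sum.cong) auto
      moreover have "(\<Sum>C\<in>rcosets N. f (u \<otimes> s (C #> k))) = (\<Sum>C\<in>rcosets N. f (u \<otimes> s C))"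
        by (rule sum.reindex_bij_betw[OF bij, of "\<lambda>C. f (u \<otimes> s C)"])
      ultimately show "(\<Sum>C\<in>rcosets N. h' (u \<otimes> s C)) = (\<Sum>C\<in>rcosets N. h (u \<otimes> s C)) +
          (\<Sum>C\<in>rcosets N. f (u \<otimes> m C \<otimes> s (C #> k)) - f (u \<otimes> s (C #> k)))"
        by (simp add: sum.distrib sum_subtractf)
    qed
  qed
  have "N \<in> rcosets N" using N.subset N.subgroup_in_rcosets is_group by blast
  then have pos: "card (rcosets N) > 0" using N(2) by (auto simp: card_gt_0_iff)
  show ?thesis
    unfolding amenable_def
  proof (intro allI impI)
    fix h \<delta> assume h: "coboundary G h" "\<forall>u\<in>carrier G. h u \<le> \<delta>"
    have "(\<Sum>C\<in>rcosets N. h (u \<otimes> s C)) \<le> card (rcosets N) * \<delta>" if "u \<in> N" for u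
      using sum_bounded_above[of "rcosets N" "\<lambda>C. h (u \<otimes> s C)" \<delta>] h(2) s that by simp
    then have "0 \<le> card (rcosets N) * \<delta>"
      using am[unfolded amenable_def, rule_format, OF lift[OF h(1)], of "card (rcosets N) * \<delta>"] by simp
    then show "0 \<le> \<delta>" using pos by (simp add: zero_le_mult_iff)
  qed
qed

text \<open>An infinite cyclic quotient, given by its homomorphism to the integers and a lift
  \<open>t\<close> of 1; its kernel is \<open>level_zero\<close> below.\<close>

locale graded_group = group +
  fixes lev :: "'a \<Rightarrow> int" and t
  assumes lev_mult: "g \<in> carrier G \<Longrightarrow> h \<in> carrier G \<Longrightarrow> lev (g \<otimes> h) = lev g + lev h"
    and t_closed [simp, intro]: "t \<in> carrier G" and lev_t: "lev t = 1"
begin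

definition "level_zero = {g \<in> carrier G. lev g = 0}"

lemma lev_one [simp]: "lev \<one> = 0"
  using lev_mult[of \<one> \<one>] by simp

lemma lev_inv: "g \<in> carrier G \<Longrightarrow> lev (inv g) = - lev g"
  using lev_mult[of g "inv g"] by simp

lemma lev_nat_pow: "g \<in> carrier G \<Longrightarrow> lev (g [^] (n::nat)) = int n * lev g"
  by (induction n) (auto simp: lev_mult algebra_simps)

lemma lev_int_pow: "g \<in> carrier G \<Longrightarrow> lev (g [^] (k::int)) = k * lev g"
  by (cases k rule: int_cases2) (simp_all add: int_pow_int int_pow_neg_int lev_nat_pow lev_inv)

lemma subgroup_level_zero: "subgroup level_zero G"
proof (rule subgroupI)
  have "\<one> \<in> level_zero" by (simp add: level_zero_def)
  then show "level_zero \<noteq> {}" by blast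
qed (auto simp: level_zero_def lev_mult lev_inv)

lemma level_zero_closed: "g \<in> level_zero \<Longrightarrow> g \<in> carrier G"
  by (simp add: level_zero_def)

lemma level_decomp:
  assumes "g \<in> carrier G"
  shows "g \<otimes> t [^] (- lev g) \<in> level_zero" "g = g \<otimes> t [^] (- lev g) \<otimes> t [^] lev g"
proof -
  show "g \<otimes> t [^] (- lev g) \<in> level_zero"
    using assms by (simp add: level_zero_def lev_mult lev_int_pow lev_t)
  have "t [^] (- lev g) \<otimes> t [^] lev g = \<one>" by (subst int_pow_mult[symmetric]) simp_all
  then show "g = g \<otimes> t [^] (- lev g) \<otimes> t [^] lev g" using assms by (simp add: m_assoc)
qed

text \<open>The sum of a coboundary of \<open>G\<close> over \<open>J\<close> consecutive levels is
  a coboundary of \<open>level_zero\<close> up to an error bounded independently of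
  \<open>J\<close>. If the coboundary were at most a negative constant, these sums would tend to
  minus infinity and beat the error.\<close>

lemma amenable_graded:
  assumes am: "amenable (G\<lparr>carrier := level_zero\<rparr>)"
  shows "amenable G"
proof -
  let ?N = "G\<lparr>carrier := level_zero\<rparr>"
  \<comment> \<open>Shifting the window of summation by one place changes the sum by at most two
    boundary terms.\<close>
  have shift_sum: "\<bar>\<Sum>j<J. p (int j + l) - p (int j)\<bar> \<le> 2 * \<bar>l\<bar> * B"
    if p: "\<And>j. \<bar>p j\<bar> \<le> B" for p :: "int \<Rightarrow> real" and l B and J :: nat
  proof -
    have nat: "\<bar>\<Sum>j<J. q (int j + int n) - q (int j)\<bar> \<le> 2 * n * B"
      if q: "\<And>j. \<bar>q j\<bar> \<le> B" for q :: "int \<Rightarrow> real" and n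
    proof (induction n)
      case (Suc n)
      have "(\<Sum>j<J. q (int j + int (Suc n)) - q (int j))
        = (\<Sum>j<J. q (int j + int n) - q (int j)) + (\<Sum>j<J. q (int (Suc j) + int n) - q (int j + int n))"
        by (simp add: sum.distrib[symmetric] algebra_simps)
      also have "(\<Sum>j<J. q (int (Suc j) + int n) - q (int j + int n)) = q (int J + int n) - q (int n)"
        using sum_lessThan_telescope[of "\<lambda>j. q (int j + int n)" J] by simp
      finally show ?case using Suc q[of "int J + int n"] q[of "int n"]
        by (simp add: algebra_simps)
    qed simp
    show ?thesis
    proof (cases "l \<ge> 0")
      case True
      then show ?thesis using nat[of p "nat l", OF p] by simp
    next
      case False
      define n where "n = nat (- l)"
      have l: "l = - int n" using False by (simp add: n_def)
      have "(\<Sum>j<J. p (int j + l) - p (int j)) = - (\<Sum>j<J. p (int j + int n + l) - p (int j + l))"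
        by (simp add: l sum_negf[symmetric])
      then show ?thesis using nat[of "\<lambda>j. p (j + l)" n] p by (simp add: l)
    qed
  qed
  have avg: "\<exists>B. \<forall>J::nat. \<exists>b. coboundary ?N b \<and>
      (\<forall>u\<in>level_zero. \<bar>(\<Sum>j<J. h (u \<otimes> t [^] int j)) - b u\<bar> \<le> B)" if "coboundary G h" for h
    using that
  proof (induction rule: coboundary.induct)
    case (zero h)
    then have "(\<Sum>j<J. h (u \<otimes> t [^] int j)) = 0" if "u \<in> level_zero" for u and J :: nat
      using level_zero_closed[OF that] by simp
    then show ?case
      by (intro exI[of _ 0] allI exI[of _ "\<lambda>_. 0"]) (auto intro: coboundary.zero)
  next
    case (step h k f C h')
    then obtain B where B: "\<And>J::nat. \<exists>b. coboundary ?N b \<and>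
      (\<forall>u\<in>level_zero. \<bar>(\<Sum>j<J. h (u \<otimes> t [^] int j)) - b u\<bar> \<le> B)" by blast
    define l where "l = lev k"
    \<comment> \<open>Translation by \<open>k\<close> splits into a translation by
      \<open>m j\<close> inside level \<open>j\<close> and a jump by \<open>l\<close> levels. The
      first part is a coboundary of \<open>level_zero\<close>; the second is estimated by
      \<open>shift_sum\<close>.\<close>
    define m where "m j = t [^] int j \<otimes> k \<otimes> t [^] (- (int j + l))" for j :: nat
    have m: "m j \<in> level_zero" "m j \<otimes> t [^] (int j + l) = t [^] int j \<otimes> k" for j
      using step.hyps(2)
    proof -
      have "t [^] (- (int j + l)) \<otimes> t [^] (int j + l) = \<one>"
        by (subst int_pow_mult[symmetric]) simp_all
      then show "m j \<otimes> t [^] (int j + l) = t [^] int j \<otimes> k"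
        using step.hyps(2) by (simp add: m_def m_assoc)
    qed (use step.hyps(2) in \<open>simp add: m_def level_zero_def lev_mult lev_int_pow lev_t l_def\<close>)
    show ?case
    proof (intro exI[of _ "B + 2 * \<bar>l\<bar> * C"] allI)
      fix J :: nat
      obtain b where b: "coboundary ?N b"
        "\<forall>u\<in>level_zero. \<bar>(\<Sum>j<J. h (u \<otimes> t [^] int j)) - b u\<bar> \<le> B" using B by blast
      define c where "c u = (\<Sum>j<J. f (u \<otimes> m j \<otimes> t [^] (int j + l)) - f (u \<otimes> t [^] (int j + l)))" for u
      have "coboundary ?N c"
        unfolding c_def
      proof (rule coboundary_sum)
        fix j
        show "coboundary ?N (\<lambda>u. f (u \<otimes> m j \<otimes> t [^] (int j + l)) - f (u \<otimes> t [^] (int j + l)))"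
          using coboundary_translate[of "m j" ?N "\<lambda>u. f (u \<otimes> t [^] (int j + l))" C]
            m[of j] step.hyps(3) level_zero_closed by simp
      qed
      then have "coboundary ?N (\<lambda>u. b u + c u)" by (rule coboundary_add[OF b(1)])
      moreover have "\<bar>(\<Sum>j<J. h' (u \<otimes> t [^] int j)) - (b u + c u)\<bar> \<le> B + 2 * \<bar>l\<bar> * C"
        if u: "u \<in> level_zero" for u
      proof -
        have uG: "u \<in> carrier G" using u level_zero_closed by blast
        have "f (u \<otimes> t [^] int j \<otimes> k) = f (u \<otimes> m j \<otimes> t [^] (int j + l))" for j
          using m[of j] uG step.hyps(2) level_zero_closed[OF m(1)] by (simp add: m_assoc)
        then have "(\<Sum>j<J. h' (u \<otimes> t [^] int j)) = (\<Sum>j<J. h (u \<otimes> t [^] int j)) + c u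
          + (\<Sum>j<J. f (u \<otimes> t [^] (int j + l)) - f (u \<otimes> t [^] int j))"
          using uG by (simp add: step.hyps(4) c_def sum.distrib sum_subtractf)
        moreover have "\<bar>\<Sum>j<J. f (u \<otimes> t [^] (int j + l)) - f (u \<otimes> t [^] int j)\<bar> \<le> 2 * \<bar>l\<bar> * C"
          using shift_sum[of "\<lambda>j. f (u \<otimes> t [^] j)" C l J] step.hyps(3) uG by simp
        ultimately show ?thesis using b(2) u by fastforce
      qed
      ultimately show "\<exists>b. coboundary ?N b \<and> (\<forall>u\<in>level_zero.
          \<bar>(\<Sum>j<J. h' (u \<otimes> t [^] int j)) - b u\<bar> \<le> B + 2 * \<bar>l\<bar> * C)" by blast
    qed
  qed
  show ?thesis
    unfolding amenable_def
  proof (intro allI impI)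
    fix h \<delta> assume h: "coboundary G h" "\<forall>u\<in>carrier G. h u \<le> \<delta>"
    obtain B where B: "\<And>J::nat. \<exists>b. coboundary ?N b \<and>
      (\<forall>u\<in>level_zero. \<bar>(\<Sum>j<J. h (u \<otimes> t [^] int j)) - b u\<bar> \<le> B)" using avg[OF h(1)] by blast
    have bound: "0 \<le> J * \<delta> + B" for J :: nat
    proof -
      obtain b where b: "coboundary ?N b"
        "\<forall>u\<in>level_zero. \<bar>(\<Sum>j<J. h (u \<otimes> t [^] int j)) - b u\<bar> \<le> B" using B by blast
      have "b u \<le> J * \<delta> + B" if u: "u \<in> level_zero" for u
      proof -
        have "(\<Sum>j<J. h (u \<otimes> t [^] int j)) \<le> J * \<delta>"
          using sum_bounded_above[of "{..<J}" "\<lambda>j. h (u \<otimes> t [^] int j)" \<delta>] h(2)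
            level_zero_closed[OF u] by simp
        then show ?thesis using b(2) u by fastforce
      qed
      then show ?thesis using am b(1) unfolding amenable_def by simp
    qed
    show "0 \<le> \<delta>"
    proof (rule ccontr)
      assume "\<not> 0 \<le> \<delta>"
      then obtain J :: nat where "B / (- \<delta>) < J" using reals_Archimedean2 by blast
      moreover have "- \<delta> > 0" using \<open>\<not> 0 \<le> \<delta>\<close> by simp
      ultimately have "B < J * (- \<delta>)" by (simp only: pos_divide_less_eq)
      then show False using bound[of J] by simp
    qed
  qed
qed

end

section \<open>Local rules\<close>

text \<open>The rule sees the configuration recentred at \<open>g\<close> and reads right multiples
  of \<open>g\<close>, so left translations are symmetries of the rule.\<close>

definition follows :: "('g, 'm) monoid_scheme \<Rightarrow> 'b set \<Rightarrow> (('g \<Rightarrow> 'b) \<Rightarrow> bool) \<Rightarrow> ('g \<Rightarrow> 'b) \<Rightarrow> bool" where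
  "follows G A L x \<longleftrightarrow> (\<forall>g\<in>carrier G. x g \<in> A \<and> L (\<lambda>h. x (g \<otimes>\<^bsub>G\<^esub> h)))"

definition periods :: "('g, 'm) monoid_scheme \<Rightarrow> ('g \<Rightarrow> 'b) \<Rightarrow> 'g set" where
  "periods G x = {s \<in> carrier G. \<forall>h\<in>carrier G. x (s \<otimes>\<^bsub>G\<^esub> h) = x h}"

definition determined_on :: "'g set \<Rightarrow> (('g \<Rightarrow> 'b) \<Rightarrow> bool) \<Rightarrow> bool" where
  "determined_on K L \<longleftrightarrow> (\<forall>x y. (\<forall>k\<in>K. x k = y k) \<longrightarrow> L x \<longrightarrow> L y)"

text \<open>The alphabet lies in \<open>nat\<close> because a definition cannot quantify over types;
  \<open>forcesI\<close> recodes other finite alphabets. The goal is \<open>forces G finite\<close>,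
  and other choices of \<open>Q\<close> express partial control of the periods.\<close>

definition forces :: "('g, 'm) monoid_scheme \<Rightarrow> ('g set \<Rightarrow> bool) \<Rightarrow> bool" where
  "forces G Q \<longleftrightarrow> (\<exists>(A :: nat set) K L. finite A \<and> finite K \<and> K \<subseteq> carrier G \<and> determined_on K L \<and>
     (\<exists>x. follows G A L x) \<and> (\<forall>x. follows G A L x \<longrightarrow> Q (periods G x)))"

lemma determined_onD:
  assumes "determined_on K L" "\<And>k. k \<in> K \<Longrightarrow> x k = y k"
  shows "L x \<longleftrightarrow> L y"
  using assms unfolding determined_on_def by metis

lemma (in group) subgroup_periods: "subgroup (periods G x) G"
proof (rule subgroupI)
  show "periods G x \<noteq> {}" by (auto simp: periods_def intro!: exI[of _ \<one>])
next
  fix a assume a: "a \<in> periods G x"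
  have "x (inv a \<otimes> h) = x h" if "h \<in> carrier G" for h
  proof -
    have "x (a \<otimes> (inv a \<otimes> h)) = x (inv a \<otimes> h)" using a that by (auto simp: periods_def)
    then show ?thesis using a that by (simp add: m_assoc[symmetric] periods_def)
  qed
  then show "inv a \<in> periods G x" using a by (auto simp: periods_def)
qed (auto simp: periods_def m_assoc)

text \<open>Symbols are renamed by an injection into \<open>nat\<close>. The decoding
  \<open>d\<close> is injective on the renamed symbols, so the periods do not change.\<close>

lemma (in group) forcesI:
  fixes A :: "'c set"
  assumes "finite A" "finite K" "K \<subseteq> carrier G" "determined_on K L" "follows G A L x0"
    and Q: "\<And>x. follows G A L x \<Longrightarrow> Q (periods G x)"
  shows "forces G Q"
proof -
  obtain f :: "'c \<Rightarrow> nat" where f: "inj_on f A"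
    using \<open>finite A\<close> finite_imp_inj_to_nat_seg by metis
  define d where "d = inv_into A f"
  define L' where "L' y \<longleftrightarrow> L (\<lambda>h. d (y h))" for y
  have df: "d (f a) = a" if "a \<in> A" for a using f that by (simp add: d_def)
  have d: "d n \<in> A" "f (d n) = n" if "n \<in> f ` A" for n
    using that by (auto simp: df)
  have det: "determined_on K L'"
    using \<open>determined_on K L\<close> unfolding determined_on_def L'_def by metis
  have "follows G (f ` A) L' (\<lambda>g. f (x0 g))"
  proof -
    have "L (\<lambda>h. d (f (x0 (g \<otimes> h))))" if "g \<in> carrier G" for g
    proof -
      have "d (f (x0 (g \<otimes> k))) = x0 (g \<otimes> k)" if "k \<in> K" for k
        using assms(3,5) that \<open>g \<in> carrier G\<close> by (auto simp: follows_def intro!: df)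
      then show ?thesis
        using determined_onD[OF assms(4), of "\<lambda>h. d (f (x0 (g \<otimes> h)))" "\<lambda>h. x0 (g \<otimes> h)"]
          assms(5) that by (auto simp: follows_def)
    qed
    then show ?thesis using assms(5) by (auto simp: follows_def L'_def)
  qed
  moreover have "Q (periods G x)" if x: "follows G (f ` A) L' x" for x
  proof -
    have "follows G A L (\<lambda>g. d (x g))"
      using x d by (auto simp: follows_def L'_def)
    moreover have "periods G (\<lambda>g. d (x g)) = periods G x"
    proof -
      have "d (x g) = d (x h) \<longleftrightarrow> x g = x h" if "g \<in> carrier G" "h \<in> carrier G" for g h
        using x d(2) that unfolding follows_def by metis
      then show ?thesis by (auto simp: periods_def)
    qed
    ultimately show ?thesis using Q by metis
  qed
  ultimately show ?thesis
    unfolding forces_def using assms det by (intro exI[of _ "f ` A"] exI[of _ K] exI[of _ L']) auto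
qed

lemma forces_mono:
  assumes "forces G Q" "\<And>x :: 'g \<Rightarrow> nat. Q (periods G x) \<Longrightarrow> Q' (periods G x)"
  shows "forces G Q'"
  using assms unfolding forces_def by metis

text \<open>A period of a pair of configurations is a period of both. The supersets \<open>T\<close>
  and \<open>T'\<close> appear because \<open>Q\<close> need not pass to subsets.\<close>

lemma (in group) forces_conj:
  assumes "forces G Q" "forces G Q'"
  shows "forces G (\<lambda>S. \<exists>T T'. Q T \<and> Q' T' \<and> S \<subseteq> T \<and> S \<subseteq> T')"
proof -
  obtain A K L x where 1: "finite A" "finite K" "K \<subseteq> carrier G" "determined_on K L" "follows G A L x"
    "\<And>x :: 'a \<Rightarrow> nat. follows G A L x \<Longrightarrow> Q (periods G x)"
    using assms(1) unfolding forces_def by blast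
  obtain A' K' L' x' where 2: "finite A'" "finite K'" "K' \<subseteq> carrier G" "determined_on K' L'" "follows G A' L' x'"
    "\<And>x :: 'a \<Rightarrow> nat. follows G A' L' x \<Longrightarrow> Q' (periods G x)"
    using assms(2) unfolding forces_def by blast
  define M where "M y \<longleftrightarrow> L (\<lambda>h. fst (y h)) \<and> L' (\<lambda>h. snd (y h))" for y
  show ?thesis
  proof (rule forcesI[of "A \<times> A'" "K \<union> K'" M])
    show "determined_on (K \<union> K') M"
      unfolding determined_on_def M_def
    proof (intro allI impI)
      fix y z assume yz: "\<forall>k\<in>K \<union> K'. y k = z k" "L (\<lambda>h. fst (y h)) \<and> L' (\<lambda>h. snd (y h))"
      show "L (\<lambda>h. fst (z h)) \<and> L' (\<lambda>h. snd (z h))"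
        using determined_onD[OF 1(4), of "\<lambda>h. fst (y h)" "\<lambda>h. fst (z h)"]
          determined_onD[OF 2(4), of "\<lambda>h. snd (y h)" "\<lambda>h. snd (z h)"] yz by auto
    qed
    show "follows G (A \<times> A') M (\<lambda>g. (x g, x' g))"
      using 1(5) 2(5) by (auto simp: follows_def M_def)
  next
    fix y assume y: "follows G (A \<times> A') M y"
    then have "follows G A L (\<lambda>g. fst (y g))" "follows G A' L' (\<lambda>g. snd (y g))"
      by (auto simp: follows_def M_def mem_Times_iff)
    then have "Q (periods G (\<lambda>g. fst (y g)))" "Q' (periods G (\<lambda>g. snd (y g)))"
      using 1(6) 2(6) by auto
    moreover have "periods G y \<subseteq> periods G (\<lambda>g. fst (y g))" "periods G y \<subseteq> periods G (\<lambda>g. snd (y g))"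
      by (auto simp: periods_def)
    ultimately show "\<exists>T T'. Q T \<and> Q' T' \<and> periods G y \<subseteq> T \<and> periods G y \<subseteq> T'" by blast
  qed (use 1 2 in auto)
qed

text \<open>The rule reads only right multiples by elements of \<open>K\<close>, which lie in
  \<open>H\<close>, so different left cosets of \<open>H\<close> do not interact and a copy of
  \<open>x\<close> can be placed on each. Only periods in \<open>H\<close> are controlled, since
  other periods may move the cosets.\<close>

lemma (in group) forces_induced:
  assumes H: "subgroup H G" and "forces (G\<lparr>carrier := H\<rparr>) Q"
  shows "forces G (\<lambda>S. \<exists>T. Q T \<and> S \<inter> H \<subseteq> T)"
proof -
  interpret H: subgroup H G by fact
  obtain A K L x where 1: "finite A" "finite K" "K \<subseteq> H" "determined_on K L"
    "follows (G\<lparr>carrier := H\<rparr>) A L x"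
    "\<And>x :: 'a \<Rightarrow> nat. follows (G\<lparr>carrier := H\<rparr>) A L x \<Longrightarrow> Q (periods (G\<lparr>carrier := H\<rparr>) x)"
    using assms(2) unfolding forces_def by auto
  define rep where "rep g = (SOME r. r \<in> g <# H)" for g
  have coset: "(g \<otimes> h) <# H = g <# H" if "g \<in> carrier G" "h \<in> H" for g h
    using that H.mem_carrier lcos_m_assoc[of H g h] H.subset coset_join3[of h H] H by simp
  have rep: "inv (rep g) \<otimes> g \<in> H" "rep g \<in> carrier G" if g: "g \<in> carrier G" for g
  proof -
    have "g \<in> g <# H" using g H.one_closed by (force simp: l_coset_def)
    then have "rep g \<in> g <# H" unfolding rep_def by (rule someI)
    then obtain h where h: "h \<in> H" "rep g = g \<otimes> h" by (auto simp: l_coset_def)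
    then show "inv (rep g) \<otimes> g \<in> H" "rep g \<in> carrier G"
      using g H.mem_carrier by (auto simp: inv_mult_group m_assoc)
  qed
  define y where "y g = x (inv (rep g) \<otimes> g)" for g
  have rep_eq: "rep (g \<otimes> h) = rep g" if "g \<in> carrier G" "h \<in> H" for g h
    using coset[OF that] by (simp add: rep_def)
  have y: "follows G A L y"
    unfolding follows_def
  proof (intro ballI conjI)
    fix g assume g: "g \<in> carrier G"
    show "y g \<in> A" using 1(5) rep[OF g] by (auto simp: follows_def y_def)
    have "y (g \<otimes> k) = x (inv (rep g) \<otimes> g \<otimes> k)" if "k \<in> K" for k
      using that 1(3) g rep[OF g] H.mem_carrier by (auto simp: y_def rep_eq m_assoc)
    moreover have "L (\<lambda>h. x (inv (rep g) \<otimes> g \<otimes> h))"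
      using 1(5) rep[OF g] by (auto simp: follows_def)
    ultimately show "L (\<lambda>h. y (g \<otimes> h))"
      using determined_onD[OF 1(4), of "\<lambda>h. y (g \<otimes> h)" "\<lambda>h. x (inv (rep g) \<otimes> g \<otimes> h)"] by simp
  qed
  show ?thesis
  proof (rule forcesI[OF 1(1,2) _ 1(4) y])
    show "K \<subseteq> carrier G" using 1(3) H.subset by blast
    fix z assume "follows G A L z"
    then have "follows (G\<lparr>carrier := H\<rparr>) A L z" by (auto simp: follows_def)
    then have "Q (periods (G\<lparr>carrier := H\<rparr>) z)" by (rule 1(6))
    moreover have "periods G z \<inter> H \<subseteq> periods (G\<lparr>carrier := H\<rparr>) z" by (auto simp: periods_def)
    ultimately show "\<exists>T. Q T \<and> periods G z \<inter> H \<subseteq> T" by blast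
  qed
qed

text \<open>The forbidden patterns are the assignments on \<open>K\<close> that \<open>L\<close>
  rejects. Since \<open>shift G g\<close> evaluates at \<open>inv g\<close>, passing between rule
  and SFT inverts group elements, and stabilizers consist of inverses of periods.\<close>

lemma (in group) forces_finite_imp_strongly_aperiodic:
  assumes "forces G finite"
  shows "\<exists>(A :: nat set) S. finite A \<and> is_SFT G A S \<and> strongly_aperiodic G S"
proof -
  obtain A K L x0 where 1: "finite A" "finite K" "K \<subseteq> carrier G" "determined_on K L" "follows G A L x0"
    "\<And>x :: 'a \<Rightarrow> nat. follows G A L x \<Longrightarrow> finite (periods G x)"
    using assms unfolding forces_def by blast
  define \<P> where "\<P> = {P. dom P = K \<and> ran P \<subseteq> A \<and> \<not> L (\<lambda>h. the (P h))}"
  define S where "S = SFT_of G A \<P>"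
  have "finite \<P>"
    using finite_set_of_finite_maps[OF 1(2,1)] by (rule rev_finite_subset) (auto simp: \<P>_def)
  moreover have "is_pattern G A P" if "P \<in> \<P>" for P
    using that 1(2,3) by (auto simp: \<P>_def is_pattern_def)
  ultimately have sft: "is_SFT G A S" unfolding is_SFT_def S_def by blast
  have mem: "x \<in> S \<longleftrightarrow> x \<in> configurations G A \<and> follows G A L x" for x
  proof
    assume x: "x \<in> S"
    then have conf: "x \<in> configurations G A" by (simp add: S_def SFT_of_def)
    have "L (\<lambda>h. x (g \<otimes> h))" if g: "g \<in> carrier G" for g
    proof (rule ccontr)
      assume notL: "\<not> L (\<lambda>h. x (g \<otimes> h))"
      define P where "P h = (if h \<in> K then Some (x (g \<otimes> h)) else None)" for h
      have dom: "dom P = K" by (auto simp: P_def split: if_splits)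
      have "x (g \<otimes> h) \<in> A" if "h \<in> K" for h
        using conf g that 1(3) by (auto simp: configurations_def)
      then have "ran P \<subseteq> A" by (auto simp: P_def ran_def split: if_splits)
      moreover have "\<not> L (\<lambda>h. the (P h))"
        using notL determined_onD[OF 1(4), of "\<lambda>h. the (P h)" "\<lambda>h. x (g \<otimes> h)"] by (simp add: P_def)
      ultimately have "P \<in> \<P>" using dom by (simp add: \<P>_def)
      then obtain h where h: "h \<in> K" "shift G (inv g) x h \<noteq> the (P h)"
        using x g inv_closed[OF g] dom unfolding S_def SFT_of_def by blast
      then show False using 1(3) g by (auto simp: shift_def P_def)
    qed
    with conf show "x \<in> configurations G A \<and> follows G A L x"
      by (auto simp: follows_def configurations_def)
  next
    assume x: "x \<in> configurations G A \<and> follows G A L x"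
    have "\<exists>h\<in>dom P. shift G g x h \<noteq> the (P h)" if g: "g \<in> carrier G" and P: "P \<in> \<P>" for g P
    proof (rule ccontr)
      assume contr: "\<not> ?thesis"
      have dom: "dom P = K" using P by (simp add: \<P>_def)
      have "x (inv g \<otimes> h) = the (P h)" if "h \<in> K" for h
      proof -
        have "shift G g x h = the (P h)" "h \<in> carrier G" using contr that dom 1(3) by auto
        then show ?thesis by (simp add: shift_def)
      qed
      then have "L (\<lambda>h. the (P h))"
        using determined_onD[OF 1(4), of "\<lambda>h. x (inv g \<otimes> h)" "\<lambda>h. the (P h)"] x g
        by (auto simp: follows_def)
      then show False using P by (simp add: \<P>_def)
    qed
    with x show "x \<in> S" by (simp add: S_def SFT_of_def)
  qed
  \<comment> \<open>Points of the SFT are extensional, so \<open>x0\<close> is cut down to the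
    carrier; the rule does not notice, as \<open>K\<close> lies in the carrier.\<close>
  have "restrict x0 (carrier G) \<in> S"
  proof -
    have "L (\<lambda>h. restrict x0 (carrier G) (g \<otimes> h))" if "g \<in> carrier G" for g
    proof (rule iffD1[OF determined_onD[OF 1(4)], of "\<lambda>h. x0 (g \<otimes> h)"])
      show "L (\<lambda>h. x0 (g \<otimes> h))" using 1(5) that by (simp add: follows_def)
      show "x0 (g \<otimes> k) = restrict x0 (carrier G) (g \<otimes> k)" if "k \<in> K" for k
        using 1(3) that \<open>g \<in> carrier G\<close> by auto
    qed
    then show ?thesis using 1(5) unfolding mem by (auto simp: follows_def configurations_def)
  qed
  moreover have "finite (stabilizer G (shift G) x)" if x: "x \<in> S" for x
  proof -
    have "stabilizer G (shift G) x \<subseteq> (\<lambda>s. inv s) ` periods G x"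
    proof
      fix s assume "s \<in> stabilizer G (shift G) x"
      then have s: "s \<in> carrier G" "shift G s x = x" by (auto simp: stabilizer_def)
      have "x (inv s \<otimes> h) = x h" if "h \<in> carrier G" for h
        using fun_cong[OF s(2), of h] that by (simp add: shift_def)
      then have "inv s \<in> periods G x" using s by (auto simp: periods_def)
      then show "s \<in> (\<lambda>s. inv s) ` periods G x" using s(1) by (force intro: rev_image_eqI)
    qed
    then show ?thesis using 1(6)[of x] x mem by (meson finite_imageI finite_subset)
  qed
  ultimately have "strongly_aperiodic G S" unfolding strongly_aperiodic_def by blast
  with 1(1) sft show ?thesis by blast
qed

section \<open>Kari's construction over an infinite cyclic quotient\<close>

lemma (in group) int_pow_eq_one_imp:
  assumes "e \<in> carrier G" "\<And>n::nat. n > 0 \<Longrightarrow> e [^] n \<noteq> \<one>" "e [^] (k::int) = \<one>"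
  shows "k = 0"
proof (cases k rule: int_cases2)
  case (nonneg n)
  then show ?thesis using assms by (metis int_pow_int gr0I of_nat_0)
next
  case (nonpos n)
  then have "e [^] n = \<one>" using assms by (metis int_pow_neg_int inv_eq_1_iff nat_pow_closed)
  then show ?thesis using assms nonpos by (metis gr0I of_nat_0 minus_zero)
qed

lemma (in group) int_pow_inj:
  assumes "e \<in> carrier G" "\<And>n::nat. n > 0 \<Longrightarrow> e [^] n \<noteq> \<one>" "e [^] (k::int) = e [^] (l::int)"
  shows "k = l"
proof -
  have "e [^] (k - l) = \<one>" using assms(1,3) by (simp add: int_pow_diff)
  then show ?thesis using int_pow_eq_one_imp[OF assms(1,2)] by fastforce
qed

text \<open>Each coset of the subgroup generated by \<open>e\<close> is a copy of the integers; an
  origin is chosen on every one of them, independently.\<close>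

lemma (in group) line_coordinate:
  assumes e: "e \<in> carrier G" "\<And>n::nat. n > 0 \<Longrightarrow> e [^] n \<noteq> \<one>"
  obtains j :: "'a \<Rightarrow> int" where "\<And>g. g \<in> carrier G \<Longrightarrow> j (g \<otimes> e) = j g + 1"
proof -
  define line where "line g = range (\<lambda>i::int. g \<otimes> e [^] i)" for g
  define rep where "rep g = (SOME r. r \<in> line g)" for g
  define j where "j g = (SOME i. g = rep g \<otimes> e [^] (i::int))" for g
  have rep: "\<exists>i::int. rep g = g \<otimes> e [^] i" if "g \<in> carrier G" for g
  proof -
    have "g \<in> line g" using that by (auto simp: line_def intro!: image_eqI[of _ _ 0])
    then have "rep g \<in> line g" unfolding rep_def by (rule someI)
    then show ?thesis by (auto simp: line_def)
  qed
  have rep_closed: "rep g \<in> carrier G" if "g \<in> carrier G" for g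
    using rep[OF that] that e(1) by auto
  have j: "g = rep g \<otimes> e [^] j g" if g: "g \<in> carrier G" for g
  proof -
    obtain i where "rep g = g \<otimes> e [^] (i::int)" using rep[OF g] by blast
    then have "g = rep g \<otimes> e [^] (- i)" using g e(1) by (simp add: m_assoc int_pow_neg)
    then show ?thesis unfolding j_def by (rule someI)
  qed
  have "j (g \<otimes> e) = j g + 1" if g: "g \<in> carrier G" for g
  proof -
    have shift: "g \<otimes> e \<otimes> e [^] (i::int) = g \<otimes> e [^] (1 + i)" for i
      using g e(1) int_pow_mult[OF e(1), of 1 i] by (simp add: m_assoc)
    have "line (g \<otimes> e) = line g"
    proof
      show "line (g \<otimes> e) \<subseteq> line g" by (auto simp: line_def shift)
      show "line g \<subseteq> line (g \<otimes> e)"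
      proof
        fix x assume "x \<in> line g"
        then obtain i where "x = g \<otimes> e [^] (i::int)" by (auto simp: line_def)
        then have "x = g \<otimes> e \<otimes> e [^] (i - 1)" by (simp add: shift)
        then show "x \<in> line (g \<otimes> e)" by (auto simp: line_def)
      qed
    qed
    then have "rep (g \<otimes> e) = rep g" by (simp add: rep_def)
    then have "rep g \<otimes> e [^] j (g \<otimes> e) = g \<otimes> e" using j[of "g \<otimes> e"] g e(1) by simp
    also have "\<dots> = rep g \<otimes> e [^] j g \<otimes> e" using j[OF g] by simp
    also have "\<dots> = rep g \<otimes> e [^] (j g + 1)"
      using rep_closed[OF g] e(1) by (simp add: m_assoc int_pow_mult)
    finally have "e [^] j (g \<otimes> e) = e [^] (j g + 1)"
      using rep_closed[OF g] e(1) by simp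
    then show ?thesis using int_pow_inj[of e "j (g \<otimes> e)" "j g + 1"] e by blast
  qed
  then show ?thesis using that by blast
qed

text \<open>Reduced logarithmically modulo the interval \<open>[2/3, 2)\<close>, multiplication by \<open>2\<close> is an irrational
  rotation; this is the aperiodic system of Kari.\<close>
lemma kari_orbit:
  obtains r :: "int \<Rightarrow> real" where
    "\<And>k. 0 \<le> r k \<and> r k < 2"
    "\<And>k. r k < 1 \<Longrightarrow> r (k + 1) = 2 * r k \<and> 1 \<le> r (k + 1)"
    "\<And>k. 1 \<le> r k \<Longrightarrow> 3 * r (k + 1) = 2 * r k"
proof -
  \<comment> \<open>In the coordinate \<open>\<phi>\<close>, with r = (2/3) 3^phi, adding
    \<open>\<theta>\<close> multiplies \<open>r\<close> by 2, and the wrap-around by -1 divides it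
    by 3. The condition \<open>r k < 1\<close> says that no wrap-around occurs.\<close>
  define \<theta> :: real where "\<theta> = log 3 2"
  have \<theta>: "0 < \<theta>" "\<theta> < 1" "3 powr \<theta> = 2" by (simp_all add: \<theta>_def)
  define \<phi> where "\<phi> k = frac (\<theta> * of_int k)" for k
  define r where "r k = 2 / 3 * 3 powr \<phi> k" for k
  have \<phi>: "0 \<le> \<phi> k" "\<phi> k < 1" for k by (simp_all add: \<phi>_def frac_lt_1)
  have "frac \<theta> = \<theta>" using \<theta> by (simp add: frac_eq)
  then have next_\<phi>: "\<phi> (k + 1) = (if \<phi> k + \<theta> < 1 then \<phi> k + \<theta> else \<phi> k + \<theta> - 1)" for k
    using frac_add[of "\<theta> * of_int k" \<theta>] by (simp add: \<phi>_def algebra_simps)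
  have p: "3 powr (1 - \<theta>) = (3/2 :: real)" by (simp add: powr_diff \<theta>)
  have lt1: "r k < 1 \<longleftrightarrow> \<phi> k + \<theta> < 1" for k
  proof -
    have "r k < 1 \<longleftrightarrow> 3 powr \<phi> k < 3 powr (1 - \<theta>)" unfolding p by (simp add: r_def mult.commute)
    also have "\<dots> \<longleftrightarrow> \<phi> k < 1 - \<theta>" by (rule powr_less_cancel_iff) simp
    finally show ?thesis by auto
  qed
  show ?thesis
  proof (rule that[of r])
    fix k
    have "3 powr \<phi> k < (3::real) powr 1" using \<phi>[of k] by (intro powr_less_mono) auto
    then show "0 \<le> r k \<and> r k < 2" by (simp add: r_def)
    have "(1::real) \<le> 3 powr \<phi> k" using \<phi>[of k] by (intro ge_one_powr_ge_zero) auto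
    \<comment> \<open>The lower end of the interval makes a doubled value at least 4/3, so it
      exceeds 1.\<close>
    then have ge: "2 / 3 \<le> r k" by (simp add: r_def)
    show "r (k + 1) = 2 * r k \<and> 1 \<le> r (k + 1)" if "r k < 1"
    proof -
      have "r (k + 1) = 2 * r k"
        using that unfolding lt1 by (simp add: r_def next_\<phi> powr_add \<theta>)
      with ge show ?thesis by simp
    qed
    show "3 * r (k + 1) = 2 * r k" if "1 \<le> r k"
      using that lt1[of k] by (simp add: r_def next_\<phi> powr_add powr_diff \<theta>)
  qed
qed

section \<open>Digits, carries and densities on the levels\<close>

context graded_group
begin

lemma level_zero_conj:
  assumes "n \<in> level_zero" "g \<in> carrier G"
  shows "g \<otimes> n \<otimes> inv g \<in> level_zero" "inv g \<otimes> n \<otimes> g \<in> level_zero"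
  using assms by (simp_all add: level_zero_def lev_mult lev_inv)

text \<open>The upper densities of the levels are multiplied by \<open>2\<close> or \<open>2/3\<close> from each level to the next,
  and \<open>2\<^sup>n\<close> is a power of \<open>3\<close> only for \<open>n = 0\<close>.\<close>
lemma density_cocycle_no_upward_period:
  fixes d p q :: "'a \<Rightarrow> real" and up :: "'a \<Rightarrow> bool"
  assumes am: "amenable (G\<lparr>carrier := level_zero\<rparr>)"
    and d: "\<And>g. g \<in> carrier G \<Longrightarrow> \<bar>d g\<bar> \<le> B"
    and c: "\<And>g. g \<in> carrier G \<Longrightarrow> \<bar>p g\<bar> \<le> C" "\<And>g. g \<in> carrier G \<Longrightarrow> \<bar>q g\<bar> \<le> C"
    and e: "a \<in> level_zero" "b \<in> level_zero"
    and up: "\<And>g n. g \<in> carrier G \<Longrightarrow> n \<in> level_zero \<Longrightarrow> up (g \<otimes> n) = up g"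
    and rel: "\<And>g. g \<in> carrier G \<Longrightarrow> 2 * d g - (if up g then 1 else 3) * d (g \<otimes> t) =
      p (g \<otimes> a) - p g + (q (g \<otimes> b) - q g)"
    and pos: "\<And>g. g \<in> carrier G \<Longrightarrow> (if up g then 1 \<le> d (g \<otimes> t) else 1 \<le> d g)"
    and s: "s \<in> carrier G" "\<And>h. h \<in> carrier G \<Longrightarrow> d (s \<otimes> h) = d h"
  shows "lev s \<le> 0"
proof (rule ccontr)
  assume "\<not> lev s \<le> 0"
  define n where "n = nat (lev s)"
  have n: "n > 0" "lev s = int n" using \<open>\<not> lev s \<le> 0\<close> by (auto simp: n_def)
  let ?N = "G\<lparr>carrier := level_zero\<rparr>"
  \<comment> \<open>The digits of level \<open>k\<close>, pulled back to \<open>level_zero\<close>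
    along u -> u t^k; \<open>P k\<close> is their upper density.\<close>
  define f where "f k u = d (u \<otimes> t [^] (k::nat))" for k u
  define P where "P k = upper_density ?N (f k)" for k
  define D :: "nat \<Rightarrow> nat" where "D k = (if up (t [^] k) then 1 else 3)" for k
  have up_level: "up (u \<otimes> t [^] k) = up (t [^] k)" if u: "u \<in> level_zero" for u and k :: nat
  proof -
    have "u \<otimes> t [^] k = t [^] k \<otimes> (inv (t [^] k) \<otimes> u \<otimes> t [^] k)"
      using level_zero_closed[OF u] by (simp add: m_assoc[symmetric])
    then show ?thesis using up level_zero_conj(2)[OF u, of "t [^] k"] by simp
  qed
  have f_bound: "\<bar>f k u\<bar> \<le> B" if "u \<in> carrier ?N" for k u
    using d[of "u \<otimes> t [^] k"] that level_zero_closed[of u] by (simp add: f_def)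
  have transl: "coboundary ?N (\<lambda>u. c (u \<otimes> t [^] k \<otimes> e) - c (u \<otimes> t [^] k))"
    if c: "\<And>g. g \<in> carrier G \<Longrightarrow> \<bar>c g\<bar> \<le> C" and e: "e \<in> level_zero"
    for c :: "'a \<Rightarrow> real" and e and k :: nat
  proof -
    \<comment> \<open>On level \<open>k\<close>, right translation by \<open>e\<close> is right
      translation of \<open>u\<close> by t^k e t^-k, which stays in
      \<open>level_zero\<close>.\<close>
    have "coboundary ?N (\<lambda>u. c (u \<otimes> (t [^] k \<otimes> e \<otimes> inv (t [^] k)) \<otimes> t [^] k) - c (u \<otimes> t [^] k))"
      using coboundary_translate[of "t [^] k \<otimes> e \<otimes> inv (t [^] k)" ?N "\<lambda>u. c (u \<otimes> t [^] k)" C]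
        level_zero_conj(1)[OF e, of "t [^] k"] c level_zero_closed by simp
    then show ?thesis
      by (rule coboundary_cong) (use level_zero_closed[OF e] level_zero_closed in \<open>simp add: m_assoc\<close>)
  qed
  have step: "real (D k) * P (Suc k) = 2 * P k" for k
    unfolding P_def
  proof (rule upper_density_scale[OF am _ _ _ f_bound f_bound])
    show "coboundary ?N (\<lambda>u. - 1 * (p (u \<otimes> t [^] k \<otimes> a) - p (u \<otimes> t [^] k)
        + (q (u \<otimes> t [^] k \<otimes> b) - q (u \<otimes> t [^] k))))"
      by (intro coboundary_scale coboundary_add transl c e)
    fix u assume "u \<in> carrier ?N"
    then have u: "u \<in> level_zero" by simp
    have "u \<otimes> t [^] Suc k = u \<otimes> t [^] k \<otimes> t"
      using level_zero_closed[OF u] by (simp add: m_assoc)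
    then show "real (D k) * f (Suc k) u = 2 * f k u + - 1 * (p (u \<otimes> t [^] k \<otimes> a) - p (u \<otimes> t [^] k)
        + (q (u \<otimes> t [^] k \<otimes> b) - q (u \<otimes> t [^] k)))"
      using rel[of "u \<otimes> t [^] k"] up_level[OF u, of k] level_zero_closed[OF u]
      by (simp add: f_def D_def split: if_splits)
  qed (auto simp: D_def)
  have prod: "real (\<Prod>k<m. D k) * P m = 2 ^ m * P 0" for m
  proof (induction m)
    case (Suc m)
    have "real (\<Prod>k<Suc m. D k) * P (Suc m) = real (\<Prod>k<m. D k) * (real (D m) * P (Suc m))"
      by simp
    also have "\<dots> = 2 * (real (\<Prod>k<m. D k) * P m)" unfolding step by simp
    also have "\<dots> = 2 ^ Suc m * P 0" unfolding Suc by simp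
    finally show ?case .
  qed simp
  \<comment> \<open>This excludes the zero configuration: by \<open>pos\<close>, all digits of level
    0 or all digits of level 1 are at least 1.\<close>
  have "P 0 > 0"
  proof (cases "up \<one>")
    case True
    have "1 \<le> P (Suc 0)"
      unfolding P_def
    proof (rule upper_density_ge[OF am f_bound])
      fix u assume "u \<in> carrier ?N"
      then show "1 \<le> f (Suc 0) u"
        using pos[of u] up_level[of u 0] True level_zero_closed[of u] by (simp add: f_def)
    qed
    then show ?thesis using step[of 0] True by (simp add: D_def)
  next
    case False
    have "1 \<le> P 0"
      unfolding P_def
    proof (rule upper_density_ge[OF am f_bound])
      fix u assume "u \<in> carrier ?N"
      then show "1 \<le> f 0 u"
        using pos[of u] up_level[of u 0] False level_zero_closed[of u] by (simp add: f_def)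
    qed
    then show ?thesis by simp
  qed
  \<comment> \<open>Left multiplication by \<open>s\<close> maps level 0 onto level \<open>n\<close>
    and preserves digits; in coordinates it is u -> s u t^-n.\<close>
  moreover have "P n = P 0"
  proof (rule antisym)
    define tn where "tn = t [^] n"
    have tn: "tn \<in> carrier G" "lev tn = int n" by (simp_all add: tn_def lev_nat_pow lev_t)
    show "P 0 \<le> P n"
      unfolding P_def
    proof (rule upper_density_reindex_le[OF am f_bound, where \<psi> = "\<lambda>u. s \<otimes> u \<otimes> inv tn"])
      fix k assume "k \<in> carrier ?N"
      then have k: "k \<in> level_zero" by simp
      show "\<exists>k'\<in>carrier ?N. \<forall>u\<in>carrier ?N. s \<otimes> (u \<otimes>\<^bsub>?N\<^esub> k') \<otimes> inv tn = s \<otimes> u \<otimes> inv tn \<otimes>\<^bsub>?N\<^esub> k"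
        using level_zero_conj[OF k tn(1)] tn(1) s(1) level_zero_closed[OF k] level_zero_closed
        by (intro bexI[of _ "inv tn \<otimes> k \<otimes> tn"]) (simp_all add: m_assoc)
    next
      fix u assume "u \<in> carrier ?N"
      then have u: "u \<in> level_zero" "u \<in> carrier G" using level_zero_closed by auto
      show "s \<otimes> u \<otimes> inv tn \<in> carrier ?N"
        using u s(1) tn n(2) by (simp add: level_zero_def lev_mult lev_inv)
      show "f 0 u = f n (s \<otimes> u \<otimes> inv tn)"
        using u s tn(1) by (simp add: f_def tn_def[symmetric] m_assoc)
    qed
    have s_inv: "d (inv s \<otimes> h) = d h" if "h \<in> carrier G" for h
      using s(2)[of "inv s \<otimes> h"] s(1) that by (simp add: m_assoc[symmetric])
    show "P n \<le> P 0"
      unfolding P_def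
    proof (rule upper_density_reindex_le[OF am f_bound, where \<psi> = "\<lambda>u. inv s \<otimes> u \<otimes> tn"])
      fix k assume "k \<in> carrier ?N"
      then have k: "k \<in> level_zero" by simp
      show "\<exists>k'\<in>carrier ?N. \<forall>u\<in>carrier ?N. inv s \<otimes> (u \<otimes>\<^bsub>?N\<^esub> k') \<otimes> tn = inv s \<otimes> u \<otimes> tn \<otimes>\<^bsub>?N\<^esub> k"
        using level_zero_conj[OF k tn(1)] tn(1) s(1) level_zero_closed[OF k] level_zero_closed
        by (intro bexI[of _ "tn \<otimes> k \<otimes> inv tn"]) (simp_all add: m_assoc)
    next
      fix u assume "u \<in> carrier ?N"
      then have u: "u \<in> level_zero" "u \<in> carrier G" using level_zero_closed by auto
      show "inv s \<otimes> u \<otimes> tn \<in> carrier ?N"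
        using u s(1) tn n(2) by (simp add: level_zero_def lev_mult lev_inv)
      show "f n u = f 0 (inv s \<otimes> u \<otimes> tn)"
        using u s(1) s_inv tn(1) by (simp add: f_def tn_def[symmetric] m_assoc)
    qed
  qed
  ultimately have "real (\<Prod>k<n. D k) = real (2 ^ n)" using prod[of n] by simp
  then have "(\<Prod>k<n. D k) = 2 ^ n" by (simp only: of_nat_eq_iff)
  \<comment> \<open>A product of ones and threes is odd, while 2^n is even for positive
    \<open>n\<close>.\<close>
  moreover have "odd (\<Prod>k<n. D k)" by (simp add: even_prod_iff D_def)
  ultimately show False using n(1) by simp
qed

text \<open>Level \<open>k\<close> gets the density \<open>r k\<close> of the orbit, realized by a
  Beatty sequence along each line in direction \<open>e\<close>. A digit differs from its density by
  a difference of fractional parts, and the densities cancel since 2 r k is 1 or 3 times r (k+1). So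
  the fractional parts are real carries; rounding them as a flow with integral divergence makes them
  bounded integers.\<close>

lemma density_cocycle_exists:
  assumes e: "e \<in> level_zero" "\<And>n::nat. n > 0 \<Longrightarrow> e [^] n \<noteq> \<one>"
  defines "e' \<equiv> t \<otimes> e \<otimes> inv t"
  obtains d c1 c2 :: "'a \<Rightarrow> int" and up :: "'a \<Rightarrow> bool" where
    "\<And>g. g \<in> carrier G \<Longrightarrow> d g \<in> {0..2} \<and> c1 g \<in> {-2..3} \<and> c2 g \<in> {-2..3}"
    "\<And>g n. g \<in> carrier G \<Longrightarrow> n \<in> level_zero \<Longrightarrow> up (g \<otimes> n) = up g"
    "\<And>g. g \<in> carrier G \<Longrightarrow> 2 * d g - (if up g then 1 else 3) * d (g \<otimes> t) =
      c1 (g \<otimes> e) - c1 g + (c2 (g \<otimes> e') - c2 g)"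
    "\<And>g. g \<in> carrier G \<Longrightarrow> (if up g then 1 \<le> d (g \<otimes> t) else 1 \<le> d g)"
proof -
  have eG: "e \<in> carrier G" "lev e = 0" using e(1) by (auto simp: level_zero_def)
  have e'G: "e' \<in> carrier G" "lev e' = 0" "e' \<otimes> t = t \<otimes> e"
    using eG by (simp_all add: e'_def lev_mult lev_inv m_assoc)
  have ne: "e \<noteq> \<one>" using e(2)[of 1] eG by auto
  have ne': "e' \<noteq> \<one>"
  proof
    assume "e' = \<one>"
    then have "t = t \<otimes> e" using e'G(3) by simp
    then show False using ne eG(1) by (metis l_cancel_one' t_closed)
  qed
  obtain j :: "'a \<Rightarrow> int" where j: "\<And>g. g \<in> carrier G \<Longrightarrow> j (g \<otimes> e) = j g + 1"
    using line_coordinate[OF eG(1) e(2)] by blast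
  obtain r :: "int \<Rightarrow> real" where r: "\<And>k. 0 \<le> r k \<and> r k < 2"
    "\<And>k. r k < 1 \<Longrightarrow> r (k + 1) = 2 * r k \<and> 1 \<le> r (k + 1)"
    "\<And>k. 1 \<le> r k \<Longrightarrow> 3 * r (k + 1) = 2 * r k" using kari_orbit by blast
  define up where "up g \<longleftrightarrow> r (lev g) < 1" for g
  define D :: "'a \<Rightarrow> real" where "D g = (if up g then 1 else 3)" for g
  define F where "F g = frac (r (lev g) * j g)" for g
  define d where "d g = \<lfloor>r (lev g) * (j g + 1)\<rfloor> - \<lfloor>r (lev g) * j g\<rfloor>" for g
  have F: "0 \<le> F g" "F g < 1" for g by (simp_all add: F_def frac_lt_1)
  \<comment> \<open>As r < 2 and fractional parts differ by less than 1, this identity confines the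
    digits to 0, 1, 2, and makes them positive where r is at least 1.\<close>
  have d_eq: "of_int (d g) = r (lev g) - (F (g \<otimes> e) - F g)" if "g \<in> carrier G" for g
    using that eG by (simp add: d_def F_def frac_def j lev_mult algebra_simps)
  have d_bounds: "0 \<le> d g" "d g \<le> 2" "1 \<le> r (lev g) \<Longrightarrow> 1 \<le> d g" if "g \<in> carrier G" for g
  proof -
    have "of_int (d g) < (3::real)" "-1 < (of_int (d g) :: real)"
      using d_eq[OF that] F[of g] F[of "g \<otimes> e"] r(1)[of "lev g"] by linarith+
    then show "0 \<le> d g" "d g \<le> 2" by linarith+
    assume "1 \<le> r (lev g)"
    then have "0 < (of_int (d g) :: real)"
      using d_eq[OF that] F[of g] F[of "g \<otimes> e"] by linarith
    then show "1 \<le> d g" by linarith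
  qed
  define dir where "dir i = (if i then e else e')" for i
  define src where "src = (fst :: 'a \<times> bool \<Rightarrow> 'a)"
  \<comment> \<open>Edges go from h to h e^-1 and to h e'^-1. The edges entering g then start at
    \<open>g \<otimes> e\<close> and \<open>g \<otimes> e'\<close>, so the net inflow at g is
    exactly the carry term of the relation.\<close>
  define tgt where "tgt v = fst v \<otimes> inv (dir (snd v))" for v
  \<comment> \<open>The carry of the next level is read at \<open>g \<otimes> t\<close>: a step
    \<open>e'\<close> at \<open>g\<close> is a step \<open>e\<close> there, because e' t = t
    e.\<close>
  define a where "a v = (if snd v then - 2 * F (fst v) else D (fst v) * F (fst v \<otimes> t))" for v :: "'a \<times> bool"
  let ?E = "carrier G \<times> (UNIV :: bool set)"
  let ?S = "\<lambda>g. {v \<in> ?E. incidence src tgt g v \<noteq> 0}"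
  have dir: "dir i \<in> carrier G" "dir i \<noteq> \<one>" "lev (dir i) = 0" for i
    using eG e'G ne ne' by (auto simp: dir_def)
  have tgt_iff: "h \<otimes> inv (dir i) = g \<longleftrightarrow> h = g \<otimes> dir i" if "g \<in> carrier G" "h \<in> carrier G" for g h i
    using that dir by (metis inv_solve_right m_closed)
  have move: "g \<otimes> dir i \<noteq> g" if "g \<in> carrier G" for g i
    using that dir(1,2)[of i] l_cancel_one[of g "dir i"] by simp
  have S: "?S g = {(g, True), (g, False), (g \<otimes> e, True), (g \<otimes> e', False)}" if g: "g \<in> carrier G" for g
  proof -
    have iff: "(h, i) \<in> ?S g \<longleftrightarrow> h = g \<or> h = g \<otimes> dir i" if h: "h \<in> carrier G" for h i
      using h move[OF g, of i] by (simp add: incidence_def src_def tgt_def tgt_iff[OF g h, of i])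
    show ?thesis
    proof (rule Set.set_eqI)
      fix v :: "'a \<times> bool"
      obtain h i where v: "v = (h, i)" by (cases v)
      show "v \<in> ?S g \<longleftrightarrow> v \<in> {(g, True), (g, False), (g \<otimes> e, True), (g \<otimes> e', False)}"
      proof (cases "h \<in> carrier G")
        case True
        show ?thesis unfolding v iff[OF True] by (cases i) (auto simp: dir_def)
      next
        case False
        have "g \<otimes> e \<in> carrier G" "g \<otimes> e' \<in> carrier G" using g eG(1) e'G(1) by simp_all
        with False g have "h \<noteq> g" "h \<noteq> g \<otimes> e" "h \<noteq> g \<otimes> e'" by metis+
        with False show ?thesis by (simp add: v)
      qed
    qed
  qed
  have net: "(\<Sum>v\<in>?S g. incidence src tgt g v * h v)
      = h (g \<otimes> e, True) - h (g, True) + (h (g \<otimes> e', False) - h (g, False))"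
    if g: "g \<in> carrier G" for g and h :: "'a \<times> bool \<Rightarrow> real"
  proof -
    have inc: "incidence src tgt g (g, i) = -1" "incidence src tgt g (g \<otimes> dir i, i) = 1" for i
      using g move[OF g, of i] tgt_iff[OF g g, of i] tgt_iff[OF g _, of "g \<otimes> dir i" i] dir(1)
      by (auto simp: incidence_def src_def tgt_def)
    have ne: "g \<otimes> e \<noteq> g" "g \<otimes> e' \<noteq> g"
      using move[OF g, of True] move[OF g, of False] by (simp_all add: dir_def)
    show ?thesis unfolding S[OF g]
      using inc[of True] inc[of False] ne ne[symmetric] by (simp add: dir_def)
  qed
  have rel_a: "a (g \<otimes> e, True) - a (g, True) + (a (g \<otimes> e', False) - a (g, False))
      = of_int (2 * d g - (if up g then 1 else 3) * d (g \<otimes> t))" if g: "g \<in> carrier G" for g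
  proof -
    have De: "D (g \<otimes> e') = D g" using g e'G by (simp add: D_def up_def lev_mult)
    have te: "g \<otimes> e' \<otimes> t = g \<otimes> t \<otimes> e"
      using m_assoc[OF g e'G(1) t_closed] m_assoc[OF g t_closed eG(1)] e'G(3) by simp
    have "a (g \<otimes> e, True) - a (g, True) + (a (g \<otimes> e', False) - a (g, False))
      = - 2 * (F (g \<otimes> e) - F g) + D g * (F (g \<otimes> t \<otimes> e) - F (g \<otimes> t))"
      unfolding a_def fst_conv snd_conv te De by (simp add: right_diff_distrib)
    also have "\<dots> = 2 * (of_int (d g) - r (lev g)) - D g * (of_int (d (g \<otimes> t)) - r (lev g + 1))"
      using g by (simp add: d_eq lev_mult lev_t right_diff_distrib)
    also have "\<dots> = 2 * of_int (d g) - D g * of_int (d (g \<otimes> t)) + (D g * r (lev g + 1) - 2 * r (lev g))"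
      unfolding right_diff_distrib by simp
    also have "D g * r (lev g + 1) = 2 * r (lev g)"
      using r(2,3)[of "lev g"] by (simp add: D_def up_def)
    finally show ?thesis by (simp add: D_def)
  qed
  have fin_S: "finite (?S g)" if "g \<in> carrier G" for g by (subst S[OF that]) simp
  have int_S: "(\<Sum>v\<in>?S g. incidence src tgt g v * a v) \<in> \<int>" if "g \<in> carrier G" for g
    unfolding net[OF that] rel_a[OF that] by (rule Ints_of_int)
  obtain b :: "'a \<times> bool \<Rightarrow> int" where b: "\<And>v. v \<in> ?E \<Longrightarrow> b v \<in> {\<lfloor>a v\<rfloor>..\<lceil>a v\<rceil>}"
    "\<And>g. g \<in> carrier G \<Longrightarrow> (\<Sum>v\<in>?S g. incidence src tgt g v * of_int (b v)) =
      (\<Sum>v\<in>?S g. incidence src tgt g v * a v)"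
    using flow_rounding[OF fin_S int_S] by blast
  \<comment> \<open>The real carries lie in (-2, 0] for direction \<open>e\<close> and in [0, 3) for
    direction \<open>e'\<close>.\<close>
  have b_range: "b (g, i) \<in> {-2..3}" if g: "g \<in> carrier G" for g i
  proof -
    have "-2 \<le> a (g, i) \<and> a (g, i) \<le> 3"
      using F[of g] F[of "g \<otimes> t"] by (auto simp: a_def D_def)
    then have "-2 \<le> \<lfloor>a (g, i)\<rfloor>" "\<lceil>a (g, i)\<rceil> \<le> 3" by linarith+
    moreover have "\<lfloor>a (g, i)\<rfloor> \<le> b (g, i)" "b (g, i) \<le> \<lceil>a (g, i)\<rceil>"
      using b(1)[of "(g, i)"] g by simp_all
    ultimately show ?thesis by (simp only: atLeastAtMost_iff) linarith
  qed
  show ?thesis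
  proof (rule that[of d "\<lambda>g. b (g, True)" "\<lambda>g. b (g, False)" up])
    fix g assume g: "g \<in> carrier G"
    show "d g \<in> {0..2} \<and> b (g, True) \<in> {-2..3} \<and> b (g, False) \<in> {-2..3}"
      using d_bounds[OF g] b_range[OF g] by auto
    show "up (g \<otimes> n) = up g" if "n \<in> level_zero" for n
      using g that by (simp add: up_def level_zero_def lev_mult)
    have "real_of_int (b (g \<otimes> e, True) - b (g, True) + (b (g \<otimes> e', False) - b (g, False)))
        = of_int (2 * d g - (if up g then 1 else 3) * d (g \<otimes> t))"
      using b(2)[OF g] unfolding net[OF g] rel_a[OF g] by simp
    then show "2 * d g - (if up g then 1 else 3) * d (g \<otimes> t) =
        b (g \<otimes> e, True) - b (g, True) + (b (g \<otimes> e', False) - b (g, False))"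
      by (simp only: of_int_eq_iff)
    show "if up g then 1 \<le> d (g \<otimes> t) else 1 \<le> d g"
      using d_bounds(3)[of g] d_bounds(3)[of "g \<otimes> t"] r(2)[of "lev g"] g
      by (auto simp: up_def lev_mult lev_t)
  qed
qed

text \<open>A symbol consists of a digit, the choice between the multipliers \<open>2\<close> and \<open>2/3\<close>, and two carries.
  The carry of the next level runs along \<open>e\<close>, which is \<open>t e t\<^sup>-\<^sup>1\<close> as seen from the current level.\<close>
definition kari_rule :: "'a set \<Rightarrow> 'a \<Rightarrow> ('a \<Rightarrow> int \<times> bool \<times> int \<times> int) \<Rightarrow> bool" where
  "kari_rule K e y \<longleftrightarrow>
    (\<forall>k\<in>K. fst (snd (y k)) = fst (snd (y \<one>))) \<and>
    2 * fst (y \<one>) - (if fst (snd (y \<one>)) then 1 else 3) * fst (y t) =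
      fst (snd (snd (y e))) - fst (snd (snd (y \<one>))) +
      (snd (snd (snd (y (t \<otimes> e \<otimes> inv t)))) - snd (snd (snd (y \<one>)))) \<and>
    (if fst (snd (y \<one>)) then 1 \<le> fst (y t) else 1 \<le> fst (y \<one>))"

text \<open>That the multiplier is constant on a whole level becomes a local condition by comparing
  it along a finite generating set of \<open>level_zero\<close>. Excluding upward periods suffices,
  as the inverse of a downward period is an upward one.\<close>

lemma forces_level_zero:
  assumes fg: "finite K" "K \<subseteq> level_zero" "generate G K = level_zero"
    and am: "amenable (G\<lparr>carrier := level_zero\<rparr>)"
    and e: "e \<in> level_zero" "\<And>n::nat. n > 0 \<Longrightarrow> e [^] n \<noteq> \<one>"
  shows "forces G (\<lambda>S. S \<subseteq> level_zero)"
proof -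
  define e' where "e' = t \<otimes> e \<otimes> inv t"
  have eG: "e \<in> carrier G" and e': "e' \<in> level_zero" and e'G: "e' \<in> carrier G"
    using e(1) level_zero_conj(1)[OF e(1) t_closed] level_zero_closed by (auto simp: e'_def)
  have KG: "K \<subseteq> carrier G" using fg(2) level_zero_closed by blast
  define A :: "(int \<times> bool \<times> int \<times> int) set" where "A = {0..2} \<times> UNIV \<times> {-2..3} \<times> {-2..3}"
  obtain d c1 c2 :: "'a \<Rightarrow> int" and up :: "'a \<Rightarrow> bool" where x0:
    "\<And>g. g \<in> carrier G \<Longrightarrow> d g \<in> {0..2} \<and> c1 g \<in> {-2..3} \<and> c2 g \<in> {-2..3}"
    "\<And>g n. g \<in> carrier G \<Longrightarrow> n \<in> level_zero \<Longrightarrow> up (g \<otimes> n) = up g"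
    "\<And>g. g \<in> carrier G \<Longrightarrow> 2 * d g - (if up g then 1 else 3) * d (g \<otimes> t) =
      c1 (g \<otimes> e) - c1 g + (c2 (g \<otimes> e') - c2 g)"
    "\<And>g. g \<in> carrier G \<Longrightarrow> (if up g then 1 \<le> d (g \<otimes> t) else 1 \<le> d g)"
    using density_cocycle_exists[OF e] unfolding e'_def[symmetric] by blast
  have rule_iff: "kari_rule K e (\<lambda>h. y (g \<otimes> h)) \<longleftrightarrow>
      (\<forall>k\<in>K. fst (snd (y (g \<otimes> k))) = fst (snd (y g))) \<and>
      2 * fst (y g) - (if fst (snd (y g)) then 1 else 3) * fst (y (g \<otimes> t)) =
        fst (snd (snd (y (g \<otimes> e)))) - fst (snd (snd (y g))) +
        (snd (snd (snd (y (g \<otimes> e')))) - snd (snd (snd (y g)))) \<and>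
      (if fst (snd (y g)) then 1 \<le> fst (y (g \<otimes> t)) else 1 \<le> fst (y g))"
    if "g \<in> carrier G" for y and g
    using that by (simp add: kari_rule_def e'_def)
  show ?thesis
  proof (rule forcesI[of A "K \<union> {\<one>, t, e, e'}" "kari_rule K e" "\<lambda>g. (d g, up g, c1 g, c2 g)"])
    show "finite A" by (simp add: A_def)
    show "determined_on (K \<union> {\<one>, t, e, e'}) (kari_rule K e)"
      unfolding determined_on_def kari_rule_def e'_def[symmetric] by simp
    show "follows G A (kari_rule K e) (\<lambda>g. (d g, up g, c1 g, c2 g))"
      unfolding follows_def
    proof (intro ballI conjI)
      fix g assume g: "g \<in> carrier G"
      show "(d g, up g, c1 g, c2 g) \<in> A" using x0(1)[OF g] by (simp add: A_def)
      show "kari_rule K e (\<lambda>h. (d (g \<otimes> h), up (g \<otimes> h), c1 (g \<otimes> h), c2 (g \<otimes> h)))"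
        using x0(2-4)[OF g] fg(2) by (auto simp: rule_iff[OF g, of "\<lambda>g. (d g, up g, c1 g, c2 g)"])
    qed
  next
    fix x assume "follows G A (kari_rule K e) x"
    then have xA: "\<And>g. g \<in> carrier G \<Longrightarrow> x g \<in> A"
      and xL: "\<And>g. g \<in> carrier G \<Longrightarrow> kari_rule K e (\<lambda>h. x (g \<otimes> h))"
      by (auto simp: follows_def)
    define up' where "up' g = fst (snd (x g))" for g
    have up'_K: "up' (g \<otimes> k) = up' g" if "g \<in> carrier G" "k \<in> K" for g k
      using xL[OF that(1)] that(2) unfolding rule_iff[OF that(1)] up'_def by blast
    have up': "up' (g \<otimes> n) = up' g" if n: "n \<in> level_zero" and g: "g \<in> carrier G" for g n
      using n[folded fg(3)] g
    proof (induction n arbitrary: g rule: generate.induct)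
      case (inv k)
      then show ?case
        using up'_K[of "g \<otimes> inv k" k] KG by (auto simp: m_assoc subset_iff)
    next
      case (eng m n)
      have "m \<in> carrier G" "n \<in> carrier G" using eng.hyps generate_in_carrier[OF KG] by auto
      then show ?case using eng by (simp add: m_assoc[symmetric])
    qed (use up'_K in auto)
    have no_up: "lev s \<le> 0"
      if s: "s \<in> carrier G" "\<And>h. h \<in> carrier G \<Longrightarrow> x (s \<otimes> h) = x h" for s
    proof (rule density_cocycle_no_upward_period[OF am, where d = "\<lambda>g. of_int (fst (x g))"
          and p = "\<lambda>g. of_int (fst (snd (snd (x g))))" and q = "\<lambda>g. of_int (snd (snd (snd (x g))))"
          and up = up' and a = e and b = e' and s = s and B = 2 and C = 3])
      fix g assume g: "g \<in> carrier G"
      show "\<bar>real_of_int (fst (x g))\<bar> \<le> 2" "\<bar>real_of_int (fst (snd (snd (x g))))\<bar> \<le> 3"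
        "\<bar>real_of_int (snd (snd (snd (x g))))\<bar> \<le> 3"
        using xA[OF g] by (auto simp: A_def abs_le_iff)
      show "up' (g \<otimes> n) = up' g" if "n \<in> level_zero" for n using up'[OF that g] .
      note R = xL[OF g, unfolded rule_iff[OF g], folded up'_def]
      show "2 * real_of_int (fst (x g)) - (if up' g then 1 else 3) * real_of_int (fst (x (g \<otimes> t))) =
          real_of_int (fst (snd (snd (x (g \<otimes> e))))) - real_of_int (fst (snd (snd (x g)))) +
          (real_of_int (snd (snd (snd (x (g \<otimes> e'))))) - real_of_int (snd (snd (snd (x g)))))"
      proof -
        have "real_of_int (2 * fst (x g) - (if up' g then 1 else 3) * fst (x (g \<otimes> t))) =
          real_of_int (fst (snd (snd (x (g \<otimes> e)))) - fst (snd (snd (x g))) +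
            (snd (snd (snd (x (g \<otimes> e')))) - snd (snd (snd (x g)))))"
          using R by (simp only: of_int_eq_iff)
        then show ?thesis by (cases "up' g") simp_all
      qed
      show "if up' g then 1 \<le> real_of_int (fst (x (g \<otimes> t))) else 1 \<le> real_of_int (fst (x g))"
        using R by (auto split: if_splits)
    qed (use e e' s in auto)
    show "periods G x \<subseteq> level_zero"
    proof
      fix s assume s: "s \<in> periods G x"
      have "inv s \<in> periods G x"
        using subgroup.m_inv_closed[OF subgroup_periods s] .
      then have "lev s \<le> 0" "lev (inv s) \<le> 0" using no_up s by (auto simp: periods_def)
      then show "s \<in> level_zero" using s by (simp add: level_zero_def lev_inv periods_def)
    qed
  qed (use fg(1) KG eG e'G in auto)
qed

end

section \<open>Climbing along the series\<close>

text \<open>The induction hypothesis for a group of Hirsch number \<open>c\<close>.\<close>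
definition tame :: "('g, 'm) monoid_scheme \<Rightarrow> nat \<Rightarrow> bool" where
  "tame G c \<longleftrightarrow>
    (\<exists>K. finite K \<and> K \<subseteq> carrier G \<and> generate G K = carrier G) \<and> amenable G \<and>
    (c = 0 \<longrightarrow> finite (carrier G)) \<and>
    (c \<noteq> 0 \<longrightarrow> (\<exists>e\<in>carrier G. \<forall>n::nat. n > 0 \<longrightarrow> e [^]\<^bsub>G\<^esub> n \<noteq> \<one>\<^bsub>G\<^esub>)) \<and>
    (c = 1 \<longrightarrow> (\<exists>a\<in>carrier G. (\<forall>n::nat. n > 0 \<longrightarrow> a [^]\<^bsub>G\<^esub> n \<noteq> \<one>\<^bsub>G\<^esub>) \<and>
       (\<exists>R. finite R \<and> R \<subseteq> carrier G \<and>
         (\<forall>g\<in>carrier G. \<exists>r\<in>R. \<exists>k::int. g = a [^]\<^bsub>G\<^esub> k \<otimes>\<^bsub>G\<^esub> r)))) \<and>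
    (2 \<le> c \<longrightarrow> forces G finite)"

lemmas tame_fg = tame_def[THEN iffD1, THEN conjunct1]
  and tame_amenable = tame_def[THEN iffD1, THEN conjunct2, THEN conjunct1]
  and tame_finite = tame_def[THEN iffD1, THEN conjunct2, THEN conjunct2, THEN conjunct1, THEN mp]
  and tame_infinite_order =
    tame_def[THEN iffD1, THEN conjunct2, THEN conjunct2, THEN conjunct2, THEN conjunct1, THEN mp]
  and tame_virtually_cyclic =
    tame_def[THEN iffD1, THEN conjunct2, THEN conjunct2, THEN conjunct2, THEN conjunct2, THEN conjunct1, THEN mp]
  and tame_forces =
    tame_def[THEN iffD1, THEN conjunct2, THEN conjunct2, THEN conjunct2, THEN conjunct2, THEN conjunct2, THEN mp]

lemma (in group) tame_trivial:
  assumes "carrier G = {\<one>}"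
  shows "tame G 0"
  using amenable_trivial[OF is_group assms] assms
  by (auto simp: tame_def intro!: exI[of _ "{}"] generate_empty)

text \<open>Once \<open>S\<close> meets a coset of \<open>H\<close>, its part in that coset is
  contained in a right translate of the finite set \<open>S \<inter> H\<close>.\<close>

lemma (in group) finite_of_finite_index:
  assumes S: "subgroup S G" and H: "subgroup H G" and "finite (S \<inter> H)"
    and R: "finite R" "\<And>s. s \<in> S \<Longrightarrow> \<exists>r\<in>R. r \<in> carrier G \<and> s \<in> H #> r"
  shows "finite S"
proof -
  interpret S: subgroup S G by fact
  interpret H: subgroup H G by fact
  have "finite (S \<inter> (H #> r))" if "r \<in> carrier G" for r
  proof (cases "S \<inter> (H #> r) = {}")
    case False
    then obtain s0 where s0: "s0 \<in> S" "s0 \<in> H #> r" by blast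
    have "S \<inter> (H #> r) \<subseteq> (\<lambda>u. u \<otimes> s0) ` (S \<inter> H)"
    proof
      fix s assume s: "s \<in> S \<inter> (H #> r)"
      have "s \<in> H #> s0" using repr_independence[OF s0(2) that H] s by simp
      then have "s \<otimes> inv s0 \<in> H" using H.rcos_module_imp[OF is_group] s0(1) by simp
      moreover have "s \<otimes> inv s0 \<in> S" using s s0(1) by simp
      moreover have "s = s \<otimes> inv s0 \<otimes> s0" using s s0(1) by (simp add: m_assoc)
      ultimately show "s \<in> (\<lambda>u. u \<otimes> s0) ` (S \<inter> H)" by blast
    qed
    then show ?thesis using assms(3) by (meson finite_imageI finite_subset)
  qed simp
  moreover have "S \<subseteq> (\<Union>r\<in>R \<inter> carrier G. S \<inter> (H #> r))" using R(2) by blast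
  ultimately show ?thesis using R(1) by (meson IntD2 finite_Int finite_UN_I finite_subset)
qed

lemma (in group) finite_transversal:
  assumes N: "subgroup N G" and fin: "finite (rcosets N)"
  obtains R where "finite R" "R \<subseteq> carrier G" "\<And>g. g \<in> carrier G \<Longrightarrow> \<exists>r\<in>R. g \<in> N #> r"
proof
  define R where "R = (\<lambda>C. SOME x. x \<in> C) ` (rcosets N)"
  have some: "(SOME x. x \<in> N #> g) \<in> N #> g" if "g \<in> carrier G" for g
    using rcos_self[OF that N] by (rule someI)
  show "finite R" using fin by (simp add: R_def)
  show "R \<subseteq> carrier G"
    using some r_coset_subset_G[OF subgroup.subset[OF N]] by (fastforce simp: R_def RCOSETS_def)
  show "\<exists>r\<in>R. g \<in> N #> r" if g: "g \<in> carrier G" for g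
  proof
    show "(SOME x. x \<in> N #> g) \<in> R" using g by (auto simp: R_def RCOSETS_def)
    show "g \<in> N #> (SOME x. x \<in> N #> g)"
      using repr_independence[OF some[OF g] g N] rcos_self[OF g N] by simp
  qed
qed

text \<open>Each clause passes through a finite transversal \<open>R\<close>. For the subshift, the
  induced rule bounds the periods in \<open>N\<close>, and these have finite index among all
  periods.\<close>

lemma (in group) tame_finite_extension:
  assumes N: "subgroup N G" and fin: "finite (rcosets N)" and tame: "tame (G\<lparr>carrier := N\<rparr>) c"
  shows "tame G c"
proof -
  interpret N: subgroup N G by fact
  obtain R where R: "finite R" "R \<subseteq> carrier G" "\<And>g. g \<in> carrier G \<Longrightarrow> \<exists>r\<in>R. g \<in> N #> r"
    using finite_transversal[OF N fin] by blast
  have decomp: "\<exists>r\<in>R. \<exists>n\<in>N. g = n \<otimes> r" if "g \<in> carrier G" for g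
    using R(3)[OF that] by (auto simp: r_coset_def)
  obtain K where K: "finite K" "K \<subseteq> N" "generate (G\<lparr>carrier := N\<rparr>) K = N"
    using tame_fg[OF tame] by auto
  have KR: "K \<union> R \<subseteq> carrier G" using K(2) R(2) N.subset by blast
  have "generate G (K \<union> R) = carrier G"
  proof
    show "generate G (K \<union> R) \<subseteq> carrier G" by (rule generate_incl[OF KR])
    show "carrier G \<subseteq> generate G (K \<union> R)"
    proof
      fix g assume "g \<in> carrier G"
      then obtain r n where rn: "r \<in> R" "n \<in> N" "g = n \<otimes> r" using decomp by blast
      have "generate G K = N" using generate_consistent[OF K(2) N] K(3) by simp
      then have "n \<in> generate G (K \<union> R)" using rn(2) mono_generate[of K "K \<union> R"] by blast
      then show "g \<in> generate G (K \<union> R)"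
        unfolding rn(3) by (rule generate.eng) (simp add: rn(1) generate.incl)
    qed
  qed
  then have 1: "\<exists>K. finite K \<and> K \<subseteq> carrier G \<and> generate G K = carrier G"
    using K(1) R(1) KR by (intro exI[of _ "K \<union> R"]) auto
  have 2: "amenable G" by (rule amenable_finite_quotient[OF N fin tame_amenable[OF tame]])
  have 3: "finite (carrier G)" if "c = 0"
  proof (rule finite_of_finite_index[OF subgroup_self N _ R(1)])
    show "finite (carrier G \<inter> N)" using tame_finite[OF tame that] by simp
    show "\<exists>r\<in>R. r \<in> carrier G \<and> g \<in> N #> r" if "g \<in> carrier G" for g using R(2,3) that by blast
  qed
  have 4: "\<exists>e\<in>carrier G. \<forall>n::nat. n > 0 \<longrightarrow> e [^] n \<noteq> \<one>" if "c \<noteq> 0"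
    using tame_infinite_order[OF tame that] N.subset by (auto simp: nat_pow_consistent[symmetric])
  have 5: "\<exists>a\<in>carrier G. (\<forall>n::nat. n > 0 \<longrightarrow> a [^] n \<noteq> \<one>) \<and>
      (\<exists>R. finite R \<and> R \<subseteq> carrier G \<and> (\<forall>g\<in>carrier G. \<exists>r\<in>R. \<exists>k::int. g = a [^] k \<otimes> r))"
    if c: "c = 1"
  proof -
    obtain a R' where a: "a \<in> N" "\<forall>n::nat. n > 0 \<longrightarrow> a [^] n \<noteq> \<one>" "finite R'" "R' \<subseteq> N"
      "\<forall>g\<in>N. \<exists>r\<in>R'. \<exists>k::int. g = a [^]\<^bsub>G\<lparr>carrier := N\<rparr>\<^esub> k \<otimes> r"
      using tame_virtually_cyclic[OF tame c] by (auto simp: nat_pow_consistent[symmetric])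
    define R'' where "R'' = (\<lambda>(r, s). r \<otimes> s) ` (R' \<times> R)"
    have cover: "\<exists>r\<in>R''. \<exists>k::int. g = a [^] k \<otimes> r" if g: "g \<in> carrier G" for g
    proof -
      obtain s n where sn: "s \<in> R" "n \<in> N" "g = n \<otimes> s" using decomp[OF g] by blast
      obtain r k where "r \<in> R'" "n = a [^]\<^bsub>G\<lparr>carrier := N\<rparr>\<^esub> (k::int) \<otimes> r"
        using bspec[OF a(5) sn(2)] by blast
      then have rk: "r \<in> R'" "n = a [^] k \<otimes> r" using int_pow_consistent[OF N a(1)] by simp_all
      have "a \<in> carrier G" "r \<in> carrier G" "s \<in> carrier G" using a(1,4) rk(1) sn(1) R(2) N.subset by auto
      then have "g = a [^] k \<otimes> (r \<otimes> s)" using sn(3) rk(2) by (simp add: m_assoc)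
      moreover have "r \<otimes> s \<in> R''" using sn(1) rk(1) by (force simp: R''_def)
      ultimately show ?thesis by blast
    qed
    have "R' \<subseteq> carrier G" using a(4) N.subset by blast
    then have R'': "finite R''" "R'' \<subseteq> carrier G"
      using a(3) R(1,2) by (auto simp: R''_def)
    have "a \<in> carrier G" using a(1) by simp
    then show ?thesis by (intro bexI[of _ a] conjI exI[of _ R''] ballI a(2) R'' cover)
  qed
  have 6: "forces G finite" if c: "2 \<le> c"
  proof (rule forces_mono)
    show "forces G (\<lambda>S. \<exists>T. finite T \<and> S \<inter> N \<subseteq> T)"
      by (rule forces_induced[OF N tame_forces[OF tame c]])
    fix x :: "'a \<Rightarrow> nat" assume "\<exists>T. finite T \<and> periods G x \<inter> N \<subseteq> T"
    then have "finite (periods G x \<inter> N)" by (meson finite_subset)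
    then show "finite (periods G x)"
    proof (rule finite_of_finite_index[OF subgroup_periods N _ R(1)])
      show "\<exists>r\<in>R. r \<in> carrier G \<and> s \<in> N #> r" if "s \<in> periods G x" for s
        using R(2,3) subgroup.mem_carrier[OF subgroup_periods that] by blast
    qed
  qed
  show ?thesis unfolding tame_def by (intro conjI impI 1 2 3 4 5 6)
qed

section \<open>Cyclic subgroups and commuting pairs\<close>

lemma (in group) range_int_pow_subgroup:
  assumes "y \<in> carrier G"
  shows "subgroup (range (\<lambda>j::int. y [^] j)) G" "generate G {y} = range (\<lambda>j::int. y [^] j)"
proof -
  show "generate G {y} = range (\<lambda>j::int. y [^] j)" using generate_pow[OF assms] by auto
  then show "subgroup (range (\<lambda>j::int. y [^] j)) G"
    using generate_is_subgroup[of "{y}"] assms by simp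
qed

text \<open>Graded by the exponent, an infinite cyclic group has trivial level zero.\<close>

lemma (in group) amenable_cyclic:
  assumes y: "y \<in> carrier G" "\<And>n::nat. n > 0 \<Longrightarrow> y [^] n \<noteq> \<one>"
  shows "amenable (G\<lparr>carrier := range (\<lambda>j::int. y [^] j)\<rparr>)"
proof -
  let ?Y = "range (\<lambda>j::int. y [^] j)"
  define lev where "lev g = (THE j::int. g = y [^] j)" for g
  have lev: "lev (y [^] j) = j" for j :: int
    unfolding lev_def using int_pow_inj[OF y] by (intro the_equality) auto
  interpret Y: graded_group "G\<lparr>carrier := ?Y\<rparr>" lev y
  proof (intro graded_group.intro graded_group_axioms.intro)
    show "group (G\<lparr>carrier := ?Y\<rparr>)"
      using range_int_pow_subgroup(1)[OF y(1)] by (rule subgroup_imp_group)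
    have y1: "y = y [^] (1::int)" using y(1) by simp
    then show "y \<in> carrier (G\<lparr>carrier := ?Y\<rparr>)" by (simp add: range_eqI[of _ _ 1])
    show "lev y = 1" using lev[of 1] y(1) by simp
    show "lev (g \<otimes>\<^bsub>G\<lparr>carrier := ?Y\<rparr>\<^esub> h) = lev g + lev h"
      if "g \<in> carrier (G\<lparr>carrier := ?Y\<rparr>)" "h \<in> carrier (G\<lparr>carrier := ?Y\<rparr>)" for g h
      using that y(1) by (auto simp: lev int_pow_mult[symmetric])
  qed
  have lz: "Y.level_zero = {\<one>}"
  proof
    show "Y.level_zero \<subseteq> {\<one>}" by (auto simp: Y.level_zero_def lev)
    show "{\<one>} \<subseteq> Y.level_zero" using subgroup.one_closed[OF Y.subgroup_level_zero] by simp
  qed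
  have "group (G\<lparr>carrier := {\<one>}\<rparr>)" using triv_subgroup by (rule subgroup_imp_group)
  then have "amenable (G\<lparr>carrier := {\<one>}\<rparr>)" by (rule amenable_trivial) simp
  then show ?thesis using Y.amenable_graded by (simp add: lz)
qed

text \<open>Grading \<open>\<langle>x, y\<rangle> \<cong> \<int>\<^sup>2\<close> by the exponent of \<open>x\<close> confines the periods to \<open>\<langle>y\<rangle>\<close>.\<close>
lemma (in group) forces_independent:
  assumes x: "x \<in> carrier G" and y: "y \<in> carrier G" and comm: "x \<otimes> y = y \<otimes> x"
    and indep: "\<And>(i::int) (j::int). x [^] i \<otimes> y [^] j = \<one> \<Longrightarrow> i = 0 \<and> j = 0"
  shows "forces G (\<lambda>S. \<exists>T. (\<forall>i::int. x [^] i \<in> T \<longrightarrow> i = 0) \<and> S \<inter> range (\<lambda>i::int. x [^] i) \<subseteq> T)"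
proof -
  define H where "H = {x [^] i \<otimes> y [^] j | (i::int) (j::int). True}"
  have comm': "y [^] (j::int) \<otimes> x [^] (i::int) = x [^] i \<otimes> y [^] j" for i j
  proof -
    have 1: "inv z \<otimes> w = w \<otimes> inv z" if "z \<in> carrier G" "w \<in> carrier G" "z \<otimes> w = w \<otimes> z" for z w
      using that by (metis inv_closed inv_solve_left inv_solve_right m_assoc m_closed)
    have 2: "z [^] (n::nat) \<otimes> w = w \<otimes> z [^] n" if "z \<in> carrier G" "w \<in> carrier G" "z \<otimes> w = w \<otimes> z" for z w n
    proof (induction n)
      case (Suc n)
      have "z [^] Suc n \<otimes> w = z [^] n \<otimes> (w \<otimes> z)" using that by (simp add: m_assoc)
      also have "\<dots> = w \<otimes> z [^] n \<otimes> z" using that Suc by (simp add: m_assoc[symmetric])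
      finally show ?case using that by (simp add: m_assoc)
    qed (use that in simp)
    have 3: "z [^] (n::int) \<otimes> w = w \<otimes> z [^] n" if "z \<in> carrier G" "w \<in> carrier G" "z \<otimes> w = w \<otimes> z" for z w n
    proof (cases n rule: int_cases2)
      case (nonneg m)
      then show ?thesis using 2[OF that] by (simp add: int_pow_int)
    next
      case (nonpos m)
      then show ?thesis using 1[OF _ that(2) 2[OF that], of m] that(1) by (simp add: int_pow_neg_int)
    qed
    show ?thesis using 3[OF y _ 3[OF x y comm, symmetric]] x by simp
  qed
  have mult: "(x [^] i \<otimes> y [^] j) \<otimes> (x [^] k \<otimes> y [^] l) = x [^] (i + k) \<otimes> y [^] (j + l)"
    for i j k l :: int
  proof -
    have "(x [^] i \<otimes> y [^] j) \<otimes> (x [^] k \<otimes> y [^] l) = x [^] i \<otimes> (y [^] j \<otimes> x [^] k) \<otimes> y [^] l"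
      using x y by (simp add: m_assoc)
    then show ?thesis using x y by (simp add: comm' m_assoc int_pow_mult)
  qed
  have inj: "i = k \<and> j = l" if eq: "x [^] i \<otimes> y [^] j = x [^] k \<otimes> y [^] l" for i j k l :: int
  proof -
    have "x [^] (i - k) \<otimes> y [^] (j - l) = (x [^] i \<otimes> y [^] j) \<otimes> (x [^] (-k) \<otimes> y [^] (-l))"
      by (simp add: mult)
    also have "\<dots> = \<one>" unfolding eq by (simp add: mult)
    finally show ?thesis using indep[of "i - k" "j - l"] by simp
  qed
  have H: "subgroup H G"
  proof (rule subgroupI)
    show "H \<subseteq> carrier G" using x y by (auto simp: H_def)
    show "H \<noteq> {}" by (auto simp: H_def)
    show "a \<otimes> b \<in> H" if ab: "a \<in> H" "b \<in> H" for a b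
    proof -
      obtain i j where "a = x [^] (i::int) \<otimes> y [^] (j::int)" using ab(1) by (auto simp: H_def)
      moreover obtain k l where "b = x [^] (k::int) \<otimes> y [^] (l::int)" using ab(2) by (auto simp: H_def)
      ultimately show ?thesis using mult by (auto simp: H_def)
    qed
    show "inv a \<in> H" if aH: "a \<in> H" for a
    proof -
      obtain i j where a: "a = x [^] (i::int) \<otimes> y [^] (j::int)" using aH by (auto simp: H_def)
      have "inv a = x [^] (- i) \<otimes> y [^] (- j)"
        using mult[of "-i" "-j" i j] x y by (intro inv_equality) (auto simp: a)
      then show ?thesis by (auto simp: H_def)
    qed
  qed
  have mem: "x [^] (i::int) \<in> H" "y [^] (j::int) \<in> H" for i j
  proof -
    have "x [^] i = x [^] i \<otimes> y [^] (0::int)" "y [^] j = x [^] (0::int) \<otimes> y [^] j" using x y by simp_all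
    then show "x [^] i \<in> H" "y [^] j \<in> H" unfolding H_def by blast+
  qed
  have xyH: "x \<in> H" "y \<in> H" using mem(1)[of 1] mem(2)[of 1] x y by simp_all
  let ?H = "G\<lparr>carrier := H\<rparr>"
  \<comment> \<open>The exponent of \<open>x\<close> is unique by \<open>inj\<close>, that is, by
    independence of \<open>x\<close> and \<open>y\<close>.\<close>
  define lev where "lev g = (THE i::int. \<exists>j::int. g = x [^] i \<otimes> y [^] j)" for g
  have lev: "lev (x [^] i \<otimes> y [^] j) = i" for i j :: int
    unfolding lev_def using inj by (intro the_equality) auto
  interpret Z: graded_group ?H lev x
  proof (intro graded_group.intro graded_group_axioms.intro)
    show "group ?H" using H by (rule subgroup_imp_group)
    show "x \<in> carrier ?H" using xyH by simp
    show "lev x = 1" using lev[of 1 0] x by simp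
    show "lev (g \<otimes>\<^bsub>?H\<^esub> h) = lev g + lev h" if "g \<in> carrier ?H" "h \<in> carrier ?H" for g h
      using that by (auto simp: H_def mult lev)
  qed
  have lz: "Z.level_zero = range (\<lambda>j::int. y [^] j)"
  proof
    show "Z.level_zero \<subseteq> range (\<lambda>j::int. y [^] j)"
    proof
      fix g assume "g \<in> Z.level_zero"
      then have "g \<in> H" "lev g = 0" unfolding Z.level_zero_def by simp_all
      then obtain i j where "g = x [^] (i::int) \<otimes> y [^] (j::int)" "lev g = 0" by (auto simp: H_def)
      then have "g = y [^] j" using y by (simp add: lev)
      then show "g \<in> range (\<lambda>j::int. y [^] j)" by blast
    qed
    show "range (\<lambda>j::int. y [^] j) \<subseteq> Z.level_zero"
    proof clarify
      fix j :: int
      have "lev (y [^] j) = 0" using lev[of 0 j] y by simp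
      then show "y [^] j \<in> Z.level_zero" unfolding Z.level_zero_def using mem(2) by simp
    qed
  qed
  have y_inf: "y [^] n \<noteq> \<one>" if "n > 0" for n :: nat
    using indep[of 0 "int n"] that y by (auto simp: int_pow_int)
  have "forces ?H (\<lambda>S. S \<subseteq> Z.level_zero)"
  proof (rule Z.forces_level_zero[of "{y}" y])
    show "y \<in> Z.level_zero" unfolding lz using y by (intro range_eqI[of _ _ 1]) simp
    then show "{y} \<subseteq> Z.level_zero" by simp
    show "generate ?H {y} = Z.level_zero"
      using generate_consistent[of "{y}" H] H xyH range_int_pow_subgroup(2)[OF y] by (simp add: lz)
    show "amenable (?H\<lparr>carrier := Z.level_zero\<rparr>)"
      using amenable_cyclic[OF y y_inf] by (simp add: lz)
    show "y [^]\<^bsub>?H\<^esub> n \<noteq> \<one>\<^bsub>?H\<^esub>" if "n > 0" for n :: nat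
      using y_inf[OF that] by (simp add: nat_pow_consistent[symmetric])
  qed simp
  \<comment> \<open>Only periods in \<open>H\<close> are controlled in \<open>G\<close>. That is
    enough here, since the powers of \<open>x\<close> lie in \<open>H\<close> and meet the powers of
    \<open>y\<close> trivially.\<close>
  then have "forces G (\<lambda>S. \<exists>T. T \<subseteq> Z.level_zero \<and> S \<inter> H \<subseteq> T)" by (rule forces_induced[OF H])
  then show ?thesis
  proof (rule forces_mono)
    fix z :: "'a \<Rightarrow> nat" assume "\<exists>T. T \<subseteq> Z.level_zero \<and> periods G z \<inter> H \<subseteq> T"
    then have sub: "periods G z \<inter> H \<subseteq> Z.level_zero" by blast
    have "i = 0" if "x [^] i \<in> Z.level_zero" for i :: int
    proof -
      obtain j :: int where "x [^] i = y [^] j" using \<open>x [^] i \<in> Z.level_zero\<close> unfolding lz by blast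
      then show ?thesis using inj[of i 0 0 j] x y by simp
    qed
    then show "\<exists>T. (\<forall>i::int. x [^] i \<in> T \<longrightarrow> i = 0) \<and> periods G z \<inter> range (\<lambda>i::int. x [^] i) \<subseteq> T"
      using sub mem(1) by (intro exI[of _ "Z.level_zero"]) blast
  qed
qed

context graded_group
begin

lemma level_zeroI: "g \<in> carrier G \<Longrightarrow> lev g = 0 \<Longrightarrow> g \<in> level_zero"
  by (simp add: level_zero_def)

lemma lev_level_zero: "g \<in> level_zero \<Longrightarrow> lev g = 0"
  by (simp add: level_zero_def)

text \<open>The subgroup generated by all \<open>M\<close>-th powers is cyclic and invariant under conjugation by \<open>t\<close>,
  which can only fix or invert its generator.\<close>
lemma virtually_cyclic_commuting_square:
  assumes a: "a \<in> level_zero" "\<And>n::nat. n > 0 \<Longrightarrow> a [^] n \<noteq> \<one>"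
    and R: "finite R" "R \<subseteq> level_zero" "\<And>g. g \<in> level_zero \<Longrightarrow> \<exists>r\<in>R. \<exists>k::int. g = a [^] k \<otimes> r"
  obtains c R' where "c \<in> level_zero" "\<And>n::nat. n > 0 \<Longrightarrow> c [^] n \<noteq> \<one>"
    "c \<otimes> (t \<otimes> t) = t \<otimes> t \<otimes> c"
    "finite R'" "R' \<subseteq> level_zero" "\<And>g. g \<in> level_zero \<Longrightarrow> \<exists>r\<in>R'. g \<in> range (\<lambda>k::int. c [^] k) #> r"
proof -
  interpret N: subgroup level_zero G by (rule subgroup_level_zero)
  have aG: "a \<in> carrier G" using a(1) by simp
  \<comment> \<open>Among the first \<open>card R + 1\<close> powers of \<open>h\<close>, two lie in
    the same coset of the powers of \<open>a\<close>. The difference of their exponents is at most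
    \<open>card R\<close>, hence divides the factorial \<open>M\<close>.\<close>
  define M where "M = (fact (card R) :: nat)"
  have power: "\<exists>k::int. h [^] M = a [^] k" if h: "h \<in> level_zero" for h
  proof -
    have hG: "h \<in> carrier G" using h by simp
    have "\<forall>i::nat. \<exists>r. r \<in> R \<and> (\<exists>k::int. h [^] i = a [^] k \<otimes> r)"
    proof
      fix i :: nat
      have "h [^] i \<in> level_zero" using hG lev_level_zero[OF h] by (intro level_zeroI) (simp_all add: lev_nat_pow)
      then show "\<exists>r. r \<in> R \<and> (\<exists>k::int. h [^] i = a [^] k \<otimes> r)" using R(3) by blast
    qed
    then obtain \<rho> where \<rho>: "\<And>i::nat. \<rho> i \<in> R" "\<And>i::nat. \<exists>k::int. h [^] i = a [^] k \<otimes> \<rho> i"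
      by metis
    have "\<not> inj_on \<rho> {..card R}"
    proof
      assume "inj_on \<rho> {..card R}"
      then have "card {..card R} \<le> card R"
        using card_inj_on_le[of \<rho> "{..card R}" R] \<rho>(1) R(1) by blast
      then show False by simp
    qed
    then obtain i j where ij: "i < j" "j \<le> card R" "\<rho> i = \<rho> j"
      unfolding inj_on_def by (metis atMost_iff linorder_neqE_nat)
    obtain k l where kl: "h [^] i = a [^] (k::int) \<otimes> \<rho> i" "h [^] j = a [^] (l::int) \<otimes> \<rho> i"
      using \<rho>(2)[of i] \<rho>(2)[of j] ij(3) by auto
    have rG: "\<rho> i \<in> carrier G" using \<rho>(1)[of i] R(2) by auto
    have "h [^] (j - i) \<otimes> h [^] i = h [^] j" using hG ij(1) by (simp add: nat_pow_mult)
    then have "h [^] (j - i) = h [^] j \<otimes> inv (h [^] i)"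
      using hG by (metis inv_solve_right nat_pow_closed)
    also have "\<dots> = a [^] l \<otimes> inv (a [^] k)"
      unfolding kl using aG rG by (simp add: inv_mult_group m_assoc) (simp add: m_assoc[symmetric])
    also have "\<dots> = a [^] (l - k)" using aG by (simp add: int_pow_diff)
    finally have hd: "h [^] (j - i) = a [^] (l - k)" .
    have "(j - i) dvd M" using ij by (simp add: M_def dvd_fact)
    then obtain q where q: "M = (j - i) * q" by blast
    have "h [^] M = (a [^] (l - k)) [^] q" using hG by (simp add: q nat_pow_pow[symmetric] hd)
    also have "\<dots> = a [^] ((l - k) * int q)" using aG by (simp add: int_pow_pow int_pow_int[symmetric])
    finally show ?thesis by blast
  qed
  define A where "A = range (\<lambda>k::int. a [^] k)"
  \<comment> \<open>The powers of \<open>a\<close> need not be stable under conjugation. The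
    \<open>M\<close>-th powers of elements of \<open>level_zero\<close> are permuted by it, and the
    group they generate is still cyclic, being contained in \<open>A\<close>.\<close>
  define C where "C = generate G {h [^] M | h. h \<in> level_zero}"
  have gens: "{h [^] M | h. h \<in> level_zero} \<subseteq> A" using power by (auto simp: A_def)
  have AG: "subgroup A G" unfolding A_def by (rule range_int_pow_subgroup(1)[OF aG])
  have gensG: "{h [^] M | h. h \<in> level_zero} \<subseteq> carrier G" by auto
  have C: "subgroup C G" unfolding C_def by (rule generate_is_subgroup[OF gensG])
  have CA: "C \<subseteq> A" unfolding C_def by (rule generate_subgroup_incl[OF gens AG])
  have conj_hom: "(\<lambda>x. g \<otimes> x \<otimes> inv g) \<in> hom G G" if "g \<in> carrier G" for g
    using that by (intro homI) (simp_all add: m_assoc inv_solve_left)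
  have conj_nat: "g \<otimes> x [^] n \<otimes> inv g = (g \<otimes> x \<otimes> inv g) [^] n"
    if "g \<in> carrier G" "x \<in> carrier G" for g x and n :: nat
    using hom_nat_pow[OF conj_hom[OF that(1)] that(2) is_group is_group] .
  have conj_int: "g \<otimes> x [^] n \<otimes> inv g = (g \<otimes> x \<otimes> inv g) [^] n"
    if "g \<in> carrier G" "x \<in> carrier G" for g x and n :: int
    using hom_int_pow[OF conj_hom[OF that(1)] that(2) is_group is_group] .
  have conj_C: "g \<otimes> x \<otimes> inv g \<in> C" if g: "g \<in> carrier G" and x: "x \<in> C" for g x
    using x unfolding C_def
  proof (induction rule: generate.induct)
    case one
    then show ?case using g by (simp add: generate.one)
  next
    case (incl x)
    then obtain h where h: "h \<in> level_zero" "x = h [^] M" by blast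
    have "g \<otimes> x \<otimes> inv g = (g \<otimes> h \<otimes> inv g) [^] M" using g h by (simp add: conj_nat)
    then show ?case using level_zero_conj(1)[OF h(1) g] by (intro generate.incl) blast
  next
    case (inv x)
    then obtain h where h: "h \<in> level_zero" "x = h [^] M" by blast
    have "g \<otimes> inv x \<otimes> inv g = inv (g \<otimes> x \<otimes> inv g)" using g h by (simp add: inv_mult_group m_assoc)
    also have "g \<otimes> x \<otimes> inv g = (g \<otimes> h \<otimes> inv g) [^] M" using g h by (simp add: conj_nat)
    finally show ?case using level_zero_conj(1)[OF h(1) g] by (auto intro!: generate.inv)
  next
    case (eng x y)
    have "x \<in> carrier G" "y \<in> carrier G" using eng.hyps generate_in_carrier[OF gensG] by auto
    then have "g \<otimes> (x \<otimes> y) \<otimes> inv g = (g \<otimes> x \<otimes> inv g) \<otimes> (g \<otimes> y \<otimes> inv g)"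
      using g by (simp add: m_assoc inv_solve_left)
    then show ?case using generate.eng[OF eng.IH] by simp
  qed
  have "a [^] M \<in> C" unfolding C_def using a(1) by (intro generate.incl) blast
  moreover have "M > 0" by (simp add: M_def)
  ultimately have ex: "\<exists>d::nat. d > 0 \<and> a [^] d \<in> C" by blast
  \<comment> \<open>Division with remainder by the least positive exponent shows that
    \<open>a [^] d\<close> generates \<open>C\<close>.\<close>
  define d where "d = (LEAST d::nat. d > 0 \<and> a [^] d \<in> C)"
  have d: "d > 0" "a [^] d \<in> C" using LeastI_ex[OF ex] by (simp_all add: d_def)
  have d_least: "d \<le> n" if "n > 0" "a [^] n \<in> C" for n :: nat
    unfolding d_def using that by (intro Least_le) simp
  define c where "c = a [^] d"
  have cG: "c \<in> carrier G" using aG by (simp add: c_def)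
  have c_pow: "c [^] (k::int) = a [^] (int d * k)" for k
    using aG by (simp add: c_def int_pow_int[symmetric] int_pow_pow)
  have C_cyclic: "\<exists>k::int. x = c [^] k" if x: "x \<in> C" for x
  proof -
    obtain k :: int where k: "x = a [^] k" using x CA by (auto simp: A_def)
    have "a [^] (k mod int d) = x \<otimes> inv (c [^] (k div int d))"
      using aG by (simp add: k c_pow int_pow_diff[symmetric] minus_mult_div_eq_mod)
    also have "\<dots> \<in> C"
      using x d(2) C subgroup.m_closed[OF C] subgroup.m_inv_closed[OF C] subgroup_int_pow_closed[OF C]
      by (simp add: c_def)
    finally have "a [^] nat (k mod int d) \<in> C"
      using d(1) by (simp add: int_pow_int[symmetric])
    moreover have "nat (k mod int d) < d" using d(1) by (simp add: nat_less_iff)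
    ultimately have "nat (k mod int d) = 0" using d_least[of "nat (k mod int d)"] by linarith
    then have "k mod int d = 0"
      using d(1) by (metis nat_0_iff of_nat_0_less_iff order_antisym pos_mod_sign)
    then have "k = int d * (k div int d)" by (metis add.right_neutral mult_div_mod_eq)
    then show ?thesis using k c_pow by metis
  qed
  have c_inf: "c [^] n \<noteq> \<one>" if "n > 0" for n :: nat
    using a(2)[of "d * n"] d(1) that aG by (simp add: c_def nat_pow_pow)
  obtain i :: int where i: "t \<otimes> c \<otimes> inv t = c [^] i"
    using C_cyclic[OF conj_C[OF t_closed d(2)]] by (auto simp: c_def)
  obtain l :: int where l: "inv t \<otimes> c \<otimes> t = c [^] l"
    using C_cyclic[OF conj_C[OF inv_closed[OF t_closed] d(2)]] by (auto simp: c_def)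
  have "c = t \<otimes> (inv t \<otimes> c \<otimes> t) \<otimes> inv t" using cG by (simp add: m_assoc) (simp add: m_assoc[symmetric])
  also have "\<dots> = c [^] (i * l)" unfolding l using cG i by (simp add: conj_int int_pow_pow)
  finally have "c [^] (1::int) = c [^] (i * l)" using cG by simp
  \<comment> \<open>Conjugation by \<open>t\<close> and by its inverse raise \<open>c\<close> to the
    powers \<open>i\<close> and \<open>l\<close>; hence \<open>i\<close> is 1 or -1, and conjugating
    twice by \<open>t\<close> fixes \<open>c\<close>.\<close>
  then have "i * l = 1" using int_pow_inj[of c 1 "i * l"] cG c_inf by simp
  then have ii: "i * i = 1" by (auto simp: zmult_eq_1_iff)
  have "t \<otimes> (t \<otimes> c \<otimes> inv t) \<otimes> inv t = c [^] (i * i)"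
    unfolding i using cG by (simp add: conj_int i int_pow_pow)
  also have "\<dots> = c" using ii cG by simp
  finally have eq: "t \<otimes> (t \<otimes> c \<otimes> inv t) \<otimes> inv t = c" .
  have "c \<otimes> (t \<otimes> t) = t \<otimes> (t \<otimes> c \<otimes> inv t) \<otimes> inv t \<otimes> (t \<otimes> t)" unfolding eq by simp
  also have "\<dots> = t \<otimes> t \<otimes> c"
  proof -
    have "inv t \<otimes> (t \<otimes> t) = t" by (simp add: m_assoc[symmetric])
    then show ?thesis using cG by (simp add: m_assoc)
  qed
  finally have comm: "c \<otimes> (t \<otimes> t) = t \<otimes> t \<otimes> c" .
  \<comment> \<open>Passing from \<open>a\<close> to \<open>c\<close> leaves the remainders of
    exponents modulo \<open>d\<close>, which join the old representatives.\<close>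
  define R' where "R' = (\<lambda>(i, r). a [^] (i::nat) \<otimes> r) ` ({..<d} \<times> R)"
  have "finite R'" using R(1) by (simp add: R'_def)
  moreover have "R' \<subseteq> level_zero"
  proof
    fix g assume "g \<in> R'"
    then obtain i r where g: "r \<in> R" "g = a [^] (i::nat) \<otimes> r" by (auto simp: R'_def)
    have "r \<in> level_zero" using g(1) R(2) by blast
    then show "g \<in> level_zero"
      unfolding g(2) using aG lev_level_zero[OF a(1)] lev_level_zero[of r]
      by (intro level_zeroI) (simp_all add: lev_mult lev_nat_pow)
  qed
  moreover have "\<exists>r\<in>R'. g \<in> range (\<lambda>k::int. c [^] k) #> r" if g: "g \<in> level_zero" for g
  proof -
    obtain r k where r: "r \<in> R" "g = a [^] (k::int) \<otimes> r" using R(3)[OF g] by blast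
    have rG: "r \<in> carrier G" using r(1) R(2) by auto
    have "a [^] k = c [^] (k div int d) \<otimes> a [^] (k mod int d)"
      using aG by (simp add: c_pow int_pow_mult[symmetric])
    also have "a [^] (k mod int d) = a [^] nat (k mod int d)"
      using d(1) by (simp add: int_pow_int[symmetric])
    finally have "g = c [^] (k div int d) \<otimes> (a [^] nat (k mod int d) \<otimes> r)"
      using r(2) aG rG cG by (simp add: m_assoc)
    moreover have "a [^] nat (k mod int d) \<otimes> r \<in> R'"
      using d(1) r(1) by (auto simp: R'_def nat_less_iff intro!: image_eqI[of _ _ "(nat (k mod int d), r)"])
    ultimately show ?thesis by (auto simp: r_coset_def)
  qed
  moreover have "c \<in> level_zero"
    unfolding c_def using aG lev_level_zero[OF a(1)] by (intro level_zeroI) (simp_all add: lev_nat_pow)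
  ultimately show ?thesis using that c_inf comm by blast
qed

text \<open>Kari's rule needs an element of infinite order in \<open>level_zero\<close>, so a
  subshift becomes available once \<open>c\<close> is nonzero. For \<open>c = 0\<close> the new
  clause is the virtually cyclic one, with \<open>t\<close> as generator.\<close>

lemma tame_graded:
  assumes tame: "tame (G\<lparr>carrier := level_zero\<rparr>) c"
  shows "tame G (Suc c)"
proof -
  interpret N: subgroup level_zero G by (rule subgroup_level_zero)
  obtain K where K: "finite K" "K \<subseteq> level_zero" "generate (G\<lparr>carrier := level_zero\<rparr>) K = level_zero"
    using tame_fg[OF tame] by auto
  have genK: "generate G K = level_zero" using generate_consistent[OF K(2) subgroup_level_zero] K(3) by simp
  have KtG: "insert t K \<subseteq> carrier G" using K(2) N.subset by auto
  have t_pow: "lev (t [^] (n::nat)) = int n" for n by (simp add: lev_nat_pow lev_t)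
  then have t_inf: "t [^] n \<noteq> \<one>" if "n > 0" for n :: nat
    using that by (metis lev_one of_nat_0_eq_iff less_irrefl)
  have "generate G (insert t K) = carrier G"
  proof
    show "generate G (insert t K) \<subseteq> carrier G" by (rule generate_incl[OF KtG])
    show "carrier G \<subseteq> generate G (insert t K)"
    proof
      fix g assume g: "g \<in> carrier G"
      have sub: "subgroup (generate G (insert t K)) G" by (rule generate_is_subgroup[OF KtG])
      have "g \<otimes> t [^] (- lev g) \<in> generate G (insert t K)"
        using level_decomp(1)[OF g] mono_generate[of K "insert t K"] genK by blast
      moreover have "t [^] lev g \<in> generate G (insert t K)"
        by (rule subgroup_int_pow_closed[OF sub]) (simp add: generate.incl)
      ultimately show "g \<in> generate G (insert t K)"
        using subgroup.m_closed[OF sub] level_decomp(2)[OF g] by metis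
    qed
  qed
  then have 1: "\<exists>K. finite K \<and> K \<subseteq> carrier G \<and> generate G K = carrier G"
    using K(1) KtG by (intro exI[of _ "insert t K"]) auto
  have 2: "amenable G" by (rule amenable_graded[OF tame_amenable[OF tame]])
  have 4: "\<exists>e\<in>carrier G. \<forall>n::nat. n > 0 \<longrightarrow> e [^] n \<noteq> \<one>" using t_inf by blast
  have 5: "\<exists>a\<in>carrier G. (\<forall>n::nat. n > 0 \<longrightarrow> a [^] n \<noteq> \<one>) \<and>
      (\<exists>R. finite R \<and> R \<subseteq> carrier G \<and> (\<forall>g\<in>carrier G. \<exists>r\<in>R. \<exists>k::int. g = a [^] k \<otimes> r))"
    if c: "Suc c = 1"
  proof -
    \<comment> \<open>The kernel is finite and serves as the set of representatives.\<close>
    have fin: "finite level_zero" using tame_finite[OF tame] c by simp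
    have cover: "\<exists>r\<in>level_zero. \<exists>k::int. g = t [^] k \<otimes> r" if g: "g \<in> carrier G" for g
    proof -
      have "t [^] (- lev g) \<otimes> g \<in> level_zero"
        using g by (intro level_zeroI) (simp_all add: lev_mult lev_int_pow lev_t)
      moreover have "t [^] lev g \<otimes> t [^] (- lev g) = \<one>" by (subst int_pow_mult[symmetric]) simp_all
      then have "g = t [^] lev g \<otimes> (t [^] (- lev g) \<otimes> g)" using g by (simp add: m_assoc[symmetric])
      ultimately show ?thesis by blast
    qed
    show ?thesis
      by (intro bexI[of _ t] conjI exI[of _ level_zero] allI impI ballI fin cover N.subset t_closed t_inf)
  qed
  have 6: "forces G finite" if c: "2 \<le> Suc c"
  proof -
    have "c \<noteq> 0" using c by simp
    then obtain e where e: "e \<in> level_zero" "\<And>n::nat. n > 0 \<Longrightarrow> e [^] n \<noteq> \<one>"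
      using tame_infinite_order[OF tame] by (auto simp: nat_pow_consistent[symmetric])
    have level: "forces G (\<lambda>S. S \<subseteq> level_zero)"
      by (rule forces_level_zero[OF K(1,2) genK tame_amenable[OF tame] e])
    show ?thesis
    proof (cases "c = 1")
      case False
      then have "2 \<le> c" using c by simp
      then have "forces G (\<lambda>S. \<exists>T. finite T \<and> S \<inter> level_zero \<subseteq> T)"
        by (intro forces_induced[OF subgroup_level_zero] tame_forces[OF tame])
      from forces_conj[OF level this] show ?thesis
      proof (rule forces_mono)
        fix x :: "'a \<Rightarrow> nat"
        assume "\<exists>T T'. T \<subseteq> level_zero \<and> (\<exists>U. finite U \<and> T' \<inter> level_zero \<subseteq> U) \<and>
          periods G x \<subseteq> T \<and> periods G x \<subseteq> T'"
        then obtain U where "finite U" "periods G x \<subseteq> U" by blast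
        then show "finite (periods G x)" by (rule finite_subset[rotated])
      qed
    next
      case True
      obtain a R where a: "a \<in> level_zero" "\<forall>n::nat. n > 0 \<longrightarrow> a [^] n \<noteq> \<one>" "finite R" "R \<subseteq> level_zero"
        "\<forall>g\<in>level_zero. \<exists>r\<in>R. \<exists>k::int. g = a [^]\<^bsub>G\<lparr>carrier := level_zero\<rparr>\<^esub> k \<otimes> r"
        using tame_virtually_cyclic[OF tame True] by (auto simp: nat_pow_consistent[symmetric])
      have cover: "\<exists>r\<in>R. \<exists>k::int. g = a [^] k \<otimes> r" if "g \<in> level_zero" for g
        using bspec[OF a(5) that] int_pow_consistent[OF subgroup_level_zero a(1)] by simp
      have a_inf: "\<And>n::nat. n > 0 \<Longrightarrow> a [^] n \<noteq> \<one>" using a(2) by blast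
      obtain b R' where b: "b \<in> level_zero" "\<And>n::nat. n > 0 \<Longrightarrow> b [^] n \<noteq> \<one>"
        "b \<otimes> (t \<otimes> t) = t \<otimes> t \<otimes> b" "finite R'" "R' \<subseteq> level_zero"
        "\<And>g. g \<in> level_zero \<Longrightarrow> \<exists>r\<in>R'. g \<in> range (\<lambda>k::int. b [^] k) #> r"
        using virtually_cyclic_commuting_square[OF a(1) a_inf a(3,4) cover] by blast
      have bG: "b \<in> carrier G" using b(1) by simp
      let ?B = "range (\<lambda>k::int. b [^] k)"
      \<comment> \<open>The level of the product is 2j, which separates the two exponents.\<close>
      have indep: "i = 0 \<and> j = 0" if eq: "b [^] (i::int) \<otimes> (t \<otimes> t) [^] (j::int) = \<one>" for i j
      proof -
        have "lev (b [^] i \<otimes> (t \<otimes> t) [^] j) = 2 * j"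
          using bG lev_level_zero[OF b(1)] by (simp add: lev_mult lev_int_pow lev_t)
        then have "j = 0" unfolding eq by simp
        then have "b [^] i = \<one>" using eq bG by simp
        then show ?thesis using int_pow_eq_one_imp[OF bG b(2)] \<open>j = 0\<close> by blast
      qed
      \<comment> \<open>This is the second grading, by the exponent of \<open>b\<close>: on the copy
        of the integer plane it leaves only powers of \<open>t \<otimes> t\<close> as periods,
        whereas \<open>level\<close> excludes those.\<close>
      have "forces G (\<lambda>S. \<exists>T. (\<forall>i::int. b [^] i \<in> T \<longrightarrow> i = 0) \<and> S \<inter> ?B \<subseteq> T)"
        by (rule forces_independent[OF bG _ b(3) indep]) simp
      from forces_conj[OF level this] show ?thesis
      proof (rule forces_mono)
        fix x :: "'a \<Rightarrow> nat"
        assume "\<exists>T T'. T \<subseteq> level_zero \<and> (\<exists>U. (\<forall>i::int. b [^] i \<in> U \<longrightarrow> i = 0) \<and> T' \<inter> ?B \<subseteq> U) \<and>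
          periods G x \<subseteq> T \<and> periods G x \<subseteq> T'"
        then obtain U where U: "periods G x \<subseteq> level_zero" "\<forall>i::int. b [^] i \<in> U \<longrightarrow> i = 0"
          "periods G x \<inter> ?B \<subseteq> U" by blast
        \<comment> \<open>The powers of \<open>b\<close> have finite index in
          \<open>level_zero\<close>, which contains all periods, and no nontrivial power of
          \<open>b\<close> is a period.\<close>
        show "finite (periods G x)"
        proof (rule finite_of_finite_index[OF subgroup_periods range_int_pow_subgroup(1)[OF bG] _ b(4)])
          have "periods G x \<inter> ?B \<subseteq> {b [^] (0::int)}"
          proof
            fix g assume g: "g \<in> periods G x \<inter> ?B"
            then obtain k :: int where k: "g = b [^] k" by blast
            then have "b [^] k \<in> U" using g U(3) by blast
            then have "k = 0" using U(2) by blast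
            then show "g \<in> {b [^] (0::int)}" using k by simp
          qed
          then show "finite (periods G x \<inter> ?B)" by (rule finite_subset) simp
          show "\<exists>r\<in>R'. r \<in> carrier G \<and> s \<in> ?B #> r" if "s \<in> periods G x" for s
            using b(5,6) U(1) that N.subset by blast
        qed
      qed
    qed
  qed
  show ?thesis unfolding tame_def by (intro conjI impI 1 2 4 5 6) simp
qed

end

section \<open>Series of virtually polycyclic groups\<close>

lemma (in normal) rcos_eq_iff:
  assumes "x \<in> carrier G" "y \<in> carrier G"
  shows "H #> x = H #> y \<longleftrightarrow> x \<otimes> inv y \<in> H"
proof
  assume "H #> x = H #> y"
  then have "x \<in> H #> y" using rcos_self[OF assms(1) is_subgroup] by simp
  then show "x \<otimes> inv y \<in> H" using rcos_module_imp[OF is_group assms(2)] by simp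
next
  assume "x \<otimes> inv y \<in> H"
  then have "x \<in> H #> y" using rcos_module_rev[OF is_group assms(2,1)] by simp
  then show "H #> x = H #> y" using repr_independence[OF _ assms(2) is_subgroup] by simp
qed

lemma (in normal) cyclic_factor_iff:
  "cyclic_group (G Mod H) \<longleftrightarrow> (\<exists>t\<in>carrier G. \<forall>g\<in>carrier G. \<exists>k::int. H #> g = H #> (t [^] k))"
proof -
  interpret Q: group "G Mod H" by (rule factorgroup_is_group)
  have "cyclic_group (G Mod H) \<longleftrightarrow>
      (\<exists>t\<in>carrier G. carrier (G Mod H) = range (\<lambda>k::int. H #> (t [^] k)))"
    unfolding Q.cyclic_group by (auto simp: carrier_FactGroup FactGroup_int_pow)
  also have "\<dots> \<longleftrightarrow> (\<exists>t\<in>carrier G. \<forall>g\<in>carrier G. \<exists>k::int. H #> g = H #> (t [^] k))"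
  proof (intro bex_cong refl)
    fix t assume t: "t \<in> carrier G"
    have "range (\<lambda>k::int. H #> (t [^] k)) \<subseteq> carrier (G Mod H)"
      using t by (auto simp: carrier_FactGroup)
    then have "carrier (G Mod H) = range (\<lambda>k::int. H #> (t [^] k)) \<longleftrightarrow>
        carrier (G Mod H) \<subseteq> range (\<lambda>k::int. H #> (t [^] k))" by blast
    also have "\<dots> \<longleftrightarrow> (\<forall>g\<in>carrier G. \<exists>k::int. H #> g = H #> (t [^] k))"
      unfolding carrier_FactGroup image_subset_iff by auto
    finally show "carrier (G Mod H) = range (\<lambda>k::int. H #> (t [^] k)) \<longleftrightarrow>
        (\<forall>g\<in>carrier G. \<exists>k::int. H #> g = H #> (t [^] k))" .
  qed
  finally show ?thesis .
qed

text \<open>The level of an element is its exponent in the factor group. Exponents are unique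
  because a generator of finite order would make the factor finite.\<close>

lemma (in normal) infinite_cyclic_factor_grading:
  assumes cyc: "cyclic_group (G Mod H)" and inf: "infinite (carrier (G Mod H))"
  obtains lev t where "graded_group G lev t" "graded_group.level_zero G lev = H"
proof -
  interpret Q: group "G Mod H" by (rule factorgroup_is_group)
  obtain t where t: "t \<in> carrier G" "\<And>g. g \<in> carrier G \<Longrightarrow> \<exists>k::int. H #> g = H #> (t [^] k)"
    using cyc unfolding cyclic_factor_iff by blast
  define \<tau> where "\<tau> = H #> t"
  have \<tau>: "\<tau> \<in> carrier (G Mod H)" using t(1) by (auto simp: \<tau>_def carrier_FactGroup)
  have \<tau>_pow: "\<tau> [^]\<^bsub>G Mod H\<^esub> k = H #> (t [^] k)" for k :: int
    using FactGroup_int_pow[OF t(1)] by (simp add: \<tau>_def)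
  have carr: "carrier (G Mod H) = range (\<lambda>k::int. \<tau> [^]\<^bsub>G Mod H\<^esub> k)"
  proof
    show "carrier (G Mod H) \<subseteq> range (\<lambda>k::int. \<tau> [^]\<^bsub>G Mod H\<^esub> k)"
      using t(2) by (force simp: carrier_FactGroup \<tau>_pow)
  qed (use \<tau> in auto)
  have \<tau>_inf: "\<tau> [^]\<^bsub>G Mod H\<^esub> n \<noteq> \<one>\<^bsub>G Mod H\<^esub>" if "n > 0" for n :: nat
  proof
    assume one: "\<tau> [^]\<^bsub>G Mod H\<^esub> n = \<one>\<^bsub>G Mod H\<^esub>"
    have "\<tau> [^]\<^bsub>G Mod H\<^esub> k = \<tau> [^]\<^bsub>G Mod H\<^esub> (k mod int n)" for k :: int
    proof -
      have "\<tau> [^]\<^bsub>G Mod H\<^esub> k = \<tau> [^]\<^bsub>G Mod H\<^esub> (int n * (k div int n) + k mod int n)" by simp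
      also have "\<dots> = (\<tau> [^]\<^bsub>G Mod H\<^esub> int n) [^]\<^bsub>G Mod H\<^esub> (k div int n) \<otimes>\<^bsub>G Mod H\<^esub> \<tau> [^]\<^bsub>G Mod H\<^esub> (k mod int n)"
        using \<tau> by (simp only: Q.int_pow_mult Q.int_pow_pow)
      also have "\<tau> [^]\<^bsub>G Mod H\<^esub> int n = \<one>\<^bsub>G Mod H\<^esub>" using one by (simp only: int_pow_int)
      finally show ?thesis using \<tau> by (simp only: Q.int_pow_one Q.l_one Q.int_pow_closed)
    qed
    moreover have "k mod int n \<in> {0..<int n}" for k using that by simp
    ultimately have "carrier (G Mod H) \<subseteq> (\<lambda>k::int. \<tau> [^]\<^bsub>G Mod H\<^esub> k) ` {0..<int n}"
      unfolding carr by blast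
    then have "finite (carrier (G Mod H))" by (rule finite_subset) simp
    then show False using inf by simp
  qed
  have inj: "k = l" if "H #> (t [^] k) = H #> (t [^] l)" for k l :: int
    using Q.int_pow_inj[OF \<tau>, of k l] \<tau>_inf that by (simp add: \<tau>_pow)
  define lev where "lev g = (THE k::int. H #> g = H #> (t [^] k))" for g
  have lev_eq: "lev g = k" if "H #> g = H #> (t [^] k)" for g k
    unfolding lev_def using that inj by (intro the_equality) auto
  have lev: "H #> g = H #> (t [^] lev g)" if g: "g \<in> carrier G" for g
    using t(2)[OF g] lev_eq[of g] by auto
  have graded: "graded_group G lev t"
  proof (intro graded_group.intro graded_group_axioms.intro is_group t(1))
    show "lev t = 1" using lev_eq[of t 1] t(1) by simp
    show "lev (g \<otimes> h) = lev g + lev h" if gh: "g \<in> carrier G" "h \<in> carrier G" for g h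
    proof (rule lev_eq)
      have "H #> (g \<otimes> h) = (H #> g) <#> (H #> h)" using gh by (simp add: rcos_sum)
      also have "\<dots> = (H #> (t [^] lev g)) <#> (H #> (t [^] lev h))" using lev[OF gh(1)] lev[OF gh(2)] by simp
      also have "\<dots> = H #> (t [^] (lev g + lev h))" using t(1) by (simp add: rcos_sum int_pow_mult)
      finally show "H #> (g \<otimes> h) = H #> (t [^] (lev g + lev h))" .
    qed
  qed
  moreover have "graded_group.level_zero G lev = H"
  proof -
    have H0: "g \<in> H \<longleftrightarrow> lev g = 0" if g: "g \<in> carrier G" for g
    proof
      assume "g \<in> H"
      then have "H #> g = H #> (t [^] (0::int))" using g coset_join2[OF g is_subgroup] subset by simp
      then show "lev g = 0" by (rule lev_eq)
    next
      assume "lev g = 0"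
      then have "H #> g = H" using lev[OF g] subset by simp
      then show "g \<in> H" using coset_join1[OF _ g is_subgroup] by simp
    qed
    then show ?thesis unfolding graded_group.level_zero_def[OF graded] using subset by blast
  qed
  ultimately show ?thesis using that by blast
qed

text \<open>The factor of \<open>M\<close> embeds in that of \<open>G\<close>, and subgroups of
  cyclic groups are cyclic; both facts are carried out on exponents modulo \<open>H\<close>.\<close>

lemma (in normal) cyclic_factor_Int_subgroup:
  assumes cyc: "cyclic_group (G Mod H)" and M: "subgroup M G"
  shows "cyclic_group (G\<lparr>carrier := M\<rparr> Mod (H \<inter> M))"
proof -
  interpret M: subgroup M G by fact
  obtain t where t: "t \<in> carrier G" "\<And>g. g \<in> carrier G \<Longrightarrow> \<exists>k::int. H #> g = H #> (t [^] k)"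
    using cyc unfolding cyclic_factor_iff by blast
  \<comment> \<open>The exponents realized by \<open>M\<close> form a subgroup of the integers; its
    least positive element, if any, yields the generator.\<close>
  define D where "D = {k::int. \<exists>m\<in>M. H #> m = H #> (t [^] k)}"
  have D_diff: "k - l \<in> D" if kl: "k \<in> D" "l \<in> D" for k l
  proof -
    obtain m n where mn: "m \<in> M" "H #> m = H #> (t [^] k)" "n \<in> M" "H #> n = H #> (t [^] l)"
      using kl by (auto simp: D_def)
    have "H #> (m \<otimes> inv n) = (H #> m) <#> set_inv (H #> n)" using mn(1,3) by (simp add: rcos_sum rcos_inv)
    also have "\<dots> = H #> (t [^] (k - l))" using t(1) by (simp add: mn rcos_sum rcos_inv int_pow_diff)
    finally show ?thesis using mn(1,3) unfolding D_def by blast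
  qed
  have pow: "H #> (s [^] q) = H #> (t [^] (k * q))" if "s \<in> M" "H #> s = H #> (t [^] k)" for s and k q :: int
  proof -
    have "H #> (s [^] q) = (H #> (t [^] k)) [^]\<^bsub>G Mod H\<^esub> q"
      using FactGroup_int_pow[of s q] that by simp
    also have "\<dots> = H #> ((t [^] k) [^] q)" using FactGroup_int_pow[of "t [^] k" q] t(1) by simp
    finally show ?thesis using t(1) by (simp add: int_pow_pow)
  qed
  have "\<exists>s\<in>M. \<forall>m\<in>M. \<exists>q::int. H #> m = H #> (s [^] q)"
  proof (cases "\<exists>d::nat. d > 0 \<and> int d \<in> D")
    case True
    define d where "d = (LEAST d::nat. d > 0 \<and> int d \<in> D)"
    have d: "d > 0" "int d \<in> D" using LeastI_ex[OF True] by (simp_all add: d_def)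
    have least: "d \<le> n" if "n > 0" "int n \<in> D" for n :: nat
      unfolding d_def using that by (intro Least_le) simp
    obtain s where s: "s \<in> M" "H #> s = H #> (t [^] int d)" using d(2) by (auto simp: D_def)
    have "\<exists>q::int. H #> m = H #> (s [^] q)" if m: "m \<in> M" for m
    proof -
      obtain k :: int where k: "H #> m = H #> (t [^] k)" using t(2)[of m] m by auto
      define q where "q = k div int d"
      have "s [^] q \<in> M" using subgroup_int_pow_closed[OF M s(1)] .
      then have "int d * q \<in> D" using pow[OF s] by (auto simp: D_def)
      moreover have "k \<in> D" using m k by (auto simp: D_def)
      ultimately have "k - int d * q \<in> D" using D_diff by blast
      then have modD: "k mod int d \<in> D" by (simp add: q_def minus_mult_div_eq_mod)
      have "k mod int d = 0"
      proof (rule ccontr)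
        assume "k mod int d \<noteq> 0"
        moreover have "0 \<le> k mod int d" "k mod int d < int d" using d(1) by simp_all
        ultimately have "nat (k mod int d) > 0" "int (nat (k mod int d)) \<in> D" "nat (k mod int d) < d"
          using modD by (auto simp: nat_less_iff)
        then show False using least[of "nat (k mod int d)"] by linarith
      qed
      then have "k = int d * q" unfolding q_def by (metis add.right_neutral mult_div_mod_eq)
      then show ?thesis using k pow[OF s, of q] by auto
    qed
    then show ?thesis using s(1) by blast
  next
    case False
    \<comment> \<open>Without positive elements \<open>D\<close> is zero, so \<open>M\<close> lies
      in \<open>H\<close> and the identity generates the factor.\<close>
    have "\<exists>q::int. H #> m = H #> (\<one> [^] q)" if m: "m \<in> M" for m
    proof -
      obtain k :: int where k: "H #> m = H #> (t [^] k)" using t(2)[of m] m by auto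
      then have "k \<in> D" using m by (auto simp: D_def)
      moreover have "- k \<in> D" using D_diff[OF D_diff[OF \<open>k \<in> D\<close> \<open>k \<in> D\<close>] \<open>k \<in> D\<close>] by simp
      moreover have "\<not> (0 < l \<and> l \<in> D)" for l :: int
        using False zero_less_imp_eq_int[of l] by blast
      ultimately have "k = 0" by (metis linorder_neqE_linordered_idom neg_0_less_iff_less)
      then show ?thesis using k by simp
    qed
    then show ?thesis using M.one_closed by blast
  qed
  then obtain s where s: "s \<in> M" "\<And>m. m \<in> M \<Longrightarrow> \<exists>q::int. H #> m = H #> (s [^] q)" by blast
  interpret R: normal "H \<inter> M" "G\<lparr>carrier := M\<rparr>"
    using normal_Int_subgroup[OF M normal_axioms] .
  have "\<exists>q::int. (H \<inter> M) #>\<^bsub>G\<lparr>carrier := M\<rparr>\<^esub> m = (H \<inter> M) #>\<^bsub>G\<lparr>carrier := M\<rparr>\<^esub> (s [^]\<^bsub>G\<lparr>carrier := M\<rparr>\<^esub> q)"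
    if m: "m \<in> M" for m
  proof -
    obtain q where q: "H #> m = H #> (s [^] (q::int))" using s(2)[OF m] by blast
    have sq: "s [^] q \<in> M" using subgroup_int_pow_closed[OF M s(1)] .
    have "m \<otimes> inv (s [^] q) \<in> H" using q rcos_eq_iff[of m "s [^] q"] m sq by simp
    then have "m \<otimes> inv (s [^] q) \<in> H \<inter> M" using m sq by simp
    then have "(H \<inter> M) #>\<^bsub>G\<lparr>carrier := M\<rparr>\<^esub> m = (H \<inter> M) #>\<^bsub>G\<lparr>carrier := M\<rparr>\<^esub> (s [^] q)"
      using R.rcos_eq_iff[of m "s [^] q"] m sq m_inv_consistent[OF M sq] by simp
    then show ?thesis using int_pow_consistent[OF M s(1)] by auto
  qed
  then show ?thesis unfolding R.cyclic_factor_iff using s(1) by auto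
qed

text \<open>The kernel of the action of \<open>G\<close> on the right cosets of \<open>H\<close>.\<close>
lemma (in group) normal_core:
  assumes H: "subgroup H G" and fin: "finite (rcosets H)"
  obtains N where "N \<lhd> G" "N \<subseteq> H" "finite (carrier (G Mod N))"
proof -
  interpret H: subgroup H G by fact
  define N where "N = {g \<in> carrier G. \<forall>x\<in>carrier G. H #> (x \<otimes> g) = H #> x}"
  have sub: "subgroup N G"
  proof (rule subgroupI)
    show "N \<noteq> {}" by (auto simp: N_def intro!: exI[of _ \<one>])
  next
    fix g assume g: "g \<in> N"
    have "H #> (x \<otimes> inv g) = H #> x" if x: "x \<in> carrier G" for x
    proof -
      have "H #> (x \<otimes> inv g \<otimes> g) = H #> (x \<otimes> inv g)" using g x by (simp add: N_def)
      then show ?thesis using g x by (simp add: N_def m_assoc)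
    qed
    then show "inv g \<in> N" using g by (simp add: N_def)
  qed (auto simp: N_def m_assoc[symmetric])
  have normal: "N \<lhd> G"
    unfolding normal_inv_iff
  proof (intro conjI ballI sub)
    fix a g assume a: "a \<in> carrier G" and g: "g \<in> N"
    have gG: "g \<in> carrier G" using g by (simp add: N_def)
    have "H #> (x \<otimes> (a \<otimes> g \<otimes> inv a)) = H #> x" if x: "x \<in> carrier G" for x
    proof -
      have "H #> (x \<otimes> (a \<otimes> g \<otimes> inv a)) = (H #> (x \<otimes> a \<otimes> g)) #> inv a"
        using a gG x by (simp add: coset_mult_assoc H.subset m_assoc)
      also have "H #> (x \<otimes> a \<otimes> g) = H #> (x \<otimes> a)" using g a x by (simp add: N_def)
      also have "(H #> (x \<otimes> a)) #> inv a = H #> x"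
        using a x by (simp add: coset_mult_assoc H.subset m_assoc)
      finally show ?thesis .
    qed
    then show "a \<otimes> g \<otimes> inv a \<in> N" using a gG by (simp add: N_def)
  qed
  have NH: "N \<subseteq> H"
  proof
    fix g assume g: "g \<in> N"
    then have "H #> (\<one> \<otimes> g) = H #> \<one>" unfolding N_def by blast
    then show "g \<in> H" using g coset_join1[OF _ _ H] H.subset by (simp add: N_def)
  qed
  \<comment> \<open>The action of \<open>g\<close> on the finite set of cosets. It determines
    \<open>g\<close> modulo \<open>N\<close>, so the factor has at most as many elements as there
    are maps of that set to itself.\<close>
  define \<Phi> where "\<Phi> g = (\<lambda>C\<in>rcosets H. C #> g)" for g
  have \<Phi>_range: "\<Phi> g \<in> (rcosets H) \<rightarrow>\<^sub>E (rcosets H)" if g: "g \<in> carrier G" for g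
  proof -
    have "C #> g \<in> rcosets H" if C: "C \<in> rcosets H" for C
    proof -
      obtain a where a: "a \<in> carrier G" "C = H #> a" using C by (auto simp: RCOSETS_def)
      then have "C #> g = H #> (a \<otimes> g)" using g by (simp add: coset_mult_assoc H.subset)
      then show ?thesis using a g by (auto simp: RCOSETS_def)
    qed
    then show ?thesis by (simp add: \<Phi>_def)
  qed
  have \<Phi>_inj: "N #> g = N #> h" if gh: "g \<in> carrier G" "h \<in> carrier G" and eq: "\<Phi> g = \<Phi> h" for g h
  proof -
    have "H #> (x \<otimes> (g \<otimes> inv h)) = H #> x" if x: "x \<in> carrier G" for x
    proof -
      have "H #> x \<in> rcosets H" using x by (auto simp: RCOSETS_def)
      then have "(H #> x) #> g = (H #> x) #> h" using fun_cong[OF eq, of "H #> x"] by (simp add: \<Phi>_def)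
      then have "H #> (x \<otimes> g) = H #> (x \<otimes> h)" using gh x by (simp add: coset_mult_assoc H.subset)
      then have "(H #> (x \<otimes> g)) #> inv h = (H #> (x \<otimes> h)) #> inv h" by simp
      then show ?thesis using gh x by (simp add: coset_mult_assoc H.subset m_assoc)
    qed
    then have "g \<otimes> inv h \<in> N" using gh by (simp add: N_def)
    then show ?thesis using normal.rcos_eq_iff[OF normal gh] by simp
  qed
  define \<Psi> where "\<Psi> \<phi> = N #> (SOME g. g \<in> carrier G \<and> \<Phi> g = \<phi>)" for \<phi>
  have "N #> g = \<Psi> (\<Phi> g)" if g: "g \<in> carrier G" for g
  proof -
    have "\<exists>h. h \<in> carrier G \<and> \<Phi> h = \<Phi> g" using g by blast
    from someI_ex[OF this] show ?thesis unfolding \<Psi>_def using \<Phi>_inj g by metis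
  qed
  then have "carrier (G Mod N) \<subseteq> \<Psi> ` ((rcosets H) \<rightarrow>\<^sub>E (rcosets H))"
    using \<Phi>_range by (auto simp: carrier_FactGroup)
  moreover have "finite ((rcosets H) \<rightarrow>\<^sub>E (rcosets H))" using fin by (intro finite_PiE) auto
  ultimately have "finite (carrier (G Mod N))" by (meson finite_imageI finite_subset)
  with normal NH show ?thesis using that by blast
qed

text \<open>The subgroup of finite index may fail to be normal, so it is replaced by its core
  \<open>N\<close>. Intersecting the polycyclic series with \<open>N\<close> keeps cyclic factors,
  and one finite factor is added at the top.\<close>

lemma (in group) virtually_polycyclic_imp_series:
  assumes "virtually_polycyclic G"
  shows "\<exists>Hs. cyclic_or_finite_series G Hs"
proof -
  obtain H where H: "subgroup H G" "finite (rcosets H)" "polycyclic (G\<lparr>carrier := H\<rparr>)"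
    using assms unfolding virtually_polycyclic_def by blast
  obtain Hs where Hs: "subnormal_series (G\<lparr>carrier := H\<rparr>) Hs"
    "\<And>i. Suc i < length Hs \<Longrightarrow> cyclic_group (series_factor (G\<lparr>carrier := H\<rparr>) Hs i)"
    using H(3) unfolding polycyclic_def by blast
  obtain N where N: "N \<lhd> G" "N \<subseteq> H" "finite (carrier (G Mod N))" using normal_core[OF H(1,2)] by blast
  have NG: "subgroup N G" using N(1) by (rule normal_imp_subgroup)
  have sub: "subgroup K G" if "K \<in> set Hs" for K
    using Hs(1) that incl_subgroup[OF H(1)] unfolding subnormal_series_def by blast
  define Ks where "Ks = map (\<lambda>K. K \<inter> N) Hs @ [carrier G]"
  let ?n = "length Hs"
  have n: "?n > 0" using Hs(1) by (simp add: subnormal_series_def)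
  have len: "length Ks = Suc ?n" by (simp add: Ks_def)
  have nth: "Ks ! i = Hs ! i \<inter> N" if "i < ?n" for i using that by (simp add: Ks_def nth_append)
  have nth_last: "Ks ! ?n = carrier G" by (simp add: Ks_def nth_append)
  have last: "Ks ! (?n - 1) = N"
  proof -
    have "Hs \<noteq> []" "last Hs = H" using Hs(1) by (simp_all add: subnormal_series_def)
    then have "Hs ! (?n - 1) = H" using last_conv_nth[of Hs] by simp
    then show ?thesis using nth[of "?n - 1"] n N(2) by auto
  qed
  have step: "Ks ! i \<lhd> G\<lparr>carrier := Ks ! Suc i\<rparr> \<and>
      (cyclic_group (series_factor G Ks i) \<or> finite (carrier (series_factor G Ks i)))"
    if i: "Suc i < length Ks" for i
  proof (cases "Suc i < ?n")
    case True
    let ?B = "Hs ! Suc i"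
    have B: "subgroup ?B G" using sub True by simp
    have nrm: "Hs ! i \<lhd> G\<lparr>carrier := ?B\<rparr>" using Hs(1) True by (simp add: subnormal_series_def)
    have cyc: "cyclic_group (G\<lparr>carrier := ?B\<rparr> Mod (Hs ! i))"
      using Hs(2)[OF True] by (simp add: series_factor_def)
    interpret B: normal "Hs ! i" "G\<lparr>carrier := ?B\<rparr>" by fact
    have "subgroup (?B \<inter> N) (G\<lparr>carrier := ?B\<rparr>)"
      using subgroup_incl[OF subgroups_Inter_pair[OF B NG] B] by simp
    from B.cyclic_factor_Int_subgroup[OF cyc this]
    have "cyclic_group (G\<lparr>carrier := ?B \<inter> N\<rparr> Mod (Hs ! i \<inter> (?B \<inter> N)))" by simp
    moreover have "Hs ! i \<inter> (?B \<inter> N) = Hs ! i \<inter> N" using B.subset by auto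
    ultimately have "cyclic_group (series_factor G Ks i)" using True by (simp add: series_factor_def nth)
    moreover have "Ks ! i \<lhd> G\<lparr>carrier := Ks ! Suc i\<rparr>"
      using normal_inter[OF B NG nrm] True by (simp add: nth)
    ultimately show ?thesis by blast
  next
    case False
    then have i_eq: "i = ?n - 1" "Suc i = ?n" using i n len by auto
    then have "Ks ! Suc i = carrier G" "Ks ! i = N" using nth_last last by simp_all
    then show ?thesis using N(1,3) by (simp add: series_factor_def)
  qed
  have "subnormal_series G Ks"
    unfolding subnormal_series_def
  proof (intro conjI allI impI ballI)
    show "Ks \<noteq> []" by (simp add: Ks_def)
    have "hd Hs = {\<one>}" "Hs \<noteq> []" using Hs(1) by (simp_all add: subnormal_series_def)
    then show "hd Ks = {\<one>}" using subgroup.one_closed[OF NG] by (simp add: Ks_def hd_append hd_map)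
    show "last Ks = carrier G" by (simp add: Ks_def)
    show "subgroup K G" if "K \<in> set Ks" for K
      using that sub NG subgroups_Inter_pair subgroup_self by (auto simp: Ks_def)
    show "Ks ! i \<lhd> G\<lparr>carrier := Ks ! Suc i\<rparr>" if "Suc i < length Ks" for i using step[OF that] by blast
  qed
  then show ?thesis unfolding cyclic_or_finite_series_def using step by blast
qed

section \<open>Induction along a series\<close>

lemma (in group) tame_factor:
  assumes N: "N \<lhd> G" and tame: "tame (G\<lparr>carrier := N\<rparr>) c"
    and "cyclic_group (G Mod N) \<or> finite (carrier (G Mod N))"
  shows "tame G (if infinite (carrier (G Mod N)) then Suc c else c)"
proof (cases "finite (carrier (G Mod N))")
  case True
  then have "finite (rcosets N)" by (simp add: FactGroup_def)
  then show ?thesis using tame_finite_extension[OF normal_imp_subgroup[OF N] _ tame] True by simp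
next
  case False
  then have "cyclic_group (G Mod N)" using assms(3) by blast
  then obtain lev t where graded: "graded_group G lev t" "graded_group.level_zero G lev = N"
    using normal.infinite_cyclic_factor_grading[OF N _ False] by blast
  then show ?thesis using graded_group.tame_graded[OF graded(1)] tame False by simp
qed

text \<open>Every infinite factor raises the index of \<open>tame\<close> by one and every finite
  factor keeps it. The result applies to whichever series \<open>hirsch_number\<close>
  picks.\<close>

lemma (in group) tame_infinite_factor_count:
  assumes "cyclic_or_finite_series G Hs"
  shows "tame G (infinite_factor_count G Hs)"
proof -
  have series: "Hs \<noteq> []" "hd Hs = {\<one>}" "last Hs = carrier G" "\<And>H. H \<in> set Hs \<Longrightarrow> subgroup H G"
    "\<And>i. Suc i < length Hs \<Longrightarrow> Hs ! i \<lhd> G\<lparr>carrier := Hs ! Suc i\<rparr>"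
    "\<And>i. Suc i < length Hs \<Longrightarrow>
      cyclic_group (series_factor G Hs i) \<or> finite (carrier (series_factor G Hs i))"
    using assms unfolding cyclic_or_finite_series_def subnormal_series_def by blast+
  let ?I = "\<lambda>i. {j. j < i \<and> infinite (carrier (series_factor G Hs j))}"
  have tame: "tame (G\<lparr>carrier := Hs ! i\<rparr>) (card (?I i))" if "i < length Hs" for i
    using that
  proof (induction i)
    case 0
    have "group (G\<lparr>carrier := {\<one>}\<rparr>)" using triv_subgroup by (rule subgroup_imp_group)
    then have "tame (G\<lparr>carrier := {\<one>}\<rparr>) 0" by (rule group.tame_trivial) simp
    then show ?case using series(1,2) by (simp add: hd_conv_nth)
  next
    case (Suc i)
    let ?B = "G\<lparr>carrier := Hs ! Suc i\<rparr>"
    have "group ?B" using subgroup_imp_group[OF series(4)] Suc.prems by simp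
    moreover have "tame (?B\<lparr>carrier := Hs ! i\<rparr>) (card (?I i))" using Suc by simp
    ultimately have "tame ?B (if infinite (carrier (?B Mod (Hs ! i))) then Suc (card (?I i)) else card (?I i))"
      using series(5,6)[OF Suc.prems] unfolding series_factor_def by (intro group.tame_factor)
    moreover have "?I (Suc i) = (if infinite (carrier (?B Mod (Hs ! i))) then insert i (?I i) else ?I i)"
      by (auto simp: series_factor_def less_Suc_eq)
    ultimately show ?case by (simp split: if_splits)
  qed
  have "infinite_factor_count G Hs = card (?I (length Hs - 1))"
    unfolding infinite_factor_count_def by (rule arg_cong[of _ _ card]) auto
  moreover have "Hs ! (length Hs - 1) = carrier G" using series(1,3) by (simp add: last_conv_nth)
  moreover have "length Hs - 1 < length Hs" using series(1) by simp
  ultimately show ?thesis using tame[of "length Hs - 1"] by simp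
qed

lemma (in group) forces_finite_of_finite:
  assumes "finite (carrier G)"
  shows "forces G finite"
proof (rule forcesI[of "{0 :: nat}" "{}" "\<lambda>_. True" "\<lambda>_. 0"])
  show "finite (periods G x)" for x :: "'a \<Rightarrow> nat"
    using assms by (auto simp: periods_def)
qed (auto simp: determined_on_def follows_def)

theorem theorem5:
  fixes G :: "('g, 'm) monoid_scheme"
  assumes "group G"
    and "virtually_polycyclic G"
    and "hirsch_number G \<noteq> 1"
  shows "\<exists>(A :: nat set) S. finite A \<and> is_SFT G A S \<and> strongly_aperiodic G S"
proof -
  interpret group G by fact
  have "cyclic_or_finite_series G (SOME Hs. cyclic_or_finite_series G Hs)"
    using virtually_polycyclic_imp_series[OF assms(2)] by (rule someI_ex)
  then have tame: "tame G (hirsch_number G)"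
    unfolding hirsch_number_def by (rule tame_infinite_factor_count)
  have "forces G finite"
  proof (cases "hirsch_number G = 0")
    case True
    then show ?thesis using forces_finite_of_finite tame_finite[OF tame] by blast
  next
    case False
    \<comment> \<open>With 0 and 1 excluded the Hirsch number is at least 2, where
      \<open>tame\<close> supplies a rule with finite period groups.\<close>
    then show ?thesis using assms(3) by (intro tame_forces[OF tame]) simp
  qed
  then show ?thesis by (rule forces_finite_imp_strongly_aperiodic)
qed

end
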